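(* The Polish groups $\mathrm{Isom}(\mathbf{H})$ and $\mathrm{Isom}(\mathcal{H})$ have the Steinhaus property.
   Context: $\mathcal{H}$ is an infinite-dimensional separable real Hilbert space with Hilbert basis $(e_i)_{i\in\mathbb{N}}$, and $\mathrm{Isom}(\mathcal{H})$ is the group of all isometries of $\mathcal{H}$ for the norm metric. Let $Q(x)=x_0^2-\sum_{i\ge1}x_i^2$ with polarized symmetric bilinear form $(\cdot,\cdot)$. The infinite-dimensional separable hyperbolic space is $\mathbf{H}=\{x\in\mathcal{H}: Q(x)=1,\ x_0>0\}$ with metric $\cosh d(x,y)=(x,y)$, and $\mathrm{Isom}(\mathbf{H})$ is its isometry group. Both isometry groups carry the topology of pointwise convergence (the coarsest group topology making all orbit maps $g\mapsto gx$ continuous), which is Polish. Let $G$ be a topological group. A subset $W\subset G$ is $\sigma$-syndetic if $G$ is the union of countably many left translates of $W$; it is symmetric if $W=W^{-1}$. $G$ has the Steinhaus property if there is a natural integer $k$ such that for every $\sigma$-syndetic symmetric subset $W\subset G$, the set $W^k=\{w_1\cdots w_k: w_i\in W\}$ contains an open neighborhood of the identity. *)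

theory Defs
  imports "HOL-Analysis.Analysis" "HOL-Algebra.Coset" "HOL-Algebra.Bij"
begin

locale topological_group = group G for G :: "('a, 'b) monoid_scheme" (structure) +
  fixes T :: "'a topology"
  assumes topspace_eq_carrier: "topspace T = carrier G"
    and continuous_map_mult: "continuous_map (prod_topology T T) T (\<lambda>(x, y). x \<otimes> y)"
    and continuous_map_inv: "continuous_map T T (\<lambda>x. inv x)"

definition sigma_syndetic :: "('a, 'b) monoid_scheme \<Rightarrow> 'a set \<Rightarrow> bool" where
  "sigma_syndetic G W \<longleftrightarrow>
     W \<subseteq> carrier G \<and>
     (\<exists>C. countable C \<and> C \<subseteq> carrier G \<and> carrier G = (\<Union>g\<in>C. g <#\<^bsub>G\<^esub> W))"

definition symmetric_subset :: "('a, 'b) monoid_scheme \<Rightarrow> 'a set \<Rightarrow> bool" where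
  "symmetric_subset G W \<longleftrightarrow> W \<subseteq> carrier G \<and> set_inv\<^bsub>G\<^esub> W = W"

primrec set_power :: "('a, 'b) monoid_scheme \<Rightarrow> 'a set \<Rightarrow> nat \<Rightarrow> 'a set" where
  "set_power G W 0 = {\<one>\<^bsub>G\<^esub>}"
| "set_power G W (Suc k) = set_power G W k <#>\<^bsub>G\<^esub> W"

definition steinhaus_property :: "('a, 'b) monoid_scheme \<Rightarrow> 'a topology \<Rightarrow> bool" where
  "steinhaus_property G T \<longleftrightarrow>
     topological_group G T \<and>
     (\<exists>k::nat. \<forall>W. sigma_syndetic G W \<and> symmetric_subset G W \<longrightarrow>
        (\<exists>U. openin T U \<and> \<one>\<^bsub>G\<^esub> \<in> U \<and> U \<subseteq> set_power G W k))"

definition isom_group :: "'a set \<Rightarrow> ('a \<Rightarrow> 'a \<Rightarrow> real) \<Rightarrow> ('a \<Rightarrow> 'a) monoid" where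
  "isom_group X d =
     (BijGroup X)\<lparr>carrier := {f \<in> Bij X. \<forall>x\<in>X. \<forall>y\<in>X. d (f x) (f y) = d x y}\<rparr>"

text \<open>
  The product topology is the initial topology for the evaluations \<open>f \<mapsto> f x\<close>, so this is
  the coarsest topology making every orbit map continuous. Lemma \<open>topological_group_isom\<close> below
  shows that it is a group topology, hence also the coarsest such group topology.
\<close>
definition isom_topology :: "'a set \<Rightarrow> ('a \<Rightarrow> 'a \<Rightarrow> real) \<Rightarrow> ('a \<Rightarrow> 'a) topology" where
  "isom_topology X d =
     subtopology (product_topology (\<lambda>_. Metric_space.mtopology X d) X) (carrier (isom_group X d))"

lemma carrier_isom_group:
  "carrier (isom_group X d) = {f \<in> Bij X. \<forall>x\<in>X. \<forall>y\<in>X. d (f x) (f y) = d x y}"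
  by (simp add: isom_group_def)

lemma subgroup_isom_group: "subgroup (carrier (isom_group X d)) (BijGroup X)"
proof (rule group.subgroupI[OF group_BijGroup])
  show "carrier (isom_group X d) \<subseteq> carrier (BijGroup X)"
    by (auto simp: carrier_isom_group BijGroup_def)
  have "(\<lambda>x\<in>X. x) \<in> carrier (isom_group X d)"
    by (auto simp: carrier_isom_group id_Bij)
  then show "carrier (isom_group X d) \<noteq> {}" by blast
next
  fix f assume f: "f \<in> carrier (isom_group X d)"
  then have B: "f \<in> Bij X" by (simp add: carrier_isom_group)
  have "d (inv_into X f x) (inv_into X f y) = d x y" if xy: "x \<in> X" "y \<in> X" for x y
  proof -
    have "f (inv_into X f z) = z" "inv_into X f z \<in> X" if "z \<in> X" for z
      using bij_betw_inv_into_right[of f X X z] Bij_inv_into_mem[OF B that] B that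
      by (simp_all add: Bij_def)
    note inv = this
    have "\<forall>x\<in>X. \<forall>y\<in>X. d (f x) (f y) = d x y"
      using f by (simp add: carrier_isom_group)
    then have "d (f (inv_into X f x)) (f (inv_into X f y)) = d (inv_into X f x) (inv_into X f y)"
      using inv xy by blast
    then show ?thesis by (simp add: inv[OF xy(1)] inv[OF xy(2)])
  qed
  then show "inv\<^bsub>BijGroup X\<^esub> f \<in> carrier (isom_group X d)"
    using B by (simp add: inv_BijGroup carrier_isom_group restrict_inv_into_Bij)
next
  fix f g assume fg: "f \<in> carrier (isom_group X d)" "g \<in> carrier (isom_group X d)"
  then have B: "f \<in> Bij X" "g \<in> Bij X" by (auto simp: carrier_isom_group)
  then have "g x \<in> X" if "x \<in> X" for x
    using Bij_imp_funcset that by blast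
  then show "f \<otimes>\<^bsub>BijGroup X\<^esub> g \<in> carrier (isom_group X d)"
    using fg B by (auto simp: carrier_isom_group BijGroup_def compose_Bij compose_eq)
qed

lemma group_isom_group: "group (isom_group X d)"
  using subgroup.subgroup_is_group[OF subgroup_isom_group group_BijGroup]
  by (simp add: isom_group_def)

lemma mult_isom_group:
  assumes "f \<in> carrier (isom_group X d)" "g \<in> carrier (isom_group X d)"
  shows "f \<otimes>\<^bsub>isom_group X d\<^esub> g = compose X f g"
  using assms by (simp add: isom_group_def BijGroup_def)

lemma inv_isom_group:
  assumes "f \<in> carrier (isom_group X d)"
  shows "inv\<^bsub>isom_group X d\<^esub> f = (\<lambda>x\<in>X. inv_into X f x)"
proof -
  have "inv\<^bsub>isom_group X d\<^esub> f = inv\<^bsub>BijGroup X\<^esub> f"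
    using group.m_inv_consistent[OF group_BijGroup subgroup_isom_group assms]
    by (simp add: isom_group_def)
  then show ?thesis using assms by (simp add: inv_BijGroup carrier_isom_group)
qed

context Metric_space
begin

lemma isom_mem: "f \<in> carrier (isom_group M d) \<Longrightarrow> x \<in> M \<Longrightarrow> f x \<in> M"
  using Bij_imp_funcset[of f M] by (auto simp: carrier_isom_group)

lemma topspace_isom_topology: "topspace (isom_topology M d) = carrier (isom_group M d)"
  using Bij_imp_funcset Bij_imp_extensional
  by (auto simp: isom_topology_def carrier_isom_group PiE_def)

lemma continuous_map_orbit:
  assumes "x \<in> M"
  shows "continuous_map (isom_topology M d) mtopology (\<lambda>f. f x)"
  unfolding isom_topology_def
  using continuous_map_from_subtopology[OF continuous_map_product_projection[OF assms]] by fast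

lemma openin_isom_ball:
  assumes "x \<in> M"
  shows "openin (isom_topology M d) {f \<in> carrier (isom_group M d). f x \<in> mball y r}"
  using openin_continuous_map_preimage[OF continuous_map_orbit[OF assms] openin_mball]
  by (simp add: topspace_isom_topology)

lemma continuous_map_into_isom_topology:
  "continuous_map S (isom_topology M d) F \<longleftrightarrow>
     F ` topspace S \<subseteq> carrier (isom_group M d) \<and>
     (\<forall>x\<in>M. continuous_map S mtopology (\<lambda>s. F s x))"
proof -
  have "F ` topspace S \<subseteq> extensional M" if "F ` topspace S \<subseteq> carrier (isom_group M d)"
    using that Bij_imp_extensional[of _ M] by (auto simp: carrier_isom_group)
  then show ?thesis
    unfolding isom_topology_def continuous_map_in_subtopology continuous_map_componentwise
      image_subset_iff_funcset[symmetric]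
    by blast
qed

theorem topological_group_isom: "topological_group (isom_group M d) (isom_topology M d)"
proof -
  let ?G = "isom_group M d" and ?T = "isom_topology M d"
  interpret G: group ?G by (rule group_isom_group)
  have mult: "continuous_map (prod_topology ?T ?T) ?T (\<lambda>(x, y). x \<otimes>\<^bsub>?G\<^esub> y)"
    unfolding continuous_map_into_isom_topology
  proof (intro conjI ballI)
    show "(\<lambda>(x, y). x \<otimes>\<^bsub>?G\<^esub> y) ` topspace (prod_topology ?T ?T) \<subseteq> carrier ?G"
      by (auto simp: topspace_isom_topology)
  next
    fix x assume x: "x \<in> M"
    show "continuous_map (prod_topology ?T ?T) mtopology (\<lambda>p. (case p of (x, y) \<Rightarrow> x \<otimes>\<^bsub>?G\<^esub> y) x)"
      unfolding continuous_map_to_metric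
    proof (intro ballI allI impI)
      fix p and \<epsilon> :: real assume p: "p \<in> topspace (prod_topology ?T ?T)" and e: "\<epsilon> > 0"
      obtain g h where gh: "p = (g, h)" "g \<in> carrier ?G" "h \<in> carrier ?G"
        using p by (auto simp: topspace_isom_topology)
      define A where "A = {f \<in> carrier ?G. f (h x) \<in> mball (g (h x)) (\<epsilon>/2)}"
      define B where "B = {f \<in> carrier ?G. f x \<in> mball (h x) (\<epsilon>/2)}"
      have "openin (prod_topology ?T ?T) (A \<times> B)"
        using openin_isom_ball[OF x] openin_isom_ball[OF isom_mem[OF gh(3) x]]
        unfolding A_def B_def openin_prod_Times_iff by blast
      moreover have "p \<in> A \<times> B"
        using gh e isom_mem[OF gh(3) x] isom_mem[OF gh(2) isom_mem[OF gh(3) x]]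
        by (simp add: A_def B_def)
      moreover have "(case q of (x, y) \<Rightarrow> x \<otimes>\<^bsub>?G\<^esub> y) x \<in> mball ((case p of (x, y) \<Rightarrow> x \<otimes>\<^bsub>?G\<^esub> y) x) \<epsilon>"
        if q: "q \<in> A \<times> B" for q
      proof -
        obtain a b where ab: "q = (a, b)" "a \<in> A" "b \<in> B" using q by auto
        then have c: "a \<in> carrier ?G" "b \<in> carrier ?G" by (auto simp: A_def B_def)
        have m: "h x \<in> M" "b x \<in> M" "a (b x) \<in> M" "g (h x) \<in> M" "a (h x) \<in> M"
          by (rule isom_mem[OF gh(3) x] isom_mem[OF c(2) x] isom_mem[OF c(1) isom_mem[OF c(2) x]]
              isom_mem[OF gh(2) isom_mem[OF gh(3) x]] isom_mem[OF c(1) isom_mem[OF gh(3) x]])+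
        have "d (a (h x)) (a (b x)) = d (h x) (b x)"
          using c m by (simp add: carrier_isom_group)
        moreover have "d (h x) (b x) < \<epsilon>/2" "d (g (h x)) (a (h x)) < \<epsilon>/2"
          using ab by (auto simp: A_def B_def)
        ultimately have "d (g (h x)) (a (b x)) < \<epsilon>"
          using triangle[OF m(4) m(5) m(3)] by linarith
        then show ?thesis
          using ab gh c m x by (simp add: mult_isom_group compose_def)
      qed
      ultimately show "\<exists>U. openin (prod_topology ?T ?T) U \<and> p \<in> U \<and>
          (\<forall>q\<in>U. (case q of (x, y) \<Rightarrow> x \<otimes>\<^bsub>?G\<^esub> y) x \<in> mball ((case p of (x, y) \<Rightarrow> x \<otimes>\<^bsub>?G\<^esub> y) x) \<epsilon>)"
        by blast
    qed
  qed
  have inv: "continuous_map ?T ?T (\<lambda>x. inv\<^bsub>?G\<^esub> x)"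
    unfolding continuous_map_into_isom_topology
  proof (intro conjI ballI)
    show "(\<lambda>x. inv\<^bsub>?G\<^esub> x) ` topspace ?T \<subseteq> carrier ?G"
      by (auto simp: topspace_isom_topology)
  next
    fix x assume x: "x \<in> M"
    have I: "(inv\<^bsub>?G\<^esub> f) x \<in> M \<and> f ((inv\<^bsub>?G\<^esub> f) x) = x" if f: "f \<in> carrier ?G" for f
    proof -
      have "f \<in> Bij M" using f by (simp add: carrier_isom_group)
      then show ?thesis
        using bij_betw_inv_into_right[of f M M x] Bij_inv_into_mem[of f M x] x f
        by (simp add: inv_isom_group Bij_def)
    qed
    show "continuous_map ?T mtopology (\<lambda>f. (inv\<^bsub>?G\<^esub> f) x)"
      unfolding continuous_map_to_metric
    proof (intro ballI allI impI)
      fix g and \<epsilon> :: real assume "g \<in> topspace ?T" and e: "\<epsilon> > 0"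
      then have g: "g \<in> carrier ?G" by (simp add: topspace_isom_topology)
      define y where "y = (inv\<^bsub>?G\<^esub> g) x"
      have y: "y \<in> M" "g y = x" using I[OF g] by (auto simp: y_def)
      define A where "A = {f \<in> carrier ?G. f y \<in> mball (g y) \<epsilon>}"
      have "openin ?T A" unfolding A_def by (rule openin_isom_ball[OF y(1)])
      moreover have "g \<in> A" using g y e x by (auto simp: A_def)
      moreover have "(inv\<^bsub>?G\<^esub> f) x \<in> mball y \<epsilon>" if "f \<in> A" for f
      proof -
        have f: "f \<in> carrier ?G" "d x (f y) < \<epsilon>" using that y by (auto simp: A_def)
        have "d y ((inv\<^bsub>?G\<^esub> f) x) = d (f y) (f ((inv\<^bsub>?G\<^esub> f) x))"
        proof -
          have "\<forall>x\<in>M. \<forall>y\<in>M. d (f x) (f y) = d x y"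
            using f(1) by (simp add: carrier_isom_group)
          then have "d (f y) (f ((inv\<^bsub>?G\<^esub> f) x)) = d y ((inv\<^bsub>?G\<^esub> f) x)"
            using I[OF f(1)] y(1) by blast
          then show ?thesis ..
        qed
        also have "\<dots> = d x (f y)" using I[OF f(1)] by (simp add: commute)
        finally show ?thesis using f(2) I[OF f(1)] y by simp
      qed
      ultimately show "\<exists>U. openin ?T U \<and> g \<in> U \<and> (\<forall>f\<in>U. (inv\<^bsub>?G\<^esub> f) x \<in> mball ((inv\<^bsub>?G\<^esub> g) x) \<epsilon>)"
        unfolding y_def by blast
    qed
  qed
  show ?thesis
    by unfold_locales (use topspace_isom_topology mult inv in auto)
qed

end

definition hilbert_basis :: "(nat \<Rightarrow> 'a::real_inner) \<Rightarrow> bool" where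
  "hilbert_basis e \<longleftrightarrow>
     (\<forall>i j. e i \<bullet> e j = (if i = j then 1 else 0)) \<and> closure (span (range e)) = UNIV"

text \<open>The coordinate \<open>x\<^sub>i\<close> of \<open>x\<close> in the basis \<open>e\<close> is \<open>x \<bullet> e i\<close>.\<close>

definition hyp_quad :: "(nat \<Rightarrow> 'a::real_inner) \<Rightarrow> 'a \<Rightarrow> real" where
  "hyp_quad e x = (x \<bullet> e 0)\<^sup>2 - (\<Sum>i. (x \<bullet> e (Suc i))\<^sup>2)"

definition hyp_form :: "(nat \<Rightarrow> 'a::real_inner) \<Rightarrow> 'a \<Rightarrow> 'a \<Rightarrow> real" where
  "hyp_form e x y = (hyp_quad e (x + y) - hyp_quad e x - hyp_quad e y) / 2"

definition hyp_space :: "(nat \<Rightarrow> 'a::real_inner) \<Rightarrow> 'a set" where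
  "hyp_space e = {x. hyp_quad e x = 1 \<and> x \<bullet> e 0 > 0}"

text \<open>
  The value outside \<open>hyp_space e\<close> is irrelevant; it is set to \<open>0\<close> because the locale
  \<open>Metric_space\<close> asks for a function that is nonnegative and symmetric everywhere.
\<close>
definition hyp_dist :: "(nat \<Rightarrow> 'a::real_inner) \<Rightarrow> 'a \<Rightarrow> 'a \<Rightarrow> real" where
  "hyp_dist e x y =
     (if x \<in> hyp_space e \<and> y \<in> hyp_space e then arcosh (hyp_form e x y) else 0)"

lemma parseval:
  assumes "hilbert_basis e"
  shows "(\<lambda>i. (x \<bullet> e i)\<^sup>2) sums (x \<bullet> x)"
proof -
  have on: "e i \<bullet> e j = (if i = j then 1 else 0)" for i j
    using assms by (simp add: hilbert_basis_def)
  define P where "P n = (\<Sum>i<n. (x \<bullet> e i) *\<^sub>R e i)" for n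
  have Pe: "P n \<bullet> e j = (if j < n then x \<bullet> e j else 0)" for n j
    by (simp add: P_def inner_sum_left on if_distrib[of "(*) _"] cong: if_cong)
  have orth: "(x - P n) \<bullet> v = 0" if "v \<in> span (e ` {..<n})" for n v
    using that
    by (induction rule: span_induct_alt) (auto simp: inner_add_right inner_diff_left Pe)
  have Pspan: "P n \<in> span (e ` {..<n})" for n
    unfolding P_def by (intro span_sum span_scale span_base) auto
  have PP: "x \<bullet> P n = (\<Sum>i<n. (x \<bullet> e i)\<^sup>2)" for n
    by (simp add: P_def inner_sum_right power2_eq_square)
  have best: "x \<bullet> x - (\<Sum>i<n. (x \<bullet> e i)\<^sup>2) \<le> (norm (x - v))\<^sup>2"
    if v: "v \<in> span (e ` {..<n})" for n v
  proof -
    have o: "(x - P n) \<bullet> (P n - v) = 0"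
      by (rule orth) (intro span_diff Pspan v)
    have "(norm (x - v))\<^sup>2 = (norm (x - P n))\<^sup>2 + (norm (P n - v))\<^sup>2"
      using norm_add_Pythagorean[of "x - P n" "P n - v"] o by (simp add: orthogonal_def)
    moreover have "(norm (x - P n))\<^sup>2 = x \<bullet> x - x \<bullet> P n"
      using orth[OF Pspan, of n]
      by (simp add: power2_norm_eq_inner inner_diff_left inner_diff_right inner_commute)
    ultimately show ?thesis using PP[of n] by simp
  qed
  have bessel: "(\<Sum>i<n. (x \<bullet> e i)\<^sup>2) \<le> x \<bullet> x" for n
  proof -
    have "0 \<le> (norm (x - P n))\<^sup>2" by simp
    also have "\<dots> = x \<bullet> x - x \<bullet> P n"
      using orth[OF Pspan, of n]
      by (simp add: power2_norm_eq_inner inner_diff_left inner_diff_right inner_commute)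
    finally show ?thesis using PP[of n] by simp
  qed
  show ?thesis
    unfolding sums_def
  proof (rule LIMSEQ_I)
    fix r :: real assume r: "r > 0"
    have "x \<in> closure (span (range e))" using assms by (simp add: hilbert_basis_def)
    then obtain v where v: "v \<in> span (range e)" "dist v x < sqrt r"
      using r unfolding closure_approachable by (meson real_sqrt_gt_zero)
    obtain S where S: "finite S" "S \<subseteq> range e" "v \<in> span S"
    proof -
      obtain S c where "finite S" "S \<subseteq> range e" "v = (\<Sum>a\<in>S. c a *\<^sub>R a)"
        using v(1) unfolding span_explicit by blast
      with that show ?thesis by (simp add: span_sum span_scale span_base)
    qed
    obtain N where N: "S \<subseteq> e ` {..<N}"
    proof -
      obtain I where I: "finite I" "S = e ` I" using S by (metis finite_subset_image)
      then obtain N where "I \<subseteq> {..<N}" using finite_nat_iff_bounded by blast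
      with I that show ?thesis by blast
    qed
    have "norm ((\<Sum>i<n. (x \<bullet> e i)\<^sup>2) - x \<bullet> x) < r" if "n \<ge> N" for n
    proof -
      have "v \<in> span (e ` {..<n})"
        by (rule subsetD[OF span_mono S(3)]) (use N that in fastforce)
      then have "x \<bullet> x - (\<Sum>i<n. (x \<bullet> e i)\<^sup>2) \<le> (norm (x - v))\<^sup>2" by (rule best)
      also have "\<dots> < (sqrt r)\<^sup>2"
        using v(2) by (intro power_strict_mono) (auto simp: dist_norm norm_minus_commute)
      finally show ?thesis using bessel[of n] r by simp
    qed
    then show "\<exists>N. \<forall>n\<ge>N. norm ((\<Sum>i<n. (x \<bullet> e i)\<^sup>2) - x \<bullet> x) < r" by blast
  qed
qed

lemma hyp_quad_eq:
  assumes "hilbert_basis e"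
  shows "hyp_quad e x = 2 * (x \<bullet> e 0)\<^sup>2 - x \<bullet> x"
proof -
  have "(\<lambda>i. (x \<bullet> e (Suc i))\<^sup>2) sums (x \<bullet> x - (x \<bullet> e 0)\<^sup>2)"
    using parseval[OF assms, of x] by (subst sums_Suc_iff) simp
  then show ?thesis by (simp add: hyp_quad_def sums_unique[symmetric])
qed

lemma hyp_form_eq:
  assumes "hilbert_basis e"
  shows "hyp_form e x y = 2 * (x \<bullet> e 0) * (y \<bullet> e 0) - x \<bullet> y"
  by (simp add: hyp_form_def hyp_quad_eq[OF assms] inner_add_left inner_add_right
      power2_eq_square inner_commute[of y x] field_simps)

lemma hyp_form_split:
  assumes "hilbert_basis e"
  defines "u \<equiv> \<lambda>x. x - (x \<bullet> e 0) *\<^sub>R e 0"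
  shows "hyp_form e x y = (x \<bullet> e 0) * (y \<bullet> e 0) - u x \<bullet> u y"
proof -
  have "e 0 \<bullet> e 0 = 1" using assms(1) by (simp add: hilbert_basis_def)
  then show ?thesis
    by (simp add: u_def hyp_form_eq[OF assms(1)] inner_diff_left inner_diff_right
        inner_commute[of "e 0" y])
qed

lemma hyp_space_iff:
  assumes "hilbert_basis e"
  shows "x \<in> hyp_space e \<longleftrightarrow> hyp_form e x x = 1 \<and> x \<bullet> e 0 > 0"
  by (simp add: hyp_space_def hyp_form_eq[OF assms] hyp_quad_eq[OF assms] power2_eq_square mult.assoc)

lemma hyp_form_ge_1:
  assumes "hilbert_basis e" "x \<in> hyp_space e" "y \<in> hyp_space e"
  shows "hyp_form e x y \<ge> 1 \<and> (hyp_form e x y = 1 \<longleftrightarrow> x = y)"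
proof -
  define a b where "a = x \<bullet> e 0" and "b = y \<bullet> e 0"
  define u v where "u = x - a *\<^sub>R e 0" and "v = y - b *\<^sub>R e 0"
  have pos: "a > 0" "b > 0" and uu: "u \<bullet> u = a\<^sup>2 - 1" and vv: "v \<bullet> v = b\<^sup>2 - 1"
    and B: "hyp_form e x y = a * b - u \<bullet> v"
    using assms(2,3) hyp_form_split[OF assms(1)]
    by (auto simp: hyp_space_iff[OF assms(1)] a_def b_def u_def v_def power2_eq_square)
  have ab: "a \<ge> 1" "b \<ge> 1"
    using uu vv pos inner_ge_zero[of u] inner_ge_zero[of v]
      power2_le_imp_le[of 1 a] power2_le_imp_le[of 1 b]
    by simp_all
  then have ab1: "a * b \<ge> 1" using mult_mono[of 1 a 1 b] by simp
  have cs: "(u \<bullet> v)\<^sup>2 \<le> (a\<^sup>2 - 1) * (b\<^sup>2 - 1)"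
    using Cauchy_Schwarz_ineq[of u v] uu vv by simp
  have eq: "(a\<^sup>2 - 1) * (b\<^sup>2 - 1) = (a * b - 1)\<^sup>2 - (a - b)\<^sup>2"
    by (simp add: power2_eq_square algebra_simps)
  have "(u \<bullet> v)\<^sup>2 \<le> (a * b - 1)\<^sup>2"
    using cs eq zero_le_power2[of "a - b"] by linarith
  then have le: "u \<bullet> v \<le> a * b - 1"
    by (rule power2_le_imp_le) (use ab1 in auto)
  moreover have "x = y" if "u \<bullet> v = a * b - 1"
  proof -
    have "(a - b)\<^sup>2 \<le> 0" using cs eq that by simp
    then have "a = b" by simp
    have "(u - v) \<bullet> (u - v) = 0"
      using uu vv that \<open>a = b\<close>
      by (simp add: inner_diff_left inner_diff_right inner_commute[of v u] power2_eq_square)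
    then show ?thesis using \<open>a = b\<close> by (simp add: u_def v_def)
  qed
  moreover have "hyp_form e x y = 1" if "x = y"
    using that assms(2) by (simp add: hyp_space_iff[OF assms(1)])
  ultimately show ?thesis using B by auto
qed

lemma hyp_form_nonpos_on_orthogonal:
  assumes "hilbert_basis e" "y \<in> hyp_space e" "hyp_form e w y = 0"
  shows "hyp_form e w w \<le> 0"
proof -
  define a b where "a = w \<bullet> e 0" and "b = y \<bullet> e 0"
  define u v where "u = w - a *\<^sub>R e 0" and "v = y - b *\<^sub>R e 0"
  have b: "b > 0" and vv: "v \<bullet> v = b\<^sup>2 - 1" and o: "a * b = u \<bullet> v"
    and B: "hyp_form e w w = a\<^sup>2 - u \<bullet> u"
    using assms(2,3) hyp_form_split[OF assms(1)]
    by (auto simp: hyp_space_iff[OF assms(1)] a_def b_def u_def v_def power2_eq_square)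
  have "a\<^sup>2 * b\<^sup>2 \<le> (u \<bullet> u) * (b\<^sup>2 - 1)"
    using Cauchy_Schwarz_ineq[of u v] o vv by (simp flip: power_mult_distrib)
  also have "\<dots> \<le> (u \<bullet> u) * b\<^sup>2" by (intro mult_left_mono) auto
  finally have "a\<^sup>2 \<le> u \<bullet> u" using b by simp
  then show ?thesis using B by simp
qed

theorem Metric_space_hyp:
  assumes e: "hilbert_basis e"
  shows "Metric_space (hyp_space e) (hyp_dist e)"
proof
  let ?B = "hyp_form e"
  note BE = hyp_form_eq[OF e]
  have sym: "?B x y = ?B y x" for x y by (simp add: BE inner_commute)
  fix x y
  show "0 \<le> hyp_dist e x y"
    using hyp_form_ge_1[OF e, of x y] by (simp add: hyp_dist_def)
  show "hyp_dist e x y = hyp_dist e y x"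
    by (simp add: hyp_dist_def sym)
  show "hyp_dist e x y = 0 \<longleftrightarrow> x = y" if "x \<in> hyp_space e" "y \<in> hyp_space e"
    using hyp_form_ge_1[OF e that] that by (simp add: hyp_dist_def)
next
  let ?B = "hyp_form e"
  note BE = hyp_form_eq[OF e]
  have sym: "?B x y = ?B y x" for x y by (simp add: BE inner_commute)
  fix x y z assume H: "x \<in> hyp_space e" "y \<in> hyp_space e" "z \<in> hyp_space e"
  define \<alpha> \<beta> \<gamma> where "\<alpha> = hyp_dist e x y" and "\<beta> = hyp_dist e y z" and "\<gamma> = hyp_dist e x z"
  have nn: "\<alpha> \<ge> 0" "\<beta> \<ge> 0" "\<gamma> \<ge> 0"
    and c: "cosh \<alpha> = ?B x y" "cosh \<beta> = ?B y z" "cosh \<gamma> = ?B x z"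
    using hyp_form_ge_1[OF e H(1,2)] hyp_form_ge_1[OF e H(2,3)] hyp_form_ge_1[OF e H(1,3)] H
    by (auto simp: \<alpha>_def \<beta>_def \<gamma>_def hyp_dist_def)
  have one: "?B x x = 1" "?B y y = 1" "?B z z = 1"
    using H by (auto simp: hyp_space_iff[OF e])
  have "\<gamma> \<le> \<alpha> + \<beta>"
  proof (cases "\<alpha> = 0 \<or> \<beta> = 0")
    case True
    then have "?B x y = 1 \<or> ?B y z = 1" using c by auto
    then have "x = y \<or> y = z"
      using hyp_form_ge_1[OF e H(1,2)] hyp_form_ge_1[OF e H(2,3)] by blast
    then have "\<gamma> = \<beta> \<or> \<gamma> = \<alpha>" unfolding \<alpha>_def \<beta>_def \<gamma>_def by blast
    then show ?thesis using nn by linarith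
  next
    case False
    define s r where "s = sinh \<alpha>" and "r = sinh \<beta>"
    have rs: "s > 0" "r > 0" using False nn by (auto simp: s_def r_def)
    have s2: "s\<^sup>2 = (?B x y)\<^sup>2 - 1" and r2: "r\<^sup>2 = (?B y z)\<^sup>2 - 1"
      by (simp_all add: s_def r_def sinh_square_eq c)
    define p q where "p = x - ?B x y *\<^sub>R y" and "q = z - ?B y z *\<^sub>R y"
    define w where "w = r *\<^sub>R p + s *\<^sub>R q"
    have add: "?B (f + g) h = ?B f h + ?B g h" and diff: "?B (f - g) h = ?B f h - ?B g h"
      and sc: "?B (k *\<^sub>R f) h = k * ?B f h" for f g h k
      by (simp_all add: BE inner_add_left inner_diff_left algebra_simps)
    have add': "?B h (f + g) = ?B h f + ?B h g" and diff': "?B h (f - g) = ?B h f - ?B h g"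
      and sc': "?B h (k *\<^sub>R f) = k * ?B h f" for f g h k
      by (simp_all add: BE inner_add_left inner_add_right inner_diff_left inner_diff_right
          algebra_simps)
    have py: "?B p y = 0" "?B q y = 0"
      by (simp_all add: p_def q_def diff sc one sym[of z y])
    have pp: "?B p p = - s\<^sup>2" and qq: "?B q q = - r\<^sup>2"
      and pq: "?B p q = ?B x z - ?B x y * ?B y z"
      by (simp_all add: p_def q_def diff sc diff' sc' one sym[of z y] sym[of y x] s2 r2)
        (simp_all add: power2_eq_square)
    have "?B w w \<le> 0"
      by (rule hyp_form_nonpos_on_orthogonal[OF e H(2)]) (simp add: w_def add sc py)
    moreover have "?B w w = 2 * (r * s) * (?B p q - r * s)"
      by (simp add: w_def add sc add' sc' pp qq sym[of q p] power2_eq_square algebra_simps)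
    ultimately have "?B p q \<le> r * s"
      using rs by (simp add: mult_le_0_iff)
    then have "cosh \<gamma> \<le> cosh (\<alpha> + \<beta>)"
      by (simp add: pq cosh_add c s_def r_def mult.commute)
    then show ?thesis using nn cosh_real_nonneg_le_iff[of \<gamma> "\<alpha> + \<beta>"] by auto
  qed
  then show "hyp_dist e x z \<le> hyp_dist e x y + hyp_dist e y z"
    by (simp add: \<alpha>_def \<beta>_def \<gamma>_def)
qed

end

theory Submission
  imports Defs
begin

text \<open>
  Both groups contain the orthogonal group of a separable Hilbert space as the stabilizer of a point,
  and the core of the proof is an argument in the style of Tsankov for this group. Let \<open>W\<close> be
  symmetric and \<open>\<sigma>\<close>-syndetic. A diagonal argument over infinitely many orthogonal blocks shows that
  \<open>W\<^sup>2\<close> induces every orthogonal map of some block; two such blocks, one inside the other, allow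
  commutators to be localized, and since every orthogonal map of a small enough block is a commutator, a power
  of \<open>W\<close> contains the pointwise fixer of a coinfinite set \<open>D\<close> of basis vectors. Among uncountably many
  permutations sending \<open>D\<close> to almost disjoint sets, two differ by an element of \<open>W\<^sup>2\<close>, which gives a second
  such set meeting \<open>D\<close> in a finite set only; the two fixers generate the fixer of the intersection
  in boundedly many steps, because every orthogonal map is a product of two maps with infinite-dimensional
  fixed spaces. Finally, uncountably many rotations of the remaining finite frame give an element of \<open>W\<^sup>2\<close>
  rotating this frame by an angle into its orthogonal complement, and three such rotations reach
  every nearby frame. All exponents are independent of \<open>W\<close>.

  Applied to the stabilizers of two points \<open>a\<close> and \<open>b\<close> on opposite sides of the base point, this moves
  the base point to every nearby point in two steps, one along a sphere around \<open>a\<close> and one along a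
  sphere around \<open>b\<close>.
\<close>

section \<open>Orthogonal maps of a real Hilbert space\<close>

text \<open>All information about \<open>W\<close> comes from countability: a diagonal argument
  (\<open>full_block\<close>), or two members of an uncountable family in one translate
  (\<open>pigeonhole\<close>). Both end with a quotient of two elements of the same translate, which
  removes its unknown centre and doubles the exponent. Since the translates are centred in the big
  group and not in a point stabilizer, the same device is used once more to recentre them, so that
  \<open>P n\<close> stands for the power 2n of \<open>W\<close>. The exponents add up as follows: 2
  + 4 + 2 + 4 = 12 for a commutator, 2 + 12 + 2 = 16 for a conjugate, 12 + 16 + 12 + 16 + 12 = 68
  for a map with infinite-dimensional fixed space, 136 for a product of two of them, 136 + 2 + 136 =
  274 for a rotation, 822 for three, 1644 after recentring, and 4932 for two moves of the base point
  followed by a correction fixing it. A neighbourhood of the identity in the stabilizer is not one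
  in the whole group. Conjugate stabilizers supply the missing motion: they are images of
  \<open>orth\<close> too, so the same bound holds for them.\<close>

lemma mem_orthogonal_comp_iff: "x \<in> T\<^sup>\<bottom> \<longleftrightarrow> (\<forall>t\<in>T. x \<bullet> t = 0)"
  for x :: "'a::real_inner"
  by (auto simp: orthogonal_comp_def orthogonal_def inner_commute)

lemma subspace_orthocomplement: "subspace (T\<^sup>\<bottom>)" for T :: "'a::real_inner set"
  by (auto simp: subspace_def mem_orthogonal_comp_iff inner_add_left)

lemma closed_orthogonal_comp: "closed (T\<^sup>\<bottom>)" for T :: "'a::real_inner set"
proof -
  have "T\<^sup>\<bottom> = (\<Inter>t\<in>T. {x. x \<bullet> t = 0})" by (auto simp: mem_orthogonal_comp_iff)
  then show ?thesis by (simp add: closed_INT closed_Collect_eq continuous_intros)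
qed

section \<open>Projections and total sets\<close>

lemma norm_diff_scaleR_square:
  "(norm (w - t *\<^sub>R z))\<^sup>2 = (norm w)\<^sup>2 - 2 * t * (w \<bullet> z) + t\<^sup>2 * (z \<bullet> z)"
  for w z :: "'a::real_inner"
  unfolding power2_norm_eq_inner
  by (simp add: inner_diff_left inner_diff_right inner_commute[of z w] power2_eq_square right_diff_distrib)

text \<open>The parallelogram law forces a minimizing sequence to be Cauchy: the midpoint of two of
  its terms lies in \<open>M\<close> again, hence is no closer to \<open>x\<close> than the
  infimum.\<close>

lemma closed_subspace_projection:
  fixes M :: "'a::{real_inner,complete_space} set"
  assumes M: "subspace M" "closed M"
  obtains m where "m \<in> M" "x - m \<in> M\<^sup>\<bottom>"
proof -
  define d where "d = Inf ((\<lambda>y. (norm (x - y))\<^sup>2) ` M)"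
  have "0 \<in> M" using M by (simp add: subspace_0)
  have bdd: "bdd_below ((\<lambda>y. (norm (x - y))\<^sup>2) ` M)" by (rule bdd_belowI2[of _ 0]) simp
  have low: "d \<le> (norm (x - y))\<^sup>2" if "y \<in> M" for y
    unfolding d_def using that bdd by (rule cINF_lower[rotated])
  have "\<exists>y\<in>M. (norm (x - y))\<^sup>2 < d + 1 / Suc n" for n
  proof -
    have ne: "(\<lambda>y. (norm (x - y))\<^sup>2) ` M \<noteq> {}" using \<open>0 \<in> M\<close> by blast
    have "Inf ((\<lambda>y. (norm (x - y))\<^sup>2) ` M) < d + 1 / Suc n" by (simp add: d_def)
    from cInf_lessD[OF ne this] show ?thesis by auto
  qed
  then obtain y where y: "\<And>n. y n \<in> M" "\<And>n. (norm (x - y n))\<^sup>2 < d + 1 / Suc n"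
    by metis
  have par: "(norm (y m - y n))\<^sup>2 \<le> 2 / Suc m + 2 / Suc n" for m n
  proof -
    have "(1/2) *\<^sub>R (y m + y n) \<in> M" using y(1) M by (simp add: subspace_add subspace_scale)
    then have "d \<le> (norm (x - (1/2) *\<^sub>R (y m + y n)))\<^sup>2" by (rule low)
    also have "x - (1/2) *\<^sub>R (y m + y n) = (1/2) *\<^sub>R ((x - y m) + (x - y n))"
      by (simp add: scaleR_right_diff_distrib scaleR_right_distrib flip: scaleR_add_left)
    finally have "4 * d \<le> (norm ((x - y m) + (x - y n)))\<^sup>2"
      by (simp add: power_divide)
    moreover have "(norm (u - v))\<^sup>2 + (norm (u + v))\<^sup>2 = 2 * (norm u)\<^sup>2 + 2 * (norm v)\<^sup>2" for u v :: 'a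
      by (simp add: power2_norm_eq_inner inner_diff_left inner_diff_right inner_add_left
          inner_add_right)
    from this[of "x - y n" "x - y m"]
    have "(norm (y m - y n))\<^sup>2 + (norm ((x - y m) + (x - y n)))\<^sup>2
        = 2 * (norm (x - y m))\<^sup>2 + 2 * (norm (x - y n))\<^sup>2"
      by (simp add: add.commute)
    moreover have "2 / real (Suc k) = 2 * (1 / real (Suc k))" for k by simp
    ultimately show ?thesis using y(2)[of m] y(2)[of n] by linarith
  qed
  have "Cauchy y"
  proof (rule metric_CauchyI)
    fix e :: real assume e: "e > 0"
    obtain N0 where "4 / e\<^sup>2 < real N0" using reals_Archimedean2 by blast
    then obtain N where N: "4 / e\<^sup>2 < real (Suc N)" using that[of N0] by simp
    have "dist (y m) (y n) < e" if "m \<ge> N" "n \<ge> N" for m n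
    proof -
      have "4 / real (Suc N) < e\<^sup>2"
        using N zero_less_power[OF e, of 2] by (simp only: pos_divide_less_eq of_nat_0_less_iff zero_less_Suc mult.commute)
      moreover have "2 / real (Suc m) \<le> 2 / real (Suc N)" "2 / real (Suc n) \<le> 2 / real (Suc N)"
        using that by (simp_all add: frac_le)
      ultimately have "(norm (y m - y n))\<^sup>2 < e\<^sup>2" using par[of m n] by linarith
      then show ?thesis using e by (simp add: dist_norm power_less_imp_less_base)
    qed
    then show "\<exists>N. \<forall>m\<ge>N. \<forall>n\<ge>N. dist (y m) (y n) < e" by blast
  qed
  then obtain m where m: "y \<longlonglongrightarrow> m" using Cauchy_convergent[of y] by (auto simp: convergent_def)
  have mM: "m \<in> M" using M(2) y(1) m by (rule closed_sequentially)
  have "(\<lambda>n. d + 1 / Suc n) \<longlonglongrightarrow> d + 0"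
    by (rule tendsto_add[OF tendsto_const LIMSEQ_Suc[OF lim_1_over_n]])
  moreover have "(\<lambda>n. (norm (x - y n))\<^sup>2) \<longlonglongrightarrow> (norm (x - m))\<^sup>2"
    by (intro tendsto_intros m)
  ultimately have dm: "(norm (x - m))\<^sup>2 \<le> d"
    using y(2) less_imp_le by (intro LIMSEQ_le[of "\<lambda>n. (norm (x - y n))\<^sup>2" _ "\<lambda>n. d + 1 / Suc n"]) auto
  have "(x - m) \<bullet> z = 0" if z: "z \<in> M" for z
  proof (cases "z = 0")
    case False
    \<comment> \<open>The minimum of the quadratic in \<open>norm_diff_scaleR_square\<close>; a
      nonzero inner product would beat the infimum \<open>d\<close> there.\<close>
    define t where "t = ((x - m) \<bullet> z) / (z \<bullet> z)"
    have "m + t *\<^sub>R z \<in> M" using z mM M by (simp add: subspace_add subspace_scale)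
    from low[OF this] dm have "(norm (x - m))\<^sup>2 \<le> (norm (x - m - t *\<^sub>R z))\<^sup>2"
      unfolding diff_diff_eq by (rule order_trans[rotated])
    also have "\<dots> = (norm (x - m))\<^sup>2 - 2 * t * ((x - m) \<bullet> z) + t\<^sup>2 * (z \<bullet> z)"
      by (rule norm_diff_scaleR_square)
    also have "\<dots> = (norm (x - m))\<^sup>2 - ((x - m) \<bullet> z)\<^sup>2 / (z \<bullet> z)"
      using False by (simp add: t_def power2_eq_square field_simps)
    finally have "((x - m) \<bullet> z)\<^sup>2 / (z \<bullet> z) \<le> 0" by simp
    then show ?thesis by (metis False divide_pos_pos inner_gt_zero_iff linorder_not_less zero_less_power2)
  qed simp
  then show ?thesis using that[OF mM] by (simp add: mem_orthogonal_comp_iff)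
qed

lemma subspace_closure:
  fixes S :: "'a::real_normed_vector set"
  assumes "subspace S"
  shows "subspace (closure S)"
  unfolding subspace_def
proof (intro conjI ballI allI)
  show "0 \<in> closure S" using assms closure_subset by (auto simp: subspace_def)
  show "x + y \<in> closure S" if xy: "x \<in> closure S" "y \<in> closure S" for x y
  proof -
    obtain a b where "\<And>n. a n \<in> S" "a \<longlonglongrightarrow> x" "\<And>n. b n \<in> S" "b \<longlonglongrightarrow> y"
      using xy unfolding closure_sequential by auto
    then show ?thesis
      unfolding closure_sequential using assms
      by (intro exI[of _ "\<lambda>n. a n + b n"]) (auto intro: tendsto_add simp: subspace_add)
  qed
  show "c *\<^sub>R x \<in> closure S" if x: "x \<in> closure S" for c x
  proof -
    obtain a where "\<And>n. a n \<in> S" "a \<longlonglongrightarrow> x"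
      using x unfolding closure_sequential by auto
    then show ?thesis
      unfolding closure_sequential using assms
      by (intro exI[of _ "\<lambda>n. c *\<^sub>R a n"]) (auto intro: tendsto_intros simp: subspace_scale)
  qed
qed

text \<open>Completeness enters here: the residual of the projection onto the closed span is
  orthogonal to \<open>T\<close>. Totality of a family is tested through the right-hand side from
  now on.\<close>

lemma closure_span_UNIV_iff:
  fixes T :: "'a::{real_inner,complete_space} set"
  shows "closure (span T) = UNIV \<longleftrightarrow> T\<^sup>\<bottom> = {0}"
proof
  assume *: "closure (span T) = UNIV"
  show "T\<^sup>\<bottom> = {0}"
  proof (intro equalityI subsetI)
    fix x assume x: "x \<in> T\<^sup>\<bottom>"
    have "span T \<subseteq> {x}\<^sup>\<bottom>"
      using x by (intro span_minimal subspace_orthocomplement) (auto simp: mem_orthogonal_comp_iff inner_commute)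
    then have "closure (span T) \<subseteq> {x}\<^sup>\<bottom>" by (rule closure_minimal[OF _ closed_orthogonal_comp])
    then have "x \<in> {x}\<^sup>\<bottom>" using * by auto
    then show "x \<in> {0}" by (simp add: mem_orthogonal_comp_iff)
  qed (simp add: mem_orthogonal_comp_iff)
next
  assume *: "T\<^sup>\<bottom> = {0}"
  have "x \<in> closure (span T)" for x
  proof -
    obtain m where m: "m \<in> closure (span T)" "x - m \<in> (closure (span T))\<^sup>\<bottom>"
      using closed_subspace_projection[of "closure (span T)" x] subspace_closure[OF subspace_span[of T]]
      by blast
    then have "x - m \<in> T\<^sup>\<bottom>"
      using span_superset[of T] closure_subset[of "span T"] by (auto simp: mem_orthogonal_comp_iff)
    then show ?thesis using m * by simp
  qed
  then show "closure (span T) = UNIV" by blast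
qed

section \<open>Orthonormal families and the isometries they determine\<close>

definition orthonormal_on :: "'i set \<Rightarrow> ('i \<Rightarrow> 'a::real_inner) \<Rightarrow> bool" where
  "orthonormal_on I f \<longleftrightarrow> (\<forall>i\<in>I. \<forall>j\<in>I. f i \<bullet> f j = (if i = j then 1 else 0))"

lemma orthonormal_onD:
  "orthonormal_on I f \<Longrightarrow> i \<in> I \<Longrightarrow> j \<in> I \<Longrightarrow> f i \<bullet> f j = (if i = j then 1 else 0)"
  by (simp add: orthonormal_on_def)

lemma orthonormal_on_subset: "orthonormal_on I f \<Longrightarrow> J \<subseteq> I \<Longrightarrow> orthonormal_on J f"
  unfolding orthonormal_on_def by blast

lemma orthonormal_on_compose:
  "orthonormal_on I f \<Longrightarrow> inj_on g J \<Longrightarrow> g ` J \<subseteq> I \<Longrightarrow> orthonormal_on J (\<lambda>j. f (g j))"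
  unfolding orthonormal_on_def by (simp add: image_subset_iff inj_on_eq_iff)

lemma orthonormal_on_inj_on: "orthonormal_on I f \<Longrightarrow> inj_on f I"
  unfolding orthonormal_on_def inj_on_def by (metis zero_neq_one)

lemma orthonormal_on_independent:
  assumes "orthonormal_on I f"
  shows "independent (f ` I)"
proof (rule pairwise_orthogonal_independent)
  show "pairwise orthogonal (f ` I)"
    using assms by (auto simp: pairwise_def orthogonal_def orthonormal_on_def)
  show "0 \<notin> f ` I"
    using assms by (metis image_iff inner_zero_left orthonormal_on_def zero_neq_one)
qed

text \<open>Linearity follows from preservation of the inner product
  (\<open>isometric_linear\<close>); surjectivity does not in infinite dimension.\<close>

definition orth :: "('a::real_inner \<Rightarrow> 'a) set" where
  "orth = {A. (\<forall>x y. A x \<bullet> A y = x \<bullet> y) \<and> surj A}"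

lemma isometric_linear:
  fixes A :: "'a::real_inner \<Rightarrow> 'b::real_inner"
  assumes "\<And>x y. A x \<bullet> A y = x \<bullet> y"
  shows "linear A"
proof (rule linearI)
  fix x y and c :: real
  have "(A (x + y) - A x - A y) \<bullet> (A (x + y) - A x - A y) = 0"
    by (simp add: inner_diff_left inner_diff_right assms inner_add_left inner_add_right)
  then have "A (x + y) - A x - A y = 0" by (simp only: inner_eq_zero_iff)
  then show "A (x + y) = A x + A y" by (simp add: diff_diff_eq)
  have "(A (c *\<^sub>R x) - c *\<^sub>R A x) \<bullet> (A (c *\<^sub>R x) - c *\<^sub>R A x) = 0"
    by (simp add: inner_diff_left inner_diff_right assms)
  then show "A (c *\<^sub>R x) = c *\<^sub>R A x" by simp
qed

lemma isometric_norm: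
  assumes "\<And>x y. A x \<bullet> A y = x \<bullet> y"
  shows "norm (A x) = norm x"
  by (simp add: norm_eq_sqrt_inner assms)

lemma isometric_bounded_linear:
  fixes A :: "'a::real_inner \<Rightarrow> 'b::real_inner"
  assumes "\<And>x y. A x \<bullet> A y = x \<bullet> y"
  shows "bounded_linear A"
proof -
  interpret linear A by (rule isometric_linear[OF assms])
  show ?thesis
    by (rule bounded_linear_intro[of A 1]) (simp_all add: add scale isometric_norm[OF assms])
qed

lemma isometric_closed_range:
  fixes A :: "'a::{real_inner,complete_space} \<Rightarrow> 'b::real_inner"
  assumes iso: "\<And>x y. A x \<bullet> A y = x \<bullet> y"
  shows "closed (range A)"
proof (rule complete_imp_closed, rule completeI)
  interpret linear A by (rule isometric_linear[OF iso])
  fix s :: "nat \<Rightarrow> 'b" assume "\<forall>n. s n \<in> range A" and C: "Cauchy s"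
  then have "\<forall>n. \<exists>u. s n = A u" by auto
  then obtain t where t: "\<And>n. s n = A (t n)" by metis
  have "dist (s m) (s n) = dist (t m) (t n)" for m n
    using isometric_norm[of A "t m - t n", OF iso] by (simp add: t dist_norm diff)
  then have "Cauchy t" using C by (simp add: Cauchy_def)
  then obtain v where "t \<longlonglongrightarrow> v" using Cauchy_convergent[of t] by (auto simp: convergent_def)
  then have "(\<lambda>n. A (t n)) \<longlonglongrightarrow> A v"
    by (rule bounded_linear.tendsto[OF isometric_bounded_linear[OF iso]])
  moreover have "s = (\<lambda>n. A (t n))" using t by (rule ext)
  ultimately show "\<exists>v\<in>range A. s \<longlonglongrightarrow> v" by blast
qed

text \<open>On the span the map is forced and isometric. Uniform continuity extends it to the
  closure, and its closed range is everything once it contains a total family. Surjectivity stays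
  conditional because \<open>shift\<close> below is built from a target that is not total.\<close>

lemma isometric_extension:
  fixes f :: "'i \<Rightarrow> 'a::{real_inner,complete_space}" and f' :: "'i \<Rightarrow> 'b::{real_inner,complete_space}"
  assumes f: "orthonormal_on I f" and tot: "(f ` I)\<^sup>\<bottom> = {0}" and f': "orthonormal_on I f'"
  obtains A where "\<And>x y. A x \<bullet> A y = x \<bullet> y" "\<And>i. i \<in> I \<Longrightarrow> A (f i) = f' i"
    "(f' ` I)\<^sup>\<bottom> = {0} \<Longrightarrow> surj A"
proof -
  obtain g where g: "linear g" "\<And>b. b \<in> f ` I \<Longrightarrow> g b = f' (the_inv_into I f b)"
    using linear_independent_extend[OF orthonormal_on_independent[OF f], of "\<lambda>b. f' (the_inv_into I f b)"] by blast
  interpret g: linear g by (rule g(1))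
  have gf: "g (f i) = f' i" if "i \<in> I" for i
    using g(2) that orthonormal_on_inj_on[OF f] by (simp add: the_inv_into_f_f)
  have ip: "g x \<bullet> g y = x \<bullet> y" if x: "x \<in> span (f ` I)" and y: "y \<in> span (f ` I)" for x y
    using x
  proof (induction rule: span_induct_alt)
    case (step c b x)
    have "g b \<bullet> g y = b \<bullet> y" using y
    proof (induction rule: span_induct_alt)
      case (step c' b' y)
      have "g b \<bullet> g b' = b \<bullet> b'"
        using \<open>b \<in> f ` I\<close> \<open>b' \<in> f ` I\<close> f f' by (auto simp: gf orthonormal_on_def)
      then show ?case using step by (simp add: g.add g.scale inner_add_right)
    qed simp
    then show ?case using step by (simp add: g.add g.scale inner_add_left)
  qed simp
  have nrm: "norm (g x) = norm x" if "x \<in> span (f ` I)" for x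
    using ip[OF that that] by (simp add: norm_eq_sqrt_inner)
  have "uniformly_continuous_on (span (f ` I)) g"
    unfolding uniformly_continuous_on_def
  proof (intro allI impI)
    fix e :: real assume "e > 0"
    moreover have "dist (g x') (g x) = dist x' x" if "x \<in> span (f ` I)" "x' \<in> span (f ` I)" for x x'
      using nrm[OF span_diff[OF that(2,1)]] by (simp add: dist_norm g.diff)
    ultimately show "\<exists>d>0. \<forall>x\<in>span (f ` I). \<forall>x'\<in>span (f ` I). dist x' x < d \<longrightarrow> dist (g x') (g x) < e"
      by auto
  qed
  moreover have cl: "closure (span (f ` I)) = UNIV" using tot closure_span_UNIV_iff by blast
  ultimately obtain A where A: "uniformly_continuous_on UNIV A" "\<And>x. x \<in> span (f ` I) \<Longrightarrow> g x = A x"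
    using uniformly_continuous_on_extension_on_closure by metis
  have cA: "continuous_on UNIV A" using A(1) by (rule uniformly_continuous_imp_continuous)
  have cA': "continuous_on UNIV (\<lambda>x. A (h x))" if "continuous_on UNIV h" for h :: "'a \<Rightarrow> 'a"
    using continuous_on_compose2[OF cA that] by simp
  have ip1: "A x \<bullet> A y = x \<bullet> y" if "y \<in> span (f ` I)" for x y
  proof -
    have "closed {x. A x \<bullet> A y = x \<bullet> y}"
      by (intro closed_Collect_eq continuous_intros cA)
    moreover have "span (f ` I) \<subseteq> {x. A x \<bullet> A y = x \<bullet> y}" using A(2) ip that by auto
    ultimately show ?thesis using closure_minimal[of "span (f ` I)"] cl by blast
  qed
  have ip2: "A x \<bullet> A y = x \<bullet> y" for x y
  proof -
    have "closed {y. A x \<bullet> A y = x \<bullet> y}"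
      by (intro closed_Collect_eq continuous_intros cA)
    moreover have "span (f ` I) \<subseteq> {y. A x \<bullet> A y = x \<bullet> y}" using ip1 by auto
    ultimately show ?thesis using closure_minimal[of "span (f ` I)"] cl by blast
  qed
  have Af: "A (f i) = f' i" if "i \<in> I" for i
    using A(2)[of "f i"] gf that by (simp add: span_base)
  have "surj A" if "(f' ` I)\<^sup>\<bottom> = {0}"
  proof -
    interpret A: linear A by (rule isometric_linear[OF ip2])
    have "closed (range A)" by (rule isometric_closed_range[OF ip2])
    moreover have "span (f' ` I) \<subseteq> range A"
    proof (rule span_minimal)
      show "f' ` I \<subseteq> range A" using Af by (metis image_subsetI rangeI)
      show "subspace (range A)" by (rule linear_subspace_image[OF A.linear_axioms subspace_UNIV])
    qed
    ultimately have "closure (span (f' ` I)) \<subseteq> range A" by (simp add: closure_minimal)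
    then show ?thesis using that closure_span_UNIV_iff by blast
  qed
  with ip2 Af that show ?thesis by blast
qed

lemma orth_extension:
  fixes f f' :: "'i \<Rightarrow> 'a::{real_inner,complete_space}"
  assumes "orthonormal_on I f" "(f ` I)\<^sup>\<bottom> = {0}" "orthonormal_on I f'" "(f' ` I)\<^sup>\<bottom> = {0}"
  shows "\<exists>A\<in>orth. \<forall>i\<in>I. A (f i) = f' i"
proof (rule isometric_extension[OF assms(1-3)])
  fix A :: "'a \<Rightarrow> 'a"
  assume "\<And>x y. A x \<bullet> A y = x \<bullet> y" "\<And>i. i \<in> I \<Longrightarrow> A (f i) = f' i" "(f' ` I)\<^sup>\<bottom> = {0} \<Longrightarrow> surj A"
  with assms(4) show ?thesis by (intro bexI[of _ A]) (simp_all add: orth_def)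
qed

lemma orth_inner: "A \<in> orth \<Longrightarrow> A x \<bullet> A y = x \<bullet> y" by (simp add: orth_def)
lemma orth_linear: "A \<in> orth \<Longrightarrow> linear A" by (simp add: orth_def isometric_linear)
lemma orth_bounded_linear: "A \<in> orth \<Longrightarrow> bounded_linear A" by (simp add: orth_def isometric_bounded_linear)
lemma orth_norm: "A \<in> orth \<Longrightarrow> norm (A x) = norm x" by (simp add: orth_def isometric_norm)
lemma orth_id: "id \<in> orth" by (simp add: orth_def)

lemma orth_bij: "A \<in> orth \<Longrightarrow> bij A"
proof (rule bijI)
  assume A: "A \<in> orth"
  interpret linear A by (rule orth_linear[OF A])
  have "x = 0" if "A x = 0" for x using orth_norm[OF A, of x] that by simp
  then show "inj A" using linear_injective_0[OF orth_linear[OF A]] by blast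
  show "surj A" using A by (simp add: orth_def)
qed

lemma orth_comp: "A \<in> orth \<Longrightarrow> B \<in> orth \<Longrightarrow> A \<circ> B \<in> orth"
  unfolding orth_def using comp_surj[of B A] by auto

text \<open>\<open>HOL-Algebra\<close> uses the notation \<open>inv\<close> for inverses in a group.\<close>

abbreviation finv :: "('a \<Rightarrow> 'b) \<Rightarrow> 'b \<Rightarrow> 'a" where
  "finv \<equiv> inv_into UNIV"

lemma orth_inv_apply: "A \<in> orth \<Longrightarrow> A (finv A x) = x" "A \<in> orth \<Longrightarrow> finv A (A x) = x"
  using orth_bij by (metis bij_inv_eq_iff)+

lemma orth_inv: "A \<in> orth \<Longrightarrow> finv A \<in> orth"
proof -
  assume A: "A \<in> orth"
  have "finv A x \<bullet> finv A y = x \<bullet> y" for x y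
    using orth_inner[OF A, of "finv A x" "finv A y"] orth_inv_apply[OF A] by simp
  then show ?thesis using orth_bij[OF A] by (simp add: orth_def bij_is_inj bij_imp_bij_inv bij_is_surj)
qed

lemma orth_inner_shift: "A \<in> orth \<Longrightarrow> finv A x \<bullet> y = x \<bullet> A y"
  using orth_inner[of A "finv A x" y] by (simp add: orth_inv_apply)

section \<open>Infinite-dimensional subspaces and greedy choices\<close>

definition inf_dim :: "'a::real_vector set \<Rightarrow> bool" where
  "inf_dim V \<longleftrightarrow> subspace V \<and> (\<forall>T. finite T \<longrightarrow> \<not> V \<subseteq> span T)"

text \<open>If a finite set spanned the slice, one more vector of \<open>V\<close>, off the
  hyperplane, would make it span \<open>V\<close>.\<close>

lemma inf_dim_hyperplane:
  fixes V :: "'a::real_inner set"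
  assumes V: "inf_dim V"
  shows "inf_dim (V \<inter> {t}\<^sup>\<bottom>)"
  unfolding inf_dim_def
proof (intro conjI allI impI notI)
  have sV: "subspace V" using V by (simp add: inf_dim_def)
  show "subspace (V \<inter> {t}\<^sup>\<bottom>)" by (intro subspace_inter sV subspace_orthocomplement)
  fix T :: "'a set" assume T: "finite T" "V \<inter> {t}\<^sup>\<bottom> \<subseteq> span T"
  show False
  proof (cases "V \<subseteq> {t}\<^sup>\<bottom>")
    case True
    then show False using T V unfolding inf_dim_def by blast
  next
    case False
    then obtain u where u: "u \<in> V" "u \<bullet> t \<noteq> 0" unfolding subset_iff mem_orthogonal_comp_iff by blast
    have "V \<subseteq> span (insert u T)"
    proof
      fix v assume v: "v \<in> V"
      define c where "c = (v \<bullet> t) / (u \<bullet> t)"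
      have "v - c *\<^sub>R u \<in> V \<inter> {t}\<^sup>\<bottom>"
        using u v sV by (simp add: subspace_diff subspace_scale mem_orthogonal_comp_iff inner_diff_left c_def)
      then show "v \<in> span (insert u T)" using T(2) span_breakdown_eq by blast
    qed
    then show False using V T(1) unfolding inf_dim_def by blast
  qed
qed

lemma inf_dim_Int_orthogonal_comp:
  fixes V :: "'a::real_inner set"
  assumes "finite T" "inf_dim V"
  shows "inf_dim (V \<inter> T\<^sup>\<bottom>)"
  using assms(1)
proof induction
  case empty
  have "V \<inter> {}\<^sup>\<bottom> = V" by (auto simp: mem_orthogonal_comp_iff)
  then show ?case using assms(2) by simp
next
  case (insert t T)
  have "V \<inter> (insert t T)\<^sup>\<bottom> = (V \<inter> T\<^sup>\<bottom>) \<inter> {t}\<^sup>\<bottom>" by (auto simp: mem_orthogonal_comp_iff)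
  then show ?case using inf_dim_hyperplane[OF insert.IH] by simp
qed

lemma inf_dim_unit:
  fixes V :: "'a::real_inner set"
  assumes V: "inf_dim V" and T: "finite T"
  obtains v where "v \<in> V" "norm v = 1" "v \<in> T\<^sup>\<bottom>"
proof -
  have "inf_dim (V \<inter> T\<^sup>\<bottom>)" by (rule inf_dim_Int_orthogonal_comp[OF T V])
  then have s: "subspace (V \<inter> T\<^sup>\<bottom>)" and "\<not> V \<inter> T\<^sup>\<bottom> \<subseteq> span {}"
    unfolding inf_dim_def by blast+
  then obtain v where v: "v \<in> V \<inter> T\<^sup>\<bottom>" "v \<noteq> 0" by auto
  then have "(1 / norm v) *\<^sub>R v \<in> V \<inter> T\<^sup>\<bottom>" using s by (meson subspace_scale)
  with that[of "(1 / norm v) *\<^sub>R v"] v show ?thesis by simp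
qed

lemma inf_dim_orthonormal:
  fixes f :: "'i \<Rightarrow> 'a::real_inner"
  assumes "orthonormal_on I f" "infinite I" "f ` I \<subseteq> V" "subspace V"
  shows "inf_dim V"
  unfolding inf_dim_def
proof (intro conjI allI impI notI)
  fix T assume T: "finite T" "V \<subseteq> span T"
  then have "f ` I \<subseteq> span T" using assms(3) by blast
  then have "finite (f ` I)"
    using independent_span_bound[OF T(1) orthonormal_on_independent[OF assms(1)]] by blast
  then show False using assms(2) finite_image_iff[OF orthonormal_on_inj_on[OF assms(1)]] by blast
qed (rule assms(4))

text \<open>A greedy choice, each term facing only finitely many orthogonality conditions. Putting
  images of a vector into its \<open>\<tau>\<close> makes later terms orthogonal to these images
  too, which is how projections and images under \<open>g\<close> are controlled below.\<close>

lemma inf_dim_sequence: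
  fixes V :: "nat \<Rightarrow> 'a::real_inner set"
  assumes V: "\<And>i. inf_dim (V i)" and \<tau>: "\<And>x. finite (\<tau> x)"
  shows "\<exists>w. \<forall>i. w i \<in> V i \<and> norm (w i) = 1 \<and> (\<forall>j<i. \<forall>t\<in>\<tau> (w j). w i \<bullet> t = 0)"
proof (rule dependent_wellorder_choice)
  fix i and f :: "nat \<Rightarrow> 'a"
  have "finite (\<Union>j<i. \<tau> (f j))" using \<tau> by blast
  then obtain v where "v \<in> V i" "norm v = 1" "v \<in> (\<Union>j<i. \<tau> (f j))\<^sup>\<bottom>"
    using inf_dim_unit[OF V] by blast
  then show "\<exists>r. r \<in> V i \<and> norm r = 1 \<and> (\<forall>j<i. \<forall>t\<in>\<tau> (f j). r \<bullet> t = 0)"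
    by (auto simp: mem_orthogonal_comp_iff)
qed auto

lemma unit_orthogonal_sequence:
  fixes w :: "nat \<Rightarrow> 'a::real_inner"
  assumes "\<And>i. norm (w i) = 1" and "\<And>i j. j < i \<Longrightarrow> w i \<bullet> w j = 0"
  shows "w i \<bullet> w j = (if i = j then 1 else 0)"
  using assms by (cases i j rule: linorder_cases) (simp_all add: norm_eq_1, metis inner_commute)

section \<open>Completing a frame to a basis\<close>

lemma hilbert_basisD:
  assumes "hilbert_basis (e :: nat \<Rightarrow> 'a::{real_inner,complete_space})"
  shows "orthonormal_on UNIV e" "(range e)\<^sup>\<bottom> = {0}"
  using assms closure_span_UNIV_iff[of "range e"] by (auto simp: hilbert_basis_def orthonormal_on_def)

lemma bessel_finite:
  fixes x :: "'a::real_inner"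
  assumes "finite F" "orthonormal_on F f"
  shows "(\<Sum>i\<in>F. (x \<bullet> f i)\<^sup>2) \<le> x \<bullet> x"
proof -
  define y where "y = (\<Sum>i\<in>F. (x \<bullet> f i) *\<^sub>R f i)"
  have xy: "x \<bullet> y = (\<Sum>i\<in>F. (x \<bullet> f i)\<^sup>2)"
    by (simp add: y_def inner_sum_right power2_eq_square)
  have "y \<bullet> y = (\<Sum>i\<in>F. (x \<bullet> f i) * (f i \<bullet> y))" unfolding y_def by (simp add: inner_sum_left)
  also have "f i \<bullet> y = x \<bullet> f i" if "i \<in> F" for i
  proof -
    have "f i \<bullet> y = (\<Sum>j\<in>F. (x \<bullet> f j) * (f i \<bullet> f j))" by (simp add: y_def inner_sum_right)
    also have "\<dots> = (\<Sum>j\<in>F. if i = j then x \<bullet> f j else 0)"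
      using that assms(2) by (intro sum.cong) (auto simp: orthonormal_on_def)
    finally show ?thesis using that assms(1) by simp
  qed
  then have "(\<Sum>i\<in>F. (x \<bullet> f i) * (f i \<bullet> y)) = (\<Sum>i\<in>F. (x \<bullet> f i)\<^sup>2)"
    by (intro sum.cong) (auto simp: power2_eq_square)
  finally have "(x - y) \<bullet> (x - y) = x \<bullet> x - (\<Sum>i\<in>F. (x \<bullet> f i)\<^sup>2)"
    using xy by (simp add: inner_diff_left inner_diff_right inner_commute[of y x])
  then show ?thesis using inner_ge_zero[of "x - y"] by linarith
qed

text \<open>Every \<open>f i\<close> has a nonzero coefficient against some \<open>e k\<close>, and
  Bessel's inequality lets only finitely many squared coefficients exceed \<open>1 / Suc n\<close>.
  This makes the sets produced by Zorn's lemma enumerable by \<open>nat\<close>.\<close>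

lemma orthonormal_countable:
  fixes e :: "nat \<Rightarrow> 'a::{real_inner,complete_space}" and f :: "'i \<Rightarrow> 'a"
  assumes e: "hilbert_basis e" and f: "orthonormal_on I f"
  shows "countable I"
proof -
  have fin: "finite {i \<in> I. (x \<bullet> f i)\<^sup>2 > 1 / Suc n}" for x n
  proof (rule ccontr)
    let ?S = "{i \<in> I. (x \<bullet> f i)\<^sup>2 > 1 / Suc n}"
    assume "infinite ?S"
    obtain N :: nat where N: "x \<bullet> x * Suc n < N" using reals_Archimedean2 by blast
    obtain F where F: "F \<subseteq> ?S" "finite F" "card F = N"
      using infinite_arbitrarily_large[OF \<open>infinite ?S\<close>] by blast
    have "(\<Sum>i\<in>F. 1 / Suc n) \<le> (\<Sum>i\<in>F. (x \<bullet> f i)\<^sup>2)" using F(1) by (intro sum_mono) auto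
    also have "\<dots> \<le> x \<bullet> x"
      using F(1) by (intro bessel_finite F(2) orthonormal_on_subset[OF f]) auto
    finally show False using F N by (simp add: field_simps)
  qed
  have "I \<subseteq> (\<Union>k n. {i \<in> I. (e k \<bullet> f i)\<^sup>2 > 1 / Suc n})"
  proof
    fix i assume i: "i \<in> I"
    have "f i \<noteq> 0" using f i by (metis inner_zero_left orthonormal_onD zero_neq_one)
    then have "f i \<notin> (range e)\<^sup>\<bottom>" using hilbert_basisD(2)[OF e] by simp
    then obtain k where "(e k \<bullet> f i)\<^sup>2 > 0" by (auto simp: mem_orthogonal_comp_iff inner_commute)
    then obtain n where "(e k \<bullet> f i)\<^sup>2 > inverse (real (Suc n))" using reals_Archimedean by blast
    then show "i \<in> (\<Union>k n. {i \<in> I. (e k \<bullet> f i)\<^sup>2 > 1 / Suc n})"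
      using i by (auto simp: inverse_eq_divide)
  qed
  then show ?thesis
    by (rule countable_subset) (intro countable_UN countableI_type countable_finite fin)
qed

lemma orthonormal_completion:
  fixes T :: "'a::{real_inner,complete_space} set"
  obtains B where "orthonormal_on B (\<lambda>b. b)" "B \<subseteq> T\<^sup>\<bottom>" "(T \<union> B)\<^sup>\<bottom> = {0}"
proof -
  define \<B> where "\<B> = {B. orthonormal_on B (\<lambda>b::'a. b) \<and> B \<subseteq> T\<^sup>\<bottom>}"
  have "\<exists>M\<in>\<B>. \<forall>X\<in>\<B>. M \<subseteq> X \<longrightarrow> X = M"
  proof (rule subset_Zorn')
    fix C assume C: "subset.chain \<B> C"
    show "\<Union>C \<in> \<B>"
      unfolding \<B>_def orthonormal_on_def
    proof (intro CollectI conjI ballI)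
      fix x y assume "x \<in> \<Union>C" "y \<in> \<Union>C"
      then obtain X Y where XY: "X \<in> C" "Y \<in> C" "x \<in> X" "y \<in> Y" by blast
      then have "X \<subseteq> Y \<or> Y \<subseteq> X" using C by (auto simp: subset.chain_def)
      then obtain Z where "Z \<in> C" "x \<in> Z" "y \<in> Z" using XY by blast
      then have "orthonormal_on Z (\<lambda>b. b)" using C by (auto simp: subset.chain_def \<B>_def)
      then show "x \<bullet> y = (if x = y then 1 else 0)"
        using \<open>x \<in> Z\<close> \<open>y \<in> Z\<close> by (simp add: orthonormal_on_def)
    next
      show "\<Union>C \<subseteq> T\<^sup>\<bottom>" using C by (auto simp: subset.chain_def \<B>_def)
    qed
  qed
  then obtain B where B_mem: "B \<in> \<B>" and B_max: "\<forall>X\<in>\<B>. B \<subseteq> X \<longrightarrow> X = B" by (rule bexE)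
  have B: "orthonormal_on B (\<lambda>b. b)" "B \<subseteq> T\<^sup>\<bottom>" using B_mem by (simp_all add: \<B>_def)
  have mx: "X = B" if "orthonormal_on X (\<lambda>b. b)" "X \<subseteq> T\<^sup>\<bottom>" "B \<subseteq> X" for X
    using B_max that by (simp add: \<B>_def)
  have "x = 0" if x: "x \<in> (T \<union> B)\<^sup>\<bottom>" for x
  proof (rule ccontr)
    assume nz: "x \<noteq> 0"
    define u where "u = (1 / norm x) *\<^sub>R x"
    have uu: "u \<bullet> u = 1" using nz by (simp add: u_def dot_square_norm power2_eq_square)
    have u: "u \<bullet> t = 0" "t \<bullet> u = 0" if "t \<in> T \<union> B" for t
      using x that by (auto simp: u_def mem_orthogonal_comp_iff inner_commute)
    have "orthonormal_on (insert u B) (\<lambda>b. b)"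
      unfolding orthonormal_on_def
    proof (intro ballI)
      fix i j assume ij: "i \<in> insert u B" "j \<in> insert u B"
      have "u \<notin> B" using u(1)[of u] uu by auto
      then show "i \<bullet> j = (if i = j then 1 else 0)"
        using ij u uu orthonormal_onD[OF B(1), of i j] by (cases "i = u"; cases "j = u") auto
    qed
    moreover have "insert u B \<subseteq> T\<^sup>\<bottom>" using B(2) u by (auto simp: mem_orthogonal_comp_iff)
    ultimately have "insert u B = B" using mx by blast
    then have "u \<bullet> u = 0" using u by blast
    then show False using uu by simp
  qed
  moreover have "0 \<in> (T \<union> B)\<^sup>\<bottom>" by (simp add: mem_orthogonal_comp_iff)
  ultimately have "(T \<union> B)\<^sup>\<bottom> = {0}" by blast
  with B that show ?thesis by blast
qed

text \<open>An infinite-dimensional complement has an orthonormal basis indexed by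
  \<open>nat\<close>, so both frames complete to bases over the same index set
  \<open>I <+> UNIV\<close> and can be matched term by term.\<close>

lemma frame_extension:
  fixes f f' :: "'i \<Rightarrow> 'a::{real_inner,complete_space}"
  assumes e: "hilbert_basis (e :: nat \<Rightarrow> 'a)"
    and f: "orthonormal_on I f" "inf_dim ((f ` I)\<^sup>\<bottom>)"
    and f': "orthonormal_on I f'" "inf_dim ((f' ` I)\<^sup>\<bottom>)"
  shows "\<exists>A\<in>orth. \<forall>i\<in>I. A (f i) = f' i"
proof -
  have compl: "\<exists>b::nat \<Rightarrow> 'a. orthonormal_on UNIV b \<and> range b \<subseteq> (g ` I)\<^sup>\<bottom> \<and> (g ` I \<union> range b)\<^sup>\<bottom> = {0}"
    if g: "inf_dim ((g ` I)\<^sup>\<bottom>)" for g :: "'i \<Rightarrow> 'a"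
  proof -
    obtain B where B: "orthonormal_on B (\<lambda>b. b)" "B \<subseteq> (g ` I)\<^sup>\<bottom>" "(g ` I \<union> B)\<^sup>\<bottom> = {0}"
      by (rule orthonormal_completion)
    have "infinite B"
    proof
      assume "finite B"
      from inf_dim_unit[OF g this] obtain v where "v \<in> (g ` I)\<^sup>\<bottom>" "norm v = 1" "v \<in> B\<^sup>\<bottom>" by blast
      then have "v \<in> (g ` I \<union> B)\<^sup>\<bottom>" by (auto simp: mem_orthogonal_comp_iff)
      then show False using B(3) \<open>norm v = 1\<close> by simp
    qed
    moreover have "countable B" by (rule orthonormal_countable[OF e B(1)])
    ultimately have "bij_betw (from_nat_into B) UNIV B" by (rule bij_betw_from_nat_into[rotated])
    then have "inj (from_nat_into B)" "range (from_nat_into B) = B"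
      by (auto simp: bij_betw_def)
    moreover from this have "orthonormal_on UNIV (from_nat_into B)"
      using orthonormal_on_compose[OF B(1), of "from_nat_into B" UNIV] by simp
    ultimately show ?thesis using B by (intro exI[of _ "from_nat_into B"]) simp
  qed
  obtain b where b: "orthonormal_on (UNIV::nat set) b" "range b \<subseteq> (f ` I)\<^sup>\<bottom>" "(f ` I \<union> range b)\<^sup>\<bottom> = {0}"
    using compl[OF f(2)] by blast
  obtain b' where b': "orthonormal_on (UNIV::nat set) b'" "range b' \<subseteq> (f' ` I)\<^sup>\<bottom>" "(f' ` I \<union> range b')\<^sup>\<bottom> = {0}"
    using compl[OF f'(2)] by blast
  have on: "orthonormal_on (I <+> (UNIV::nat set)) (case_sum g c)"
    if "orthonormal_on I g" "orthonormal_on UNIV c" "range c \<subseteq> (g ` I)\<^sup>\<bottom>" for g c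
  proof -
    have "c n \<bullet> g i = 0" "g i \<bullet> c n = 0" if "i \<in> I" for n i
      using \<open>range c \<subseteq> _\<close> that by (auto simp: mem_orthogonal_comp_iff inner_commute image_subset_iff)
    with that(1,2) show ?thesis
      unfolding orthonormal_on_def Plus_def by (simp add: ball_Un)
  qed
  have im: "case_sum g c ` (I <+> (UNIV::nat set)) = g ` I \<union> range c" for g c :: "_ \<Rightarrow> 'a"
    by (auto simp: Plus_def image_Un image_image)
  have "\<exists>A\<in>orth. \<forall>i\<in>I <+> (UNIV::nat set). A (case_sum f b i) = case_sum f' b' i"
    by (rule orth_extension[OF on[OF f(1) b(1,2)] _ on[OF f'(1) b'(1,2)]]) (simp_all add: im b b')
  then obtain A where "A \<in> orth" "\<forall>i\<in>I <+> (UNIV::nat set). A (case_sum f b i) = case_sum f' b' i" ..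
  then show ?thesis by (intro bexI[of _ A]) force+
qed

section \<open>Fixers of sets of basis vectors\<close>

locale hilbert =
  fixes e :: "nat \<Rightarrow> 'a::{real_inner,complete_space}"
  assumes basis: "hilbert_basis e"
begin

lemma e_inner [simp]: "e i \<bullet> e j = (if i = j then 1 else 0)"
  using basis by (simp add: hilbert_basis_def)

lemma e_norm [simp]: "norm (e i) = 1"
  by (simp add: norm_eq_sqrt_inner)

lemma orthonormal_e: "orthonormal_on J e"
  by (simp add: orthonormal_on_def)

lemma basis_eqI: "(\<And>i. x \<bullet> e i = y \<bullet> e i) \<Longrightarrow> x = y"
proof -
  assume "\<And>i. x \<bullet> e i = y \<bullet> e i"
  then have "x - y \<in> (range e)\<^sup>\<bottom>" by (auto simp: mem_orthogonal_comp_iff inner_diff_left)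
  then show ?thesis using hilbert_basisD(2)[OF basis] by simp
qed

text \<open>The closed span of the \<open>e i\<close> with \<open>i\<close> in \<open>J\<close>,
  encoded by vanishing coordinates, so that membership is a coordinate condition and closedness is
  immediate.\<close>

definition cspan :: "nat set \<Rightarrow> 'a set" where
  "cspan J = (e ` (- J))\<^sup>\<bottom>"

lemma mem_cspan: "x \<in> cspan J \<longleftrightarrow> (\<forall>i. i \<notin> J \<longrightarrow> x \<bullet> e i = 0)"
  by (auto simp: cspan_def mem_orthogonal_comp_iff)

lemma e_mem_cspan: "i \<in> J \<Longrightarrow> e i \<in> cspan J" by (auto simp: mem_cspan)

lemma subspace_cspan: "subspace (cspan J)" by (simp add: cspan_def subspace_orthocomplement)

lemma closed_cspan: "closed (cspan J)" by (simp add: cspan_def closed_orthogonal_comp)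

lemma cspan_mono: "J \<subseteq> J' \<Longrightarrow> cspan J \<subseteq> cspan J'" unfolding subset_iff mem_cspan by blast

text \<open>Serves as an induction rule: a closed linear property holds on a block once it holds on
  the basis vectors of the block.\<close>

lemma cspan_subset:
  assumes "subspace S" "closed S" "\<And>i. i \<in> J \<Longrightarrow> e i \<in> S"
  shows "cspan J \<subseteq> S"
proof
  fix x assume x: "x \<in> cspan J"
  let ?M = "closure (span (e ` J))"
  have sM: "subspace ?M" by (rule subspace_closure[OF subspace_span])
  obtain m where m: "m \<in> ?M" "x - m \<in> ?M\<^sup>\<bottom>"
    using closed_subspace_projection[OF sM closed_closure] by blast
  have "?M \<subseteq> cspan J"
    by (intro closure_minimal span_minimal closed_cspan subspace_cspan) (auto intro: e_mem_cspan)
  then have "m \<in> cspan J" using m by blast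
  have "x \<bullet> e i = m \<bullet> e i" for i
  proof (cases "i \<in> J")
    case True
    then have "e i \<in> ?M" by (intro subsetD[OF closure_subset] span_base imageI)
    then have "(x - m) \<bullet> e i = 0" using m(2) by (simp add: mem_orthogonal_comp_iff)
    then show ?thesis by (simp add: inner_diff_left)
  next
    case False
    then show ?thesis using x \<open>m \<in> cspan J\<close> by (simp add: mem_cspan)
  qed
  then have "x = m" by (rule basis_eqI)
  moreover have "?M \<subseteq> S" using assms by (intro closure_minimal span_minimal) auto
  ultimately show "x \<in> S" using m by blast
qed

lemma cspan_orthogonal:
  assumes "x \<in> cspan J" "y \<in> cspan J'" "J \<inter> J' = {}"
  shows "x \<bullet> y = 0"
proof -
  have "cspan J \<subseteq> {y}\<^sup>\<bottom>"
  proof (intro cspan_subset subspace_orthocomplement closed_orthogonal_comp)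
    fix i assume "i \<in> J"
    then have "i \<notin> J'" using assms(3) by blast
    then show "e i \<in> {y}\<^sup>\<bottom>" using assms(2) by (simp add: mem_orthogonal_comp_iff mem_cspan inner_commute[of "e i"])
  qed
  then show ?thesis using assms(1) by (auto simp: mem_orthogonal_comp_iff)
qed

lemma inf_dim_cspan: "infinite J \<Longrightarrow> inf_dim (cspan J)"
  by (rule inf_dim_orthonormal[OF orthonormal_e _ _ subspace_cspan]) (auto intro: e_mem_cspan)

lemma inf_dim_finite_orthogonal_comp:
  assumes "finite (T :: 'a set)"
  shows "inf_dim (T\<^sup>\<bottom>)"
proof -
  have "inf_dim (cspan UNIV)" by (rule inf_dim_cspan) simp
  moreover have "cspan UNIV = UNIV" by (auto simp: mem_cspan)
  ultimately show ?thesis using inf_dim_Int_orthogonal_comp[OF assms, of UNIV] by simp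
qed

lemma orth_agree_cspan:
  assumes "A \<in> orth" "B \<in> orth" "\<And>i. i \<in> J \<Longrightarrow> A (e i) = B (e i)" "x \<in> cspan J"
  shows "A x = B x"
proof -
  note l = orth_linear[OF assms(1)] orth_linear[OF assms(2)]
  note b = orth_bounded_linear[OF assms(1)] orth_bounded_linear[OF assms(2)]
  have "subspace {x. A x = B x}"
    by (auto simp: subspace_def linear_add[OF l(1)] linear_add[OF l(2)] linear_cmul[OF l(1)]
        linear_cmul[OF l(2)] linear_0[OF l(1)] linear_0[OF l(2)])
  moreover have "closed {x. A x = B x}"
    by (intro closed_Collect_eq linear_continuous_on b)
  ultimately have "cspan J \<subseteq> {x. A x = B x}" using assms(3) by (intro cspan_subset) auto
  then show ?thesis using assms(4) by blast
qed

lemma orth_eqI: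
  assumes "A \<in> orth" "B \<in> orth" "\<And>i. A (e i) = B (e i)"
  shows "A = B"
proof
  fix x show "A x = B x" by (rule orth_agree_cspan[OF assms(1,2), of UNIV]) (use assms(3) in \<open>auto simp: mem_cspan\<close>)
qed

text \<open>\<open>fixer (- I)\<close> is the orthogonal group of the block \<open>cspan I\<close>,
  extended by the identity; compare \<open>fixer_preserves\<close>.\<close>

definition fixer :: "nat set \<Rightarrow> ('a \<Rightarrow> 'a) set" where
  "fixer J = {A \<in> orth. \<forall>j\<in>J. A (e j) = e j}"

lemma fixer_orth: "A \<in> fixer J \<Longrightarrow> A \<in> orth" by (simp add: fixer_def)

lemma fixer_antimono: "J \<subseteq> J' \<Longrightarrow> fixer J' \<subseteq> fixer J" by (auto simp: fixer_def)

lemma fixer_empty: "fixer {} = orth" by (simp add: fixer_def)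

lemma fixer_comp: "A \<in> fixer J \<Longrightarrow> B \<in> fixer J \<Longrightarrow> A \<circ> B \<in> fixer J"
  by (simp add: fixer_def orth_comp)

lemma fixer_id: "id \<in> fixer J" by (simp add: fixer_def orth_id)

lemma fixer_inv:
  assumes "A \<in> fixer J"
  shows "finv A \<in> fixer J"
proof -
  have "finv A (e j) = e j" if "j \<in> J" for j
    using assms that orth_inv_apply(2)[of A "e j"] by (simp add: fixer_def)
  then show ?thesis using assms by (simp add: fixer_def orth_inv)
qed

lemma fixer_fixes: "A \<in> fixer J \<Longrightarrow> x \<in> cspan J \<Longrightarrow> A x = x"
  using orth_agree_cspan[of A id J x] by (simp add: fixer_def orth_id)

lemma fixer_preserves:
  assumes "A \<in> fixer J" "x \<in> cspan K" "- J \<subseteq> K"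
  shows "A x \<in> cspan K"
  unfolding mem_cspan
proof (intro allI impI)
  fix i assume "i \<notin> K"
  then have "A (e i) = e i" "x \<bullet> e i = 0" using assms by (auto simp: fixer_def mem_cspan)
  then show "A x \<bullet> e i = 0" using orth_inner[OF fixer_orth[OF assms(1)], of x "e i"] by simp
qed

text \<open>The infinite orthogonal direct sum of the \<open>B n\<close>. Images of basis vectors
  stay in mutually orthogonal blocks, so the main point is their totality.\<close>

lemma glue:
  assumes disj: "\<And>m n. m \<noteq> n \<Longrightarrow> I m \<inter> I n = {}" and B: "\<And>n. B n \<in> fixer (- I n)"
  shows "\<exists>h\<in>orth. (\<forall>n. \<forall>i\<in>I n. h (e i) = B n (e i)) \<and> (\<forall>i. (\<forall>n. i \<notin> I n) \<longrightarrow> h (e i) = e i)"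
proof -
  define f where "f i = (if \<exists>n. i \<in> I n then B (THE n. i \<in> I n) (e i) else e i)" for i
  have the: "(THE n. i \<in> I n) = n" if "i \<in> I n" for i n
    using that disj by (intro the_equality) blast+
  have f1: "f i = B n (e i)" if "i \<in> I n" for i n
    using that the[OF that] unfolding f_def by auto
  have f2: "f i = e i" if "\<And>n. i \<notin> I n" for i
    using that by (simp add: f_def)
  have f1': "f i \<in> cspan (I n)" if "i \<in> I n" for i n
    unfolding f1[OF that] by (rule fixer_preserves[OF B e_mem_cspan[OF that]]) simp
  have "f i \<bullet> f j = (if i = j then 1 else 0)" for i j
  proof (cases "\<exists>n. i \<in> I n")
    case True
    then obtain n where n: "i \<in> I n" by blast
    show ?thesis
    proof (cases "\<exists>m. j \<in> I m")
      case True
      then obtain m where m: "j \<in> I m" by blast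
      show ?thesis
      proof (cases "m = n")
        case True
        then show ?thesis using f1[OF n] f1[of j n] m orth_inner[OF fixer_orth[OF B[of n]]] by simp
      next
        case False
        then have "i \<noteq> j" using disj m n by blast
        then show ?thesis using cspan_orthogonal[OF f1'[OF n] f1'[OF m] disj] False by simp
      qed
    next
      case False
      then have "i \<noteq> j" using n by blast
      then show ?thesis using f1'[OF n] False f2[of j] by (auto simp: mem_cspan)
    qed
  next
    case False
    then have fi: "f i = e i" using f2 by blast
    show ?thesis
    proof (cases "\<exists>m. j \<in> I m")
      case True
      then obtain m where m: "j \<in> I m" by blast
      then have "i \<noteq> j" using False by blast
      then show ?thesis using f1'[OF m] False fi by (simp add: mem_cspan inner_commute[of "e i"])
    next
      case False
      then show ?thesis using f2 fi by simp
    qed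
  qed
  then have onf: "orthonormal_on UNIV f" by (simp add: orthonormal_on_def)
  have "y = 0" if y: "y \<in> (range f)\<^sup>\<bottom>" for y
  proof (rule basis_eqI)
    fix k
    show "y \<bullet> e k = 0 \<bullet> e k"
    proof (cases "\<exists>n. k \<in> I n")
      case True
      then obtain n where n: "k \<in> I n" by blast
      note Bn = fixer_orth[OF B[of n]]
      \<comment> \<open>Orthogonality of \<open>y\<close> to the images of block \<open>n\<close>
        means that \<open>finv (B n) y\<close> is orthogonal to the block itself, in particular to
        \<open>finv (B n) (e k)\<close>.\<close>
      have "cspan (I n) \<subseteq> {finv (B n) y}\<^sup>\<bottom>"
      proof (intro cspan_subset subspace_orthocomplement closed_orthogonal_comp)
        fix i assume i: "i \<in> I n"
        have "y \<bullet> f i = 0" using y by (simp add: mem_orthogonal_comp_iff)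
        then show "e i \<in> {finv (B n) y}\<^sup>\<bottom>"
          using f1[OF i] orth_inner_shift[OF Bn, of y "e i"]
          by (simp add: mem_orthogonal_comp_iff inner_commute[of "e i"])
      qed
      moreover have "finv (B n) (e k) \<in> cspan (I n)"
        by (rule fixer_preserves[OF fixer_inv[OF B] e_mem_cspan[OF n]]) simp
      ultimately have "finv (B n) (e k) \<bullet> finv (B n) y = 0" by (auto simp: mem_orthogonal_comp_iff)
      then show ?thesis using orth_inner[OF orth_inv[OF Bn]] by (simp add: inner_commute)
    next
      case False
      then have "f k = e k" by (simp add: f2)
      then show ?thesis using y by (metis inner_zero_left mem_orthogonal_comp_iff rangeI)
    qed
  qed
  then have "(range f)\<^sup>\<bottom> = {0}" by (auto simp: mem_orthogonal_comp_iff)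
  then obtain h where "h \<in> orth" "\<forall>i\<in>UNIV. h (e i) = f i"
    using orth_extension[OF hilbert_basisD[OF basis] onf] by blast
  then show ?thesis using f1 f2 by (intro bexI[of _ h]) simp_all
qed

lemma permutation_orth:
  assumes "bij \<pi>"
  shows "\<exists>A\<in>orth. \<forall>i. A (e i) = e (\<pi> i)"
proof -
  have on: "orthonormal_on UNIV (\<lambda>i. e (\<pi> i))"
    using assms by (simp add: orthonormal_on_def bij_def inj_eq)
  have "range (\<lambda>i. e (\<pi> i)) = range e"
    using bij_is_surj[OF assms] image_image[of e \<pi> UNIV] by simp
  then have tot: "(range (\<lambda>i. e (\<pi> i)))\<^sup>\<bottom> = {0}" using hilbert_basisD(2)[OF basis] by simp
  show ?thesis using orth_extension[OF hilbert_basisD[OF basis] on tot] by simp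
qed

lemma orth_frame_extension:
  fixes f f' :: "'i \<Rightarrow> 'a"
  assumes "orthonormal_on I f" "inf_dim ((f ` I)\<^sup>\<bottom>)" "orthonormal_on I f'" "inf_dim ((f' ` I)\<^sup>\<bottom>)"
  shows "\<exists>A\<in>orth. \<forall>i\<in>I. A (f i) = f' i"
  by (rule frame_extension[OF basis assms])

text \<open>Both frames are enlarged by the \<open>e j\<close> with \<open>j\<close> in
  \<open>J\<close>. Matching each of these with itself puts the extension in \<open>fixer J\<close>,
  and the complements become those inside \<open>cspan (- J)\<close>.\<close>

lemma fixer_frame_extension:
  fixes p q :: "'i \<Rightarrow> 'a"
  assumes p: "orthonormal_on I p" "\<And>i. i \<in> I \<Longrightarrow> p i \<in> cspan (- J)" "inf_dim (cspan (- J) \<inter> (p ` I)\<^sup>\<bottom>)"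
    and q: "orthonormal_on I q" "\<And>i. i \<in> I \<Longrightarrow> q i \<in> cspan (- J)" "inf_dim (cspan (- J) \<inter> (q ` I)\<^sup>\<bottom>)"
  shows "\<exists>A\<in>fixer J. \<forall>i\<in>I. A (p i) = q i"
proof -
  have on: "orthonormal_on (J <+> I) (case_sum e r)"
    if "orthonormal_on I r" "\<And>i. i \<in> I \<Longrightarrow> r i \<in> cspan (- J)" for r
  proof -
    have "r i \<bullet> e j = 0" "e j \<bullet> r i = 0" if "i \<in> I" "j \<in> J" for i j
      using \<open>\<And>i. i \<in> I \<Longrightarrow> r i \<in> cspan (- J)\<close> that by (auto simp: mem_cspan inner_commute)
    with that(1) show ?thesis
      unfolding orthonormal_on_def Plus_def by (simp add: ball_Un)
  qed
  have im: "(case_sum e r ` (J <+> I))\<^sup>\<bottom> = cspan (- J) \<inter> (r ` I)\<^sup>\<bottom>" for r :: "'i \<Rightarrow> 'a"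
    by (auto simp: Plus_def image_Un image_image cspan_def mem_orthogonal_comp_iff)
  have "\<exists>A\<in>orth. \<forall>i\<in>J <+> I. A (case_sum e p i) = case_sum e q i"
    by (rule orth_frame_extension[OF on[OF p(1,2)] _ on[OF q(1,2)]]) (simp_all add: im p(3) q(3))
  then obtain A where A: "A \<in> orth" "\<And>i. i \<in> J <+> I \<Longrightarrow> A (case_sum e p i) = case_sum e q i" by blast
  have "A \<in> fixer J" using A(1) A(2)[OF InlI] by (simp add: fixer_def)
  moreover have "A (p i) = q i" if "i \<in> I" for i using A(2)[OF InrI[OF that]] by simp
  ultimately show ?thesis by blast
qed

lemma cspan_projection:
  obtains m where "m \<in> cspan J" "x - m \<in> cspan (- J)"
proof -
  obtain m where m: "m \<in> cspan J" "x - m \<in> (cspan J)\<^sup>\<bottom>"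
    using closed_subspace_projection[OF subspace_cspan closed_cspan] by blast
  have "x - m \<in> cspan (- J)"
    using m(2) e_mem_cspan by (auto simp: mem_cspan mem_orthogonal_comp_iff)
  with m that show ?thesis by blast
qed

end

section \<open>Symmetric \<open>\<sigma>\<close>-syndetic subsets of the orthogonal group\<close>

lemma orth_finv_comp: "A \<in> orth \<Longrightarrow> B \<in> orth \<Longrightarrow> finv (A \<circ> B) = finv B \<circ> finv A"
  by (rule o_inv_distrib) (simp_all add: orth_bij)

lemma orth_finv_finv: "A \<in> orth \<Longrightarrow> finv (finv A) = A"
  by (simp add: inv_inv_eq orth_bij)

lemma orth_finv_cancel:
  assumes "c \<in> orth" "A \<in> orth" "B \<in> orth"
  shows "finv (finv c \<circ> A) \<circ> (finv c \<circ> B) = finv A \<circ> B"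
proof -
  have "finv (finv c \<circ> A) = finv A \<circ> c"
    using assms by (simp add: orth_finv_comp orth_inv orth_finv_finv)
  then show ?thesis using assms by (simp add: fun_eq_iff orth_inv_apply)
qed

text \<open>\<open>P n\<close> stands for the trace on \<open>orth\<close> of a power of
  \<open>W\<close>, exponents adding under composition. Keeping it abstract lets \<open>W\<close>
  live in a larger group into which \<open>orth\<close> maps in several ways, one per
  stabilizer.\<close>

locale orth_filtration = hilbert e for e :: "nat \<Rightarrow> 'a::{real_inner,complete_space}" +
  fixes P :: "nat \<Rightarrow> ('a \<Rightarrow> 'a) set" and C :: "('a \<Rightarrow> 'a) set"
  assumes P_orth: "A \<in> P n \<Longrightarrow> A \<in> orth"
    and P_comp: "A \<in> P m \<Longrightarrow> B \<in> P n \<Longrightarrow> A \<circ> B \<in> P (m + n)"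
    and P_inv: "A \<in> P n \<Longrightarrow> finv A \<in> P n"
    and countable_C: "countable C" and C_orth: "C \<subseteq> orth"
    and cover: "A \<in> orth \<Longrightarrow> \<exists>c\<in>C. finv c \<circ> A \<in> P 1"
begin

lemma pigeonhole:
  assumes "uncountable T" and g: "\<And>t. t \<in> T \<Longrightarrow> g t \<in> orth"
  shows "\<exists>s\<in>T. \<exists>t\<in>T. s \<noteq> t \<and> finv (g s) \<circ> g t \<in> P 2"
proof -
  have "\<forall>t\<in>T. \<exists>c\<in>C. finv c \<circ> g t \<in> P 1" using cover g by blast
  then obtain c where c: "\<And>t. t \<in> T \<Longrightarrow> c t \<in> C" "\<And>t. t \<in> T \<Longrightarrow> finv (c t) \<circ> g t \<in> P 1" by metis
  have "countable (c ` T)" by (rule countable_subset[OF _ countable_C]) (use c(1) in blast)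
  then have "\<not> inj_on c T" using countable_image_inj_on[of c T] assms(1) by blast
  then obtain s t where st: "s \<in> T" "t \<in> T" "s \<noteq> t" "c s = c t" by (auto simp: inj_on_def)
  have "finv (finv (c s) \<circ> g s) \<circ> (finv (c t) \<circ> g t) \<in> P (1 + 1)"
    using c(2)[OF st(1)] c(2)[OF st(2)] by (intro P_comp P_inv)
  moreover have "c s \<in> orth" using c(1)[OF st(1)] C_orth by blast
  ultimately have "finv (g s) \<circ> g t \<in> P 2"
    using orth_finv_cancel[of "c s" "g s" "g t"] st g by (simp add: numeral_2_eq_2)
  then show ?thesis using st by blast
qed

text \<open>Each translate that meets \<open>fixer J\<close> gets a new centre at a meeting point;
  the quotient of two elements of one translate then lies in \<open>P 2\<close> instead of
  \<open>P 1\<close>.\<close>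

lemma fixer_cover:
  shows "\<exists>C'. countable C' \<and> C' \<subseteq> fixer J \<and> (\<forall>A\<in>fixer J. \<exists>c\<in>C'. finv c \<circ> A \<in> P 2)"
proof -
  define C0 where "C0 = {c \<in> C. \<exists>A\<in>fixer J. finv c \<circ> A \<in> P 1}"
  have "\<forall>c\<in>C0. \<exists>A\<in>fixer J. finv c \<circ> A \<in> P 1" by (simp add: C0_def)
  then obtain h where h: "\<And>c. c \<in> C0 \<Longrightarrow> h c \<in> fixer J" "\<And>c. c \<in> C0 \<Longrightarrow> finv c \<circ> h c \<in> P 1"
    by metis
  have "countable (h ` C0)" using countable_C by (simp add: C0_def)
  moreover have "\<exists>c\<in>h ` C0. finv c \<circ> A \<in> P 2" if A: "A \<in> fixer J" for A
  proof -
    obtain c where c: "c \<in> C" "finv c \<circ> A \<in> P 1" using cover[OF fixer_orth[OF A]] by blast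
    then have c0: "c \<in> C0" using A by (auto simp: C0_def)
    have "finv (finv c \<circ> h c) \<circ> (finv c \<circ> A) \<in> P (1 + 1)"
      by (intro P_comp P_inv c(2) h(2) c0)
    then have "finv (h c) \<circ> A \<in> P 2"
      using orth_finv_cancel[of c "h c" A] c(1) C_orth fixer_orth[OF h(1)[OF c0]] fixer_orth[OF A]
      by (auto simp: numeral_2_eq_2)
    then show ?thesis using c0 by blast
  qed
  ultimately show ?thesis using h(1) by (intro exI[of _ "h ` C0"]) blast
qed

text \<open>
  If every \<open>I n\<close> failed for the \<open>n\<close>-th translate, gluing the counterexamples on the orthogonal
  blocks \<open>cspan (I n)\<close> would give an operator in no translate.
\<close>

lemma full_block:
  assumes C': "countable C'" "C' \<subseteq> fixer J" "\<And>A. A \<in> fixer J \<Longrightarrow> \<exists>c\<in>C'. finv c \<circ> A \<in> P q"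
    and disj: "\<And>m n. m \<noteq> n \<Longrightarrow> I m \<inter> I n = {}" and I: "\<And>n::nat. I n \<subseteq> - J"
  shows "\<exists>n. \<forall>A\<in>fixer (- I n). \<exists>v\<in>P (2 * q) \<inter> fixer J. \<forall>i\<in>I n. v (e i) = A (e i)"
proof -
  define c where "c = from_nat_into C'"
  have "C' \<noteq> {}" using C'(3)[OF fixer_id] by blast
  then have rc: "range c = C'" unfolding c_def using C'(1) by (rule range_from_nat_into)
  define Q where "Q n A w \<longleftrightarrow> w \<in> fixer J \<and> finv (c n) \<circ> w \<in> P q \<and> (\<forall>i\<in>I n. w (e i) = A (e i))" for n A w
  have "\<exists>n. \<forall>A\<in>fixer (- I n). \<exists>w. Q n A w"
  proof (rule ccontr)
    assume "\<not> ?thesis"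
    then have "\<forall>n. \<exists>A. A \<in> fixer (- I n) \<and> (\<forall>w. \<not> Q n A w)" by blast
    then obtain B where B: "\<And>n. B n \<in> fixer (- I n)" "\<And>n w. \<not> Q n (B n) w" by metis
    have "\<exists>h\<in>orth. (\<forall>n. \<forall>i\<in>I n. h (e i) = B n (e i)) \<and> (\<forall>i. (\<forall>n. i \<notin> I n) \<longrightarrow> h (e i) = e i)"
      by (rule glue[where I = I and B = B]) (simp_all add: disj B(1))
    then obtain h where h: "h \<in> orth" "\<forall>n. \<forall>i\<in>I n. h (e i) = B n (e i)"
      "\<forall>i. (\<forall>n. i \<notin> I n) \<longrightarrow> h (e i) = e i" by blast
    have hJ: "h \<in> fixer J"
      unfolding fixer_def
    proof (intro CollectI conjI ballI h(1))
      fix j assume "j \<in> J"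
      then have "\<forall>n. j \<notin> I n" using I by blast
      then show "h (e j) = e j" using h(3) by blast
    qed
    then obtain c' where c': "c' \<in> C'" "finv c' \<circ> h \<in> P q" using C'(3) by blast
    then obtain n where "c' = c n" using rc by blast
    with c' have "finv (c n) \<circ> h \<in> P q" by simp
    then have "Q n (B n) h" using hJ h(2) by (simp add: Q_def)
    then show False using B(2) by blast
  qed
  then obtain n where n: "\<And>A. A \<in> fixer (- I n) \<Longrightarrow> \<exists>w. Q n A w" by blast
  \<comment> \<open>The same translate also realizes the identity, by \<open>w0\<close>. The
    quotient \<open>finv w0 \<circ> w\<close> is free of the centre \<open>c n\<close> and still
    acts as \<open>A\<close> on the block, where \<open>w0\<close> is trivial.\<close>
  obtain w0 where w0: "Q n id w0" using n[OF fixer_id] by blast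
  have "\<exists>v\<in>P (2 * q) \<inter> fixer J. \<forall>i\<in>I n. v (e i) = A (e i)" if A: "A \<in> fixer (- I n)" for A
  proof -
    obtain w where w: "Q n A w" using n[OF A] by blast
    have "finv (finv (c n) \<circ> w0) \<circ> (finv (c n) \<circ> w) \<in> P (q + q)"
      using w w0 by (intro P_comp P_inv) (auto simp: Q_def)
    moreover have "c n \<in> orth" using rc C'(2) fixer_orth by blast
    ultimately have "finv w0 \<circ> w \<in> P (2 * q)"
      using orth_finv_cancel[of "c n" w0 w] w w0 by (auto simp: Q_def fixer_def mult_2)
    moreover have "finv w0 \<circ> w \<in> fixer J" using w w0 by (intro fixer_comp fixer_inv) (auto simp: Q_def)
    moreover have "(finv w0 \<circ> w) (e i) = A (e i)" if i: "i \<in> I n" for i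
    proof -
      have o: "w0 \<in> orth" using w0 by (auto simp: Q_def fixer_def)
      have "A (e i) \<in> cspan (I n)" by (rule fixer_preserves[OF A e_mem_cspan[OF i]]) simp
      then have "w0 (A (e i)) = id (A (e i))"
        by (rule orth_agree_cspan[OF o orth_id, rotated]) (use w0 in \<open>simp add: Q_def\<close>)
      then have "finv w0 (A (e i)) = A (e i)" using orth_inv_apply(2)[OF o, of "A (e i)"] by simp
      then show ?thesis using w i by (simp add: Q_def)
    qed
    ultimately show ?thesis by blast
  qed
  then show ?thesis by blast
qed

end

section \<open>Localized commutators and the infinite swindle\<close>

context hilbert
begin

text \<open>Nothing more is known of \<open>u\<close> off \<open>M\<close> or of \<open>v\<close> on
  \<open>M - K\<close>, yet the two cannot interfere: \<open>v\<close> maps the block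
  \<open>M - K\<close> to itself, where \<open>u\<close> is the identity, and \<open>u\<close> maps
  the block \<open>- M\<close> to itself, where \<open>v\<close> is the identity.\<close>

lemma commutator_agree:
  assumes KM: "K \<subseteq> M" and g: "g \<in> fixer (- K)" and h: "h \<in> fixer (- K)"
    and u: "u \<in> orth" "\<And>i. i \<in> M \<Longrightarrow> u (e i) = g (e i)"
    and v: "v \<in> fixer (- M)" "\<And>i. i \<in> K \<Longrightarrow> v (e i) = h (e i)"
  shows "u \<circ> v \<circ> finv u \<circ> finv v = g \<circ> h \<circ> finv g \<circ> finv h"
proof -
  note go = fixer_orth[OF g] and ho = fixer_orth[OF h] and vo = fixer_orth[OF v(1)]
  define c where "c = g \<circ> h \<circ> finv g \<circ> finv h"
  have c: "c \<in> fixer (- K)" unfolding c_def by (intro fixer_comp fixer_inv g h)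
  have uM: "u x = g x" if "x \<in> cspan M" for x by (rule orth_agree_cspan[OF u(1) go u(2) that])
  have vK: "v x = h x" if "x \<in> cspan K" for x by (rule orth_agree_cspan[OF vo ho v(2) that])
  have gM: "g \<in> fixer (- M)" using g fixer_antimono[of "- M" "- K"] KM by blast
  have pK: "A x \<in> cspan K" if "A \<in> fixer (- K)" "x \<in> cspan K" for A x
    by (rule fixer_preserves[OF that]) simp
  have pM: "A x \<in> cspan M" if "A \<in> fixer (- M)" "x \<in> cspan M" for A x
    by (rule fixer_preserves[OF that]) simp
  \<comment> \<open>In the form uv = cvu the claim is checked on basis vectors without applying the
    inverse of \<open>u\<close>, which is uncontrolled off \<open>M\<close>.\<close>
  have "(u \<circ> v) (e i) = (c \<circ> (v \<circ> u)) (e i)" for i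
  proof -
    consider "i \<in> K" | "i \<in> M - K" | "i \<notin> M" using KM by blast
    then show ?thesis
    proof cases
      case 1
      note ei = e_mem_cspan[OF 1]
      have "u (v (e i)) = g (h (e i))"
        using uM[OF subsetD[OF cspan_mono[OF KM] pK[OF h ei]]] v(2)[OF 1] by simp
      moreover have "v (u (e i)) = h (g (e i))"
        using u(2)[of i] 1 KM vK[OF pK[OF g ei]] by auto
      ultimately show ?thesis by (simp add: c_def orth_inv_apply go ho)
    next
      case 2
      have ve: "v (e i) \<in> cspan (M - K)"
        unfolding mem_cspan
      proof (intro allI impI)
        fix j assume "j \<notin> M - K"
        then consider "j \<notin> M" | "j \<in> K" by blast
        then show "v (e i) \<bullet> e j = 0"
        proof cases
          case 1
          then have "v (e j) = e j" using v(1) by (simp add: fixer_def)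
          moreover have "i \<noteq> j" using 1 2 by blast
          ultimately show ?thesis using orth_inner[OF vo, of "e i" "e j"] by simp
        next
          case j: 2
          have "finv h (e j) \<in> cspan K" by (rule pK[OF fixer_inv[OF h] e_mem_cspan[OF j]])
          then have "v (finv h (e j)) = e j" "finv h (e j) \<bullet> e i = 0"
            using vK[of "finv h (e j)"] 2 by (simp_all add: orth_inv_apply ho mem_cspan)
          then show ?thesis using orth_inner[OF vo, of "e i" "finv h (e j)"] by (simp add: inner_commute)
        qed
      qed
      have "cspan (M - K) \<subseteq> cspan M" "cspan (M - K) \<subseteq> cspan (- K)" by (intro cspan_mono; blast)+
      then have ve': "v (e i) \<in> cspan M" "v (e i) \<in> cspan (- K)" using ve by blast+
      have "u (v (e i)) = v (e i)" "c (v (e i)) = v (e i)"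
        using uM[OF ve'(1)] fixer_fixes[OF g ve'(2)] fixer_fixes[OF c ve'(2)] by simp_all
      moreover have "u (e i) = e i" using u(2)[of i] 2 g by (simp add: fixer_def)
      ultimately show ?thesis by simp
    next
      case 3
      have ue: "u (e i) \<in> cspan (- M)"
        unfolding mem_cspan
      proof (intro allI impI)
        fix j assume "j \<notin> - M"
        then have j: "j \<in> M" by simp
        have "finv g (e j) \<in> cspan M" by (rule pM[OF fixer_inv[OF gM] e_mem_cspan[OF j]])
        then have "u (finv g (e j)) = e j" "finv g (e j) \<bullet> e i = 0"
          using uM[of "finv g (e j)"] 3 by (simp_all add: orth_inv_apply go mem_cspan)
        then show "u (e i) \<bullet> e j = 0"
          using orth_inner[OF u(1), of "e i" "finv g (e j)"] by (simp add: inner_commute)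
      qed
      have "v (u (e i)) = u (e i)" by (rule fixer_fixes[OF v(1) ue])
      moreover have "c (u (e i)) = u (e i)"
        using fixer_fixes[OF c] ue cspan_mono[of "- M" "- K"] KM by blast
      moreover have "v (e i) = e i" using v(1) 3 by (simp add: fixer_def)
      ultimately show ?thesis by simp
    qed
  qed
  then have eq: "u \<circ> v = c \<circ> (v \<circ> u)"
    by (intro orth_eqI orth_comp u(1) vo fixer_orth[OF c])
  have "(u \<circ> v \<circ> finv u \<circ> finv v) x = c x" for x
    using fun_cong[OF eq, of "finv u (finv v x)"] by (simp add: orth_inv_apply u(1) vo)
  then show ?thesis unfolding c_def by (rule ext)
qed

text \<open>Cuts \<open>range \<kappa>\<close> into infinite blocks indexed by the integers, through
  the pairing of \<open>nat\<close> with itself.\<close>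

definition level :: "(nat \<Rightarrow> nat) \<Rightarrow> int \<Rightarrow> nat set" where
  "level \<kappa> z = range (\<lambda>j. \<kappa> (prod_encode (int_encode z, j)))"

text \<open>
  The infinite swindle: with \<open>s\<close> shifting the blocks \<open>level \<kappa> z\<close> to \<open>level \<kappa> (z + 1)\<close> and \<open>a\<close>
  acting as a copy of \<open>g\<close> on each block with \<open>z \<ge> 0\<close>, the commutator of \<open>a\<close> and \<open>s\<close> is \<open>g\<close>.
\<close>

lemma swindle:
  assumes \<kappa>: "inj \<kappa>" and g: "g \<in> fixer (- level \<kappa> 0)"
  obtains a s where "a \<in> fixer (- range \<kappa>)" "s \<in> fixer (- range \<kappa>)" "a \<circ> s \<circ> finv a \<circ> finv s = g"
proof -
  define k where "k w j = \<kappa> (prod_encode (int_encode w, j))" for w j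
  have k_inj: "k w j = k w' j' \<longleftrightarrow> w = w' \<and> j = j'" for w j w' j'
    using \<kappa> by (simp add: k_def inj_eq inj_prod_encode inj_int_encode)
  have k_range: "k w j \<in> range \<kappa>" for w j by (simp add: k_def)
  have k_cases: "\<exists>w j. i = k w j" if "i \<in> range \<kappa>" for i
  proof -
    from that obtain m where m: "i = \<kappa> m" by (rule rangeE)
    have "m = prod_encode (int_encode (int_decode (fst (prod_decode m))), snd (prod_decode m))" by simp
    then show ?thesis using m unfolding k_def by metis
  qed
  have lev: "i \<in> level \<kappa> w \<longleftrightarrow> (\<exists>j. i = k w j)" for i w by (auto simp: level_def k_def)
  \<comment> \<open>Translation of the integer address by \<open>z\<close>. The \<open>SOME\<close>
    picks the unique address of an index, and indices off \<open>range \<kappa>\<close> stay put, so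
    that \<open>S 1\<close> fixes their basis vectors.\<close>
  define sh where "sh z i = (if i \<in> range \<kappa> then
      (let (w, j) = (SOME p. i = k (fst p) (snd p)) in k (w + z) j) else i)" for z i
  have sh_k: "sh z (k w j) = k (w + z) j" for z w j
  proof -
    have "(SOME p. k w j = k (fst p) (snd p)) = (w, j)"
      by (rule some_equality) (auto simp: k_inj)
    then show ?thesis by (simp add: sh_def k_range)
  qed
  have sh_out: "sh z i = i" if "i \<notin> range \<kappa>" for z i using that by (simp add: sh_def)
  have sh_add: "sh z (sh w i) = sh (w + z) i" for z w i
  proof (cases "i \<in> range \<kappa>")
    case True
    then obtain w' j where "i = k w' j" using k_cases by blast
    then show ?thesis by (simp add: sh_k add.assoc)
  qed (simp add: sh_out)
  have sh_0: "sh 0 i = i" for i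
  proof (cases "i \<in> range \<kappa>")
    case True
    then obtain w' j where "i = k w' j" using k_cases by blast
    then show ?thesis by (simp add: sh_k)
  qed (simp add: sh_out)
  have "bij (sh z)" for z
    by (rule o_bij[of "sh (- z)"]) (simp_all add: fun_eq_iff sh_add sh_0)
  then have "\<exists>A. A \<in> orth \<and> (\<forall>i. A (e i) = e (sh z i))" for z
    using permutation_orth by metis
  then obtain S where S: "\<And>z. S z \<in> orth" "\<And>z i. S z (e i) = e (sh z i)" by metis
  have S_add: "S z (S w x) = S (w + z) x" for z w x
  proof -
    have "S z \<circ> S w = S (w + z)" by (rule orth_eqI) (simp_all add: S orth_comp sh_add)
    then show ?thesis by (metis comp_apply)
  qed
  have S_0: "S 0 x = x" for x
  proof -
    have "S 0 = id" by (rule orth_eqI) (simp_all add: S orth_id sh_0)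
    then show ?thesis by simp
  qed
  have S_inv: "finv (S z) = S (- z)" for z
  proof
    fix x
    show "finv (S z) x = S (- z) x" using orth_inv_apply(2)[OF S(1), of z "S (- z) x"] by (simp add: S_add S_0)
  qed
  define G where "G z = S z \<circ> g \<circ> S (- z)" for z
  have G_orth: "G z \<in> orth" for z unfolding G_def by (intro orth_comp S fixer_orth[OF g])
  have G_fix: "G z \<in> fixer (- level \<kappa> z)" for z
    unfolding fixer_def
  proof (intro CollectI conjI ballI G_orth)
    fix i assume i: "i \<in> - level \<kappa> z"
    have "sh (- z) i \<notin> level \<kappa> 0"
    proof
      assume "sh (- z) i \<in> level \<kappa> 0"
      then obtain j where "sh (- z) i = k 0 j" using lev by blast
      then have "sh z (sh (- z) i) = k z j" by (simp add: sh_k)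
      then have "i = k z j" by (simp add: sh_add sh_0)
      then show False using i lev by blast
    qed
    then have "g (e (sh (- z) i)) = e (sh (- z) i)" using g by (simp add: fixer_def)
    then show "G z (e i) = e i" by (simp add: G_def S sh_add sh_0)
  qed
  have disj: "level \<kappa> w \<inter> level \<kappa> z = {}" if "w \<noteq> z" for w z
    using that by (auto simp: lev k_inj)
  have "\<exists>a\<in>orth. (\<forall>n. \<forall>i\<in>level \<kappa> (int n). a (e i) = G (int n) (e i)) \<and>
      (\<forall>i. (\<forall>n. i \<notin> level \<kappa> (int n)) \<longrightarrow> a (e i) = e i)"
    by (rule glue[where I = "\<lambda>n. level \<kappa> (int n)" and B = "\<lambda>n. G (int n)"]) (simp_all add: disj G_fix)
  then obtain a where a: "a \<in> orth" "\<And>n i. i \<in> level \<kappa> (int n) \<Longrightarrow> a (e i) = G (int n) (e i)"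
    "\<And>i. (\<And>n. i \<notin> level \<kappa> (int n)) \<Longrightarrow> a (e i) = e i"
    by blast
  have aK: "a \<in> fixer (- range \<kappa>)"
    using a(1,3) by (auto simp: fixer_def level_def)
  have sK: "S 1 \<in> fixer (- range \<kappa>)"
    using S by (simp add: fixer_def sh_out)
  \<comment> \<open>\<open>b\<close> carries the copies of \<open>g\<close> on the blocks with
    positive index only, so \<open>a\<close> and \<open>b\<close> differ by \<open>g\<close> on
    block 0: \<open>a = g \<circ> b\<close> is the commutator identity.\<close>
  define b where "b = S 1 \<circ> a \<circ> finv (S 1)"
  have b_orth: "b \<in> orth" unfolding b_def by (intro orth_comp orth_inv S a)
  have ge: "g (e i) = e i" if "i \<notin> level \<kappa> 0" for i using g that by (simp add: fixer_def)
  have "a (e i) = (g \<circ> b) (e i)" for i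
  proof (cases "i \<in> range \<kappa>")
    case False
    then have "i \<notin> level \<kappa> w" for w by (auto simp: level_def)
    then show ?thesis using False by (simp add: b_def S_inv S sh_out a(3) ge)
  next
    case True
    then obtain w j where i: "i = k w j" using k_cases by blast
    have b_i: "b (e i) = S 1 (a (e (k (w - 1) j)))" by (simp add: b_def S_inv S i sh_k)
    consider n where "w = int (Suc n)" | "w = 0" | "w < 0"
      by (metis int_cases3 int_nat_eq less_linear nonneg_int_cases not0_implies_Suc of_nat_0 zero_less_imp_eq_int gr0_implies_Suc)
    then show ?thesis
    proof cases
      case 1
      then have wn: "w - 1 = int n" by simp
      have "a (e (k (w - 1) j)) = G (int n) (e (k (w - 1) j))"
        unfolding wn by (rule a(2)) (auto simp: lev)
      also have "\<dots> = S (int n) (g (e (k 0 j)))" by (simp add: G_def S sh_k wn)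
      finally have "b (e i) = S w (g (e (k 0 j)))" using 1 by (simp add: b_i S_add add.commute)
      also have "\<dots> = G w (e i)" by (simp add: G_def S i sh_k)
      also have "\<dots> = a (e i)" unfolding 1 by (rule a(2)[symmetric]) (auto simp: lev i 1)
      finally have ba: "b (e i) = a (e i)" .
      have "a (e i) = G w (e i)" unfolding 1 by (rule a(2)) (auto simp: lev i 1)
      also have "\<dots> \<in> cspan (level \<kappa> w)"
        by (rule fixer_preserves[OF G_fix e_mem_cspan]) (auto simp: lev i)
      finally have "a (e i) \<in> cspan (- level \<kappa> 0)"
        using cspan_mono[of "level \<kappa> w" "- level \<kappa> 0"] disj[of w 0] 1 by auto
      then show ?thesis using fixer_fixes[OF g] ba by simp
    next
      case 2
      have "a (e (k (- 1) j)) = e (k (- 1) j)" by (rule a(3)) (auto simp: lev k_inj)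
      then have "b (e i) = e i" using 2 unfolding b_i by (simp add: S sh_k i)
      moreover have "a (e i) = G (int 0) (e i)" by (rule a(2)) (auto simp: lev i 2)
      ultimately show ?thesis by (simp add: G_def S_0)
    next
      case 3
      have "a (e (k (w - 1) j)) = e (k (w - 1) j)" by (rule a(3)) (use 3 in \<open>auto simp: lev k_inj\<close>)
      then have "b (e i) = e i" unfolding b_i by (simp add: S sh_k i)
      moreover have "a (e i) = e i" by (rule a(3)) (use 3 in \<open>auto simp: lev k_inj i\<close>)
      moreover have "g (e i) = e i" by (rule ge) (use 3 in \<open>auto simp: lev k_inj i\<close>)
      ultimately show ?thesis by simp
    qed
  qed
  then have agb: "a = g \<circ> b" by (intro orth_eqI a(1) orth_comp fixer_orth[OF g] b_orth)
  have "(a \<circ> S 1 \<circ> finv a \<circ> finv (S 1)) x = g x" for x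
  proof -
    define y where "y = S 1 (finv a (finv (S 1) x))"
    have "b y = x" by (simp add: b_def y_def orth_inv_apply S a(1))
    then show ?thesis using fun_cong[OF agb, of y] by (simp add: y_def)
  qed
  then have "a \<circ> S 1 \<circ> finv a \<circ> finv (S 1) = g" by (rule ext)
  with aK sK that show ?thesis by blast
qed

end

section \<open>The fixer of an infinite coinfinite set\<close>

context orth_filtration
begin

text \<open>\<open>commutator_agree\<close> wants \<open>v\<close> to be trivial off
  \<open>M\<close>, which a full block alone does not give. Hence two of them: \<open>M\<close>
  comes from all of \<open>orth\<close> and yields \<open>u\<close> in \<open>P 2\<close>; the
  second, inside \<open>M\<close>, comes from the translates recentred in \<open>fixer (- M)\<close>
  and yields \<open>v\<close> in \<open>P 4\<close>.\<close>

lemma fixer_infinite_subset_P: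
  obtains D where "infinite D" "infinite (- D)" "fixer D \<subseteq> P 12"
proof -
  have inj2: "prod_encode (m, i) = prod_encode (n, j) \<longleftrightarrow> m = n \<and> i = j" for m n i j
    by (simp add: inj_eq[OF inj_prod_encode(1)])
  have "\<exists>m. \<forall>A\<in>fixer (- range (\<lambda>j. prod_encode (m, j))). \<exists>v\<in>P (2 * 1) \<inter> fixer {}.
      \<forall>i\<in>range (\<lambda>j. prod_encode (m, j)). v (e i) = A (e i)"
  proof (rule full_block[OF countable_C])
    show "C \<subseteq> fixer {}" by (simp add: fixer_empty C_orth)
    show "\<exists>c\<in>C. finv c \<circ> A \<in> P 1" if "A \<in> fixer {}" for A
      using cover[OF fixer_orth[OF that]] .
  qed (auto simp: inj2)
  then obtain m where m: "\<And>A. A \<in> fixer (- range (\<lambda>j. prod_encode (m, j))) \<Longrightarrow>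
      \<exists>v\<in>P (2 * 1) \<inter> fixer {}. \<forall>i\<in>range (\<lambda>j. prod_encode (m, j)). v (e i) = A (e i)"
    by blast
  define M where "M = range (\<lambda>j. prod_encode (m, j))"
  from fixer_cover[of "- M"] obtain C' where C': "countable C'" "C' \<subseteq> fixer (- M)"
    "\<forall>A\<in>fixer (- M). \<exists>c\<in>C'. finv c \<circ> A \<in> P 2"
    by (elim exE conjE)
  \<comment> \<open>Splits \<open>M\<close> into infinitely many blocks for the second diagonal
    argument. \<open>\<kappa>\<close> enumerates the one that is full, and \<open>swindle\<close>
    splits it once more.\<close>
  define \<mu> where "\<mu> n j = prod_encode (m, prod_encode (n, j))" for n j
  have "\<exists>n. \<forall>A\<in>fixer (- range (\<mu> n)). \<exists>v\<in>P (2 * 2) \<inter> fixer (- M). \<forall>i\<in>range (\<mu> n). v (e i) = A (e i)"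
  proof (rule full_block[where I = "\<lambda>n. range (\<mu> n)" and C' = C'])
    show "range (\<mu> i) \<inter> range (\<mu> j) = {}" if "i \<noteq> j" for i j
      using that by (auto simp: \<mu>_def inj2)
    show "range (\<mu> i) \<subseteq> - (- M)" for i by (auto simp: \<mu>_def M_def)
  qed (use C' in auto)
  then obtain n where n: "\<And>A. A \<in> fixer (- range (\<mu> n)) \<Longrightarrow>
      \<exists>v\<in>P (2 * 2) \<inter> fixer (- M). \<forall>i\<in>range (\<mu> n). v (e i) = A (e i)"
    by blast
  define \<kappa> where "\<kappa> = \<mu> n"
  have \<kappa>: "inj \<kappa>" by (auto simp: \<kappa>_def \<mu>_def inj_def inj2)
  have KM: "range \<kappa> \<subseteq> M" by (auto simp: \<kappa>_def \<mu>_def M_def)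
  have inf: "infinite (level \<kappa> z)" for z
    unfolding level_def using \<kappa> by (intro range_inj_infinite) (auto intro!: injI simp: inj_eq inj2)
  show ?thesis
  proof (rule that)
    show "infinite (- level \<kappa> 0)"
    proof (rule infinite_super[OF _ inf[of 1]])
      show "level \<kappa> 1 \<subseteq> - level \<kappa> 0"
        using \<kappa> by (auto simp: level_def inj_eq inj2 inj_eq[OF inj_int_encode])
    qed
    show "infinite (- (- level \<kappa> 0))" using inf by simp
    show "fixer (- level \<kappa> 0) \<subseteq> P 12"
    proof
      fix g assume "g \<in> fixer (- level \<kappa> 0)"
      then obtain a s where as: "a \<in> fixer (- range \<kappa>)" "s \<in> fixer (- range \<kappa>)"
        "a \<circ> s \<circ> finv a \<circ> finv s = g" using swindle[OF \<kappa>] by blast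
      have "a \<in> fixer (- M)" using as(1) fixer_antimono[of "- M" "- range \<kappa>"] KM by blast
      from m[OF this[unfolded M_def]]
      obtain u where u: "u \<in> P 2" "\<And>i. i \<in> M \<Longrightarrow> u (e i) = a (e i)"
        unfolding M_def[symmetric] mult_1_right by blast
      have "\<exists>v\<in>P (2 * 2) \<inter> fixer (- M). \<forall>i\<in>range \<kappa>. v (e i) = s (e i)"
        using n as(2) unfolding \<kappa>_def by blast
      then obtain v where v: "v \<in> P 4" "v \<in> fixer (- M)" "\<And>i. i \<in> range \<kappa> \<Longrightarrow> v (e i) = s (e i)"
        by auto
      have "u \<circ> v \<circ> finv u \<circ> finv v \<in> P (2 + 4 + 2 + 4)" by (intro P_comp P_inv u v)
      then show "g \<in> P 12"
        using commutator_agree[OF KM as(1,2) P_orth[OF u(1)] u(2) v(2,3)] as(3) by simp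
    qed
  qed
qed

end

section \<open>Almost disjoint sets and a second fixer\<close>

lemma infinite_coinfinite_bij:
  fixes A B :: "nat set"
  assumes "infinite A" "infinite (- A)" "infinite B" "infinite (- B)"
  obtains \<pi> where "bij \<pi>" "\<pi> ` A = B"
proof -
  have bb: "\<exists>f. bij_betw f X Y" if "infinite X" "infinite Y" for X Y :: "nat set"
    using bij_betw_trans[OF bij_betw_inv_into[OF bij_enumerate[OF that(1)]] bij_enumerate[OF that(2)]] by blast
  obtain f where f: "bij_betw f A B" using bb assms by blast
  obtain g where g: "bij_betw g (- A) (- B)" using bb assms by blast
  define \<pi> where "\<pi> x = (if x \<in> A then f x else g x)" for x
  have "bij_betw \<pi> A B" using f by (rule bij_betw_cong[THEN iffD1, rotated]) (simp add: \<pi>_def)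
  moreover have "bij_betw \<pi> (- A) (- B)" using g by (rule bij_betw_cong[THEN iffD1, rotated]) (simp add: \<pi>_def)
  ultimately have "bij_betw \<pi> (A \<union> - A) (B \<union> - B)" by (rule bij_betw_combine) simp
  then have "bij \<pi>" by simp
  moreover have "\<pi> ` A = B" using \<open>bij_betw \<pi> A B\<close> by (simp add: bij_betw_def)
  ultimately show ?thesis by (rule that)
qed

text \<open>The graph of the rounded line of slope \<open>r\<close>, coded in \<open>nat\<close>.
  Lines of different slope drift apart, and the factor 2 keeps the odd numbers out of every
  set.\<close>

definition almost_disjoint :: "real \<Rightarrow> nat set" where
  "almost_disjoint r = range (\<lambda>n. 2 * prod_encode (n, int_encode \<lfloor>r * real n\<rfloor>))"

lemma infinite_almost_disjoint: "infinite (almost_disjoint r)"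
  unfolding almost_disjoint_def by (rule range_inj_infinite) (auto intro!: injI simp: inj_eq[OF inj_prod_encode(1)])

lemma almost_disjoint_even: "i \<in> almost_disjoint r \<Longrightarrow> even i" by (auto simp: almost_disjoint_def)

lemma finite_almost_disjoint_Int:
  assumes "r \<noteq> s"
  shows "finite (almost_disjoint r \<inter> almost_disjoint s)"
proof -
  obtain N :: nat where N: "1 / \<bar>r - s\<bar> < real N" using reals_Archimedean2 by blast
  have "almost_disjoint r \<inter> almost_disjoint s \<subseteq> (\<lambda>n. 2 * prod_encode (n, int_encode \<lfloor>r * real n\<rfloor>)) ` {..<N}"
  proof
    fix i assume "i \<in> almost_disjoint r \<inter> almost_disjoint s"
    then obtain n m where i: "i = 2 * prod_encode (n, int_encode \<lfloor>r * real n\<rfloor>)"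
      "i = 2 * prod_encode (m, int_encode \<lfloor>s * real m\<rfloor>)"
      by (auto simp: almost_disjoint_def)
    then have "prod_encode (n, int_encode \<lfloor>r * real n\<rfloor>) = prod_encode (m, int_encode \<lfloor>s * real m\<rfloor>)"
      by linarith
    then have "(n, int_encode \<lfloor>r * real n\<rfloor>) = (m, int_encode \<lfloor>s * real m\<rfloor>)"
      by (rule injD[OF inj_prod_encode(1)])
    then have nm: "n = m \<and> int_encode \<lfloor>r * real n\<rfloor> = int_encode \<lfloor>s * real m\<rfloor>"
      by (rule iffD1[OF prod.inject])
    then have "\<lfloor>r * real n\<rfloor> = \<lfloor>s * real m\<rfloor>"
      using injD[OF inj_int_encode(1)] by blast
    then have "\<lfloor>r * real n\<rfloor> = \<lfloor>s * real n\<rfloor>" using nm by simp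
    then have "\<bar>r * real n - s * real n\<bar> < 1" by linarith
    then have "\<bar>r - s\<bar> * real n < 1" by (simp add: abs_mult flip: left_diff_distrib)
    then have "real n < 1 / \<bar>r - s\<bar>" using assms by (simp add: field_simps)
    then have "n < N" using N by linarith
    then show "i \<in> (\<lambda>n. 2 * prod_encode (n, int_encode \<lfloor>r * real n\<rfloor>)) ` {..<N}" using i by blast
  qed
  then show ?thesis by (rule finite_subset) simp
qed

context orth_filtration
begin

text \<open>The quotient \<open>k\<close> of two permutation operators permutes the basis by
  \<open>\<sigma>\<close>. Transported by \<open>\<pi> r\<close>, \<open>D\<close> and its image
  under \<open>\<sigma>\<close> become two almost disjoint sets of even numbers, whence the finite
  intersection and the infinite common complement. Conjugation by \<open>k\<close> adds 2 on each
  side of 12.\<close>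

lemma two_fixers:
  obtains D D' where "infinite D" "infinite D'" "finite (D \<inter> D')" "infinite (- (D \<union> D'))"
    "fixer D \<subseteq> P 12" "fixer D' \<subseteq> P 16"
proof -
  obtain D where D: "infinite D" "infinite (- D)" "fixer D \<subseteq> P 12" by (rule fixer_infinite_subset_P)
  have "infinite (- almost_disjoint r)" for r
  proof (rule infinite_super)
    show "range (\<lambda>n::nat. 2 * n + 1) \<subseteq> - almost_disjoint r" by (auto dest: almost_disjoint_even)
    show "infinite (range (\<lambda>n::nat. 2 * n + 1))" by (rule range_inj_infinite) (simp add: inj_def)
  qed
  then have "\<exists>\<pi>. bij \<pi> \<and> \<pi> ` D = almost_disjoint r" for r
    using infinite_coinfinite_bij[OF D(1,2) infinite_almost_disjoint] by metis
  then obtain \<pi> where \<pi>: "\<And>r. bij (\<pi> r)" "\<And>r. \<pi> r ` D = almost_disjoint r" by metis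
  have "\<exists>A. A \<in> orth \<and> (\<forall>i. A (e i) = e (\<pi> r i))" for r using permutation_orth[OF \<pi>(1)] by blast
  then obtain g where g: "\<And>r. g r \<in> orth" "\<And>r i. g r (e i) = e (\<pi> r i)" by metis
  obtain r s where rs: "r \<noteq> s" "finv (g r) \<circ> g s \<in> P 2"
    using pigeonhole[OF uncountable_UNIV_real, of g, OF g(1)] by blast
  define k where "k = finv (g r) \<circ> g s"
  define \<sigma> where "\<sigma> = finv (\<pi> r) \<circ> \<pi> s"
  have \<sigma>: "bij \<sigma>" unfolding \<sigma>_def by (intro bij_comp bij_imp_bij_inv \<pi>)
  have \<pi>\<sigma>: "\<pi> r (\<sigma> i) = \<pi> s i" for i
    using \<pi>(1)[of r] by (simp add: \<sigma>_def bij_is_surj surj_f_inv_f)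
  have ko: "k \<in> orth" unfolding k_def by (intro orth_comp orth_inv g)
  have kP: "k \<in> P 2" using rs(2) by (simp add: k_def)
  have k: "k (e i) = e (\<sigma> i)" for i
  proof -
    have "g r (e (\<sigma> i)) = g s (e i)" by (simp add: g \<pi>\<sigma>)
    then show ?thesis using orth_inv_apply(2)[OF g(1)[of r], of "e (\<sigma> i)"] by (simp add: k_def)
  qed
  have im: "\<pi> r ` \<sigma> ` D = almost_disjoint s" using \<pi>(2)[of s] by (simp add: image_image \<pi>\<sigma>)
  have injr: "inj (\<pi> r)" by (rule bij_is_inj[OF \<pi>(1)])
  show ?thesis
  proof (rule that[of D "\<sigma> ` D"])
    show "infinite D" by (rule D(1))
    show "infinite (\<sigma> ` D)" using D(1) finite_imageD[OF _ inj_on_subset[OF bij_is_inj[OF \<sigma>]]] by blast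
    have "\<pi> r ` (D \<inter> \<sigma> ` D) = almost_disjoint r \<inter> almost_disjoint s" by (simp add: image_Int[OF injr] \<pi>(2) im)
    then have "finite (\<pi> r ` (D \<inter> \<sigma> ` D))" using finite_almost_disjoint_Int[OF rs(1)] by simp
    then show "finite (D \<inter> \<sigma> ` D)" by (rule finite_imageD) (rule inj_on_subset[OF injr subset_UNIV])
    have "\<pi> r ` (- (D \<union> \<sigma> ` D)) = - (almost_disjoint r \<union> almost_disjoint s)"
      unfolding bij_image_Compl_eq[OF \<pi>(1)] by (simp add: image_Un \<pi>(2) im)
    moreover have "infinite (- (almost_disjoint r \<union> almost_disjoint s))"
    proof (rule infinite_super)
      show "range (\<lambda>n::nat. 2 * n + 1) \<subseteq> - (almost_disjoint r \<union> almost_disjoint s)" by (auto dest: almost_disjoint_even)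
      show "infinite (range (\<lambda>n::nat. 2 * n + 1))" by (rule range_inj_infinite) (simp add: inj_def)
    qed
    ultimately show "infinite (- (D \<union> \<sigma> ` D))" by (metis finite_imageI)
    show "fixer D \<subseteq> P 12" by (rule D(3))
    show "fixer (\<sigma> ` D) \<subseteq> P 16"
    proof
      fix A assume A: "A \<in> fixer (\<sigma> ` D)"
      have "finv k \<circ> A \<circ> k \<in> fixer D"
        unfolding fixer_def
      proof (intro CollectI conjI ballI orth_comp orth_inv ko fixer_orth[OF A])
        fix i assume "i \<in> D"
        then have "A (e (\<sigma> i)) = e (\<sigma> i)" using A by (simp add: fixer_def)
        then show "(finv k \<circ> A \<circ> k) (e i) = e i"
          using orth_inv_apply(2)[OF ko, of "e i"] by (simp add: k)
      qed
      then have "k \<circ> (finv k \<circ> A \<circ> k) \<circ> finv k \<in> P (2 + 12 + 2)"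
        using D(3) by (intro P_comp P_inv kP) blast
      moreover have "k \<circ> (finv k \<circ> A \<circ> k) \<circ> finv k = A"
        by (simp add: fun_eq_iff orth_inv_apply ko)
      ultimately show "A \<in> P 16" by simp
    qed
  qed
qed

end

section \<open>Generating the fixer of a finite set of basis vectors\<close>

context hilbert
begin

lemma subspace_fixed:
  assumes "g \<in> orth"
  shows "subspace {x \<in> cspan J. g x = x}"
proof -
  note l = orth_linear[OF assms]
  show ?thesis
    using subspace_cspan[of J]
    by (auto simp: subspace_def linear_add[OF l] linear_cmul[OF l] linear_0[OF l])
qed

text \<open>
  The components of the chosen fixed vectors \<open>z i\<close> in the blocks indexed by \<open>D - D'\<close> and by \<open>- D\<close>
  are orthogonal systems, so the latter components can be moved into the free block
  \<open>- (D \<union> D')\<close> by an element of \<open>fixer D\<close>, after which an element of \<open>fixer D'\<close>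
  moves all the vectors onto the basis of the block \<open>D - D'\<close>.
\<close>

lemma fixer_inf_dim_conjugate:
  assumes inf: "infinite (D - D')" "infinite (- (D \<union> D'))"
    and g: "g \<in> fixer (D \<inter> D')" and V: "inf_dim {x \<in> cspan (- (D \<inter> D')). g x = x}"
  shows "\<exists>l\<in>fixer D. \<exists>l'\<in>fixer D'. l' \<circ> l \<circ> g \<circ> finv l \<circ> finv l' \<in> fixer D"
proof -
  define V where "V = {x \<in> cspan (- (D \<inter> D')). g x = x}"
  have "\<exists>m. m \<in> cspan (D - D') \<and> x - m \<in> cspan (- (D - D'))" for x
    using cspan_projection by blast
  then obtain pr where pr: "\<And>x. pr x \<in> cspan (D - D')" "\<And>x. x - pr x \<in> cspan (- (D - D'))" by metis
  have iD: "infinite (- D)" by (rule infinite_super[OF _ inf(2)]) blast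
  \<comment> \<open>Even terms are vectors fixed by \<open>g\<close>. Odd terms are spare vectors of
    \<open>cspan (- D)\<close>, providing the infinite-dimensional complement that the frame
    extension asks for. The conditions on \<open>pr (w j)\<close> make the components
    \<open>c i\<close> orthogonal.\<close>
  have "\<exists>w. \<forall>i::nat. w i \<in> (if even i then V else cspan (- D)) \<and> norm (w i) = 1 \<and>
      (\<forall>j<i. \<forall>t\<in>{w j, pr (w j)}. w i \<bullet> t = 0)"
  proof (rule inf_dim_sequence[of "\<lambda>i. if even i then V else cspan (- D)" "\<lambda>x. {x, pr x}"])
    show "inf_dim (if even i then V else cspan (- D))" for i :: nat
      using V inf_dim_cspan[OF iD] by (simp add: V_def)
  qed auto
  then obtain w where "\<forall>i::nat. w i \<in> (if even i then V else cspan (- D)) \<and> norm (w i) = 1 \<and>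
      (\<forall>j<i. \<forall>t\<in>{w j, pr (w j)}. w i \<bullet> t = 0)" ..
  then have w: "\<And>i. w i \<in> (if even i then V else cspan (- D))" "\<And>i. norm (w i) = 1"
    "\<And>i j t. j < i \<Longrightarrow> t \<in> {w j, pr (w j)} \<Longrightarrow> w i \<bullet> t = 0"
    by blast+
  have ww: "w i \<bullet> w j = (if i = j then 1 else 0)" for i j
    by (rule unit_orthogonal_sequence) (use w(2,3) in auto)
  define z where "z i = w (2 * i)" for i
  define r where "r i = w (2 * i + 1)" for i
  define c where "c i = pr (z i)" for i
  define p where "p i = z i - c i" for i
  have zV: "z i \<in> V" for i using w(1)[of "2 * i"] by (simp add: z_def)
  have rD: "r i \<in> cspan (- D)" for i using w(1)[of "2 * i + 1"] by (simp add: r_def)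
  have cC: "c i \<in> cspan (D - D')" and pC: "p i \<in> cspan (- (D - D'))" for i
    using pr by (simp_all add: c_def p_def)
  have zz: "z i \<bullet> z j = (if i = j then 1 else 0)" for i j by (simp add: z_def ww)
  have rr: "r i \<bullet> r j = (if i = j then 1 else 0)" for i j by (simp add: r_def ww)
  have pc: "p i \<bullet> c j = 0" for i j by (rule cspan_orthogonal[OF pC cC]) blast
  have zc: "z i \<bullet> c j = c i \<bullet> c j" for i j
    using pc[of i j] by (simp add: p_def inner_diff_left)
  have cc: "c i \<bullet> c j = 0" if "i \<noteq> j" for i j
  proof -
    have *: "c i \<bullet> c j = 0" if "j < i" for i j
    proof -
      have "z i \<bullet> c j = 0"
        using w(3)[of "2 * j" "2 * i" "pr (w (2 * j))"] that by (simp add: z_def c_def)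
      then show ?thesis by (simp only: zc)
    qed
    show ?thesis using that *[of i j] *[of j i] by (cases i j rule: linorder_cases) (simp_all add: inner_commute)
  qed
  have pp: "p i \<bullet> p j = 0" if "i \<noteq> j" for i j
  proof -
    have "p i \<bullet> p j = z i \<bullet> z j - c i \<bullet> z j"
      using pc[of i j] by (simp add: p_def inner_diff_left inner_diff_right)
    then show ?thesis using that zz cc zc[of j i] by (simp add: inner_commute)
  qed
  have pD: "p i \<in> cspan (- D)" for i
    unfolding mem_cspan
  proof (intro allI impI)
    fix k assume k: "k \<notin> - D"
    show "p i \<bullet> e k = 0"
    proof (cases "k \<in> D'")
      case True
      then have "z i \<bullet> e k = 0" "c i \<bullet> e k = 0" using k zV[of i] cC[of i] by (simp_all add: V_def mem_cspan)
      then show ?thesis by (simp add: p_def inner_diff_left)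
    next
      case False
      then show ?thesis using k pC[of i] by (simp add: mem_cspan)
    qed
  qed
  have rp: "r i \<bullet> p j = 0" for i j
  proof -
    have "2 * i + 1 \<noteq> 2 * j" by presburger
    then have "r i \<bullet> z j = 0" by (simp add: r_def z_def ww)
    moreover have "r i \<bullet> c j = 0" by (rule cspan_orthogonal[OF rD cC]) blast
    ultimately show ?thesis by (simp add: p_def inner_diff_right)
  qed
  define b where "b = enumerate (- (D \<union> D'))"
  have b: "b i \<notin> D" "b i \<notin> D'" for i
    using enumerate_in_set[OF inf(2), of i] by (simp_all add: b_def)
  have b_eq: "b i = b j \<longleftrightarrow> i = j" for i j
    using bij_enumerate[OF inf(2)] by (simp add: b_def bij_betw_def inj_eq)
  have room: "inf_dim (cspan (- J) \<inter> (q ` I)\<^sup>\<bottom>)"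
    if "\<And>i j. f i \<bullet> f j = (if i = j then 1 else 0)" "\<And>i. f i \<in> cspan (- J)"
      "\<And>i j. i \<in> I \<Longrightarrow> f j \<bullet> q i = 0" for f :: "nat \<Rightarrow> 'a" and J I and q :: "nat \<Rightarrow> 'a"
  proof (rule inf_dim_orthonormal)
    show "orthonormal_on UNIV f" using that(1) by (simp add: orthonormal_on_def)
    show "range f \<subseteq> cspan (- J) \<inter> (q ` I)\<^sup>\<bottom>" using that(2,3) by (auto simp: mem_orthogonal_comp_iff)
    show "subspace (cspan (- J) \<inter> (q ` I)\<^sup>\<bottom>)" by (intro subspace_inter subspace_cspan subspace_orthocomplement)
  qed simp
  \<comment> \<open>Some \<open>p i\<close> may vanish, so only the others are normalized to a
    frame; the formula for \<open>l (p i)\<close> below covers both cases.\<close>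
  define I where "I = {i. p i \<noteq> 0}"
  define q where "q i = (1 / norm (p i)) *\<^sub>R p i" for i
  \<comment> \<open>Only even-numbered \<open>b\<close> are targets; the odd-numbered ones leave
    room for this extension and the next.\<close>
  have "\<exists>l\<in>fixer D. \<forall>i\<in>I. l (q i) = e (b (2 * i))"
  proof (rule fixer_frame_extension)
    show "orthonormal_on I q"
      unfolding orthonormal_on_def
    proof (intro ballI)
      fix i j assume "i \<in> I" "j \<in> I"
      then show "q i \<bullet> q j = (if i = j then 1 else 0)"
        using pp[of i j] by (auto simp: q_def I_def dot_square_norm power2_eq_square)
    qed
    show "q i \<in> cspan (- D)" for i using pD[of i] by (simp add: q_def subspace_scale subspace_cspan)
    show "inf_dim (cspan (- D) \<inter> (q ` I)\<^sup>\<bottom>)" by (rule room[OF rr rD]) (simp add: q_def rp)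
    show "orthonormal_on I (\<lambda>i. e (b (2 * i)))" by (simp add: orthonormal_on_def b_eq)
    show "e (b (2 * i)) \<in> cspan (- D)" for i using b by (simp add: e_mem_cspan)
    show "inf_dim (cspan (- D) \<inter> ((\<lambda>i. e (b (2 * i))) ` I)\<^sup>\<bottom>)"
      by (rule room[where f = "\<lambda>i. e (b (2 * i + 1))"]) (auto simp: b_eq e_mem_cspan b, presburger+)
  qed
  then obtain l where l: "l \<in> fixer D" "\<And>i. i \<in> I \<Longrightarrow> l (q i) = e (b (2 * i))" by blast
  note lo = fixer_orth[OF l(1)]
  note ll = orth_linear[OF lo]
  have lp: "l (p i) = norm (p i) *\<^sub>R e (b (2 * i))" for i
  proof (cases "p i = 0")
    case False
    have "l (p i) = l (norm (p i) *\<^sub>R q i)" using False by (simp add: q_def)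
    also have "\<dots> = norm (p i) *\<^sub>R l (q i)" by (rule linear_cmul[OF ll])
    finally show ?thesis using l(2)[of i] False by (simp add: I_def)
  qed (simp add: linear_0[OF ll])
  have lc: "l (c i) = c i" for i
    using fixer_fixes[OF l(1)] cC[of i] cspan_mono[of "D - D'" D] by blast
  have lz: "l (z i) = norm (p i) *\<^sub>R e (b (2 * i)) + c i" for i
    using linear_add[OF ll, of "p i" "c i"] by (simp add: p_def[of i, symmetric] lp lc) (simp add: p_def)
  define \<gamma> where "\<gamma> = enumerate (D - D')"
  have \<gamma>: "bij_betw \<gamma> UNIV (D - D')" unfolding \<gamma>_def by (rule bij_enumerate[OF inf(1)])
  have \<gamma>_mem: "\<gamma> i \<in> D" "\<gamma> i \<notin> D'" for i using bij_betwE[OF \<gamma>] by auto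
  have \<gamma>_eq: "\<gamma> i = \<gamma> j \<longleftrightarrow> i = j" for i j using \<gamma> by (simp add: bij_betw_def inj_eq)
  have "\<exists>l'\<in>fixer D'. \<forall>i\<in>UNIV. l' (l (z i)) = e (\<gamma> i)"
  proof (rule fixer_frame_extension)
    show "orthonormal_on UNIV (\<lambda>i. l (z i))" by (simp add: orthonormal_on_def orth_inner[OF lo] zz)
    show "l (z i) \<in> cspan (- D')" for i
      unfolding lz using b cC[of i] cspan_mono[of "D - D'" "- D'"]
      by (intro subspace_add subspace_scale subspace_cspan e_mem_cspan) auto
    show "inf_dim (cspan (- D') \<inter> (range (\<lambda>i. l (z i)))\<^sup>\<bottom>)"
    proof (rule room[where f = "\<lambda>i. e (b (2 * i + 1))"])
      fix i j :: nat
      have "2 * j + 1 \<noteq> 2 * i" by presburger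
      then have "e (b (2 * j + 1)) \<bullet> e (b (2 * i)) = 0" by (simp add: b_eq)
      moreover have "e (b (2 * j + 1)) \<bullet> c i = 0"
        using cC[of i] b by (simp add: mem_cspan inner_commute)
      ultimately show "e (b (2 * j + 1)) \<bullet> l (z i) = 0" by (simp add: lz inner_add_right)
    qed (auto simp: b_eq e_mem_cspan b)
    show "orthonormal_on UNIV (\<lambda>i. e (\<gamma> i))" by (simp add: orthonormal_on_def \<gamma>_eq)
    show "e (\<gamma> i) \<in> cspan (- D')" for i using \<gamma>_mem by (simp add: e_mem_cspan)
    show "inf_dim (cspan (- D') \<inter> (range (\<lambda>i. e (\<gamma> i)))\<^sup>\<bottom>)"
    proof (rule room[where f = "\<lambda>i. e (b i)"])
      fix i j
      have "b j \<noteq> \<gamma> i" using b(1)[of j] \<gamma>_mem(1)[of i] by auto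
      then show "e (b j) \<bullet> e (\<gamma> i) = 0" by simp
    qed (auto simp: b_eq e_mem_cspan b)
  qed
  then obtain l' where l': "l' \<in> fixer D'" "\<And>i. l' (l (z i)) = e (\<gamma> i)" by blast
  note lo' = fixer_orth[OF l'(1)]
  note go = fixer_orth[OF g]
  \<comment> \<open>On \<open>D \<inter> D'\<close> all factors are trivial; a basis vector of
    \<open>D - D'\<close> is pulled back to some \<open>z i\<close>, which \<open>g\<close>
    fixes.\<close>
  have "l' \<circ> l \<circ> g \<circ> finv l \<circ> finv l' \<in> fixer D"
    unfolding fixer_def
  proof (intro CollectI conjI ballI orth_comp orth_inv lo lo' go)
    fix k assume k: "k \<in> D"
    show "(l' \<circ> l \<circ> g \<circ> finv l \<circ> finv l') (e k) = e k"
    proof (cases "k \<in> D'")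
      case True
      have "finv l' (e k) = e k" "finv l (e k) = e k"
        using fixer_inv[OF l'(1)] fixer_inv[OF l(1)] k True by (simp_all add: fixer_def)
      moreover have "g (e k) = e k" "l (e k) = e k" "l' (e k) = e k"
        using g l(1) l'(1) k True by (simp_all add: fixer_def)
      ultimately show ?thesis by simp
    next
      case False
      then have "k \<in> \<gamma> ` UNIV" using \<gamma> k by (simp add: bij_betw_def)
      then obtain i where i: "k = \<gamma> i" by blast
      have "finv l' (e k) = l (z i)" using orth_inv_apply(2)[OF lo', of "l (z i)"] by (simp add: l'(2) i)
      moreover have "g (z i) = z i" using zV by (simp add: V_def)
      ultimately show ?thesis by (simp add: orth_inv_apply lo l'(2) i)
    qed
  qed
  with l(1) l'(1) show ?thesis by blast
qed

text \<open>\<open>h\<close> copies \<open>g\<close> on every third vector of a suitable sequence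
  and is the identity on the next third, so \<open>finv h \<circ> g\<close> and \<open>h\<close>
  each fix infinitely many orthonormal vectors. The last third leaves room for extending
  \<open>h\<close>.\<close>

lemma fixer_factor:
  assumes J: "infinite (- J)" and g: "g \<in> fixer J"
  shows "\<exists>h\<in>fixer J. inf_dim {x \<in> cspan (- J). h x = x} \<and> inf_dim {x \<in> cspan (- J). (finv h \<circ> g) x = x}"
proof -
  note go = fixer_orth[OF g]
  \<comment> \<open>Including both \<open>g (w j)\<close> and \<open>finv g (w j)\<close> makes
    \<open>w i\<close> orthogonal to \<open>g (w j)\<close> for all \<open>i \<noteq> j\<close>,
    whichever index is larger; the mixed family \<open>q\<close> is then orthonormal.\<close>
  have "\<exists>w. \<forall>i::nat. w i \<in> cspan (- J) \<and> norm (w i) = 1 \<and>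
      (\<forall>j<i. \<forall>t\<in>{w j, g (w j), finv g (w j)}. w i \<bullet> t = 0)"
    by (rule inf_dim_sequence[of "\<lambda>i. cspan (- J)" "\<lambda>x. {x, g x, finv g x}"])
      (auto intro: inf_dim_cspan[OF J])
  then obtain w where w: "\<And>i::nat. w i \<in> cspan (- J)" "\<And>i. norm (w i) = 1"
    "\<And>i j t. j < i \<Longrightarrow> t \<in> {w j, g (w j), finv g (w j)} \<Longrightarrow> w i \<bullet> t = 0"
    by metis
  have ww: "w i \<bullet> w j = (if i = j then 1 else 0)" for i j
    by (rule unit_orthogonal_sequence) (use w(2,3) in auto)
  have wg: "w i \<bullet> g (w j) = 0" if "i \<noteq> j" for i j
  proof (cases "j < i")
    case True
    then show ?thesis using w(3)[of j i "g (w j)"] by simp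
  next
    case False
    then have "w j \<bullet> finv g (w i) = 0" using that w(3)[of i j "finv g (w i)"] by simp
    then show ?thesis using orth_inner_shift[OF go, of "w i" "w j"] by (simp add: inner_commute)
  qed
  have gw: "g (w i) \<bullet> w j = 0" if "i \<noteq> j" for i j using wg[of j i] that by (simp add: inner_commute)
  define I where "I = {i::nat. i mod 3 \<noteq> 2}"
  define q where "q i = (if i mod 3 = 0 then g (w i) else w i)" for i
  have sub: "subspace (cspan (- J) \<inter> T\<^sup>\<bottom>)" for T by (intro subspace_inter subspace_cspan subspace_orthocomplement)
  have on3: "orthonormal_on UNIV (\<lambda>i. w (3 * i + k))" for k by (simp add: orthonormal_on_def ww)
  have m3: "(3 * i + 2) mod 3 = 2" "(3 * i + 1) mod 3 = 1" "(3 * i) mod 3 = 0" for i :: nat by presburger+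
  have "\<exists>h\<in>fixer J. \<forall>i\<in>I. h (w i) = q i"
  proof (rule fixer_frame_extension)
    show "orthonormal_on I w" by (simp add: orthonormal_on_def ww)
    show "w i \<in> cspan (- J)" for i by (rule w(1))
    show "inf_dim (cspan (- J) \<inter> (w ` I)\<^sup>\<bottom>)"
    proof (rule inf_dim_orthonormal[OF on3[of 2] _ _ sub])
      have "w (3 * i + 2) \<bullet> w j = 0" if "j \<in> I" for i j
      proof -
        have "3 * i + 2 \<noteq> j" using that m3(1)[of i] by (auto simp: I_def)
        then show ?thesis by (simp add: ww)
      qed
      then show "range (\<lambda>i. w (3 * i + 2)) \<subseteq> cspan (- J) \<inter> (w ` I)\<^sup>\<bottom>"
        using w(1) by (auto simp: mem_orthogonal_comp_iff)
    qed simp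
    show "orthonormal_on I q"
      by (auto simp: orthonormal_on_def q_def orth_inner[OF go] ww wg gw)
    show "q i \<in> cspan (- J)" for i
      using w(1) fixer_preserves[OF g w(1), of i] by (simp add: q_def)
    show "inf_dim (cspan (- J) \<inter> (q ` I)\<^sup>\<bottom>)"
    proof (rule inf_dim_orthonormal[OF on3[of 2] _ _ sub])
      have "w (3 * i + 2) \<bullet> q j = 0" if "j \<in> I" for i j
      proof -
        have "3 * i + 2 \<noteq> j" using that m3(1)[of i] by (auto simp: I_def)
        then show ?thesis by (simp add: ww wg q_def)
      qed
      then show "range (\<lambda>i. w (3 * i + 2)) \<subseteq> cspan (- J) \<inter> (q ` I)\<^sup>\<bottom>"
        using w(1) by (auto simp: mem_orthogonal_comp_iff)
    qed simp
  qed
  then obtain h where h: "h \<in> fixer J" "\<And>i. i \<in> I \<Longrightarrow> h (w i) = q i" by blast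
  note ho = fixer_orth[OF h(1)]
  have "h (w (3 * i + 1)) = w (3 * i + 1)" for i
    using h(2)[of "3 * i + 1"] m3(2)[of i] by (simp add: I_def q_def)
  then have 1: "inf_dim {x \<in> cspan (- J). h x = x}"
    using w(1) by (intro inf_dim_orthonormal[OF on3[of 1] _ _ subspace_fixed[OF ho]]) auto
  have "(finv h \<circ> g) (w (3 * i + 0)) = w (3 * i + 0)" for i
    using h(2)[of "3 * i"] m3(3)[of i] orth_inv_apply(2)[OF ho, of "w (3 * i)"] by (simp add: I_def q_def)
  then have 2: "inf_dim {x \<in> cspan (- J). (finv h \<circ> g) x = x}"
    using w(1) by (intro inf_dim_orthonormal[OF on3[of 0] _ _ subspace_fixed[OF orth_comp[OF orth_inv[OF ho] go]]]) auto
  from h(1) 1 2 show ?thesis by blast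
qed

end

context orth_filtration
begin

text \<open>A map in the fixer of \<open>D \<inter> D'\<close> with infinite-dimensional fixed space
  is conjugate into \<open>fixer D\<close> by \<open>l' \<circ> l\<close>, hence in
  \<open>P 68\<close>; \<open>fixer_factor\<close> writes every element of that fixer as a product
  of two such maps.\<close>

lemma fixer_finite_subset_P:
  obtains m where "fixer {..<m} \<subseteq> P 136"
proof -
  obtain D D' where D: "infinite D" "infinite D'" "finite (D \<inter> D')" "infinite (- (D \<union> D'))"
    "fixer D \<subseteq> P 12" "fixer D' \<subseteq> P 16"
    by (rule two_fixers)
  have "D = (D - D') \<union> (D \<inter> D')" by blast
  then have DD: "infinite (D - D')" using D(1,3) by (metis finite_UnI)
  have one: "g \<in> P 68"
    if g: "g \<in> fixer (D \<inter> D')" and V: "inf_dim {x \<in> cspan (- (D \<inter> D')). g x = x}" for g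
  proof -
    obtain l l' where l: "l \<in> fixer D" "l' \<in> fixer D'" "l' \<circ> l \<circ> g \<circ> finv l \<circ> finv l' \<in> fixer D"
      using fixer_inf_dim_conjugate[OF DD D(4) g V] by blast
    have "finv l \<circ> finv l' \<circ> (l' \<circ> l \<circ> g \<circ> finv l \<circ> finv l') \<circ> l' \<circ> l \<in> P (12 + 16 + 12 + 16 + 12)"
      using l D(5,6) by (intro P_comp P_inv) blast+
    moreover have "finv l \<circ> finv l' \<circ> (l' \<circ> l \<circ> g \<circ> finv l \<circ> finv l') \<circ> l' \<circ> l = g"
      by (simp add: fun_eq_iff orth_inv_apply fixer_orth[OF l(1)] fixer_orth[OF l(2)])
    ultimately show ?thesis by simp
  qed
  have "infinite (- (D \<inter> D'))" by (simp only: finite_compl[OF D(3)] infinite_UNIV_nat not_False_eq_True)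
  have all: "g \<in> P 136" if g: "g \<in> fixer (D \<inter> D')" for g
  proof -
    obtain h where h: "h \<in> fixer (D \<inter> D')" "inf_dim {x \<in> cspan (- (D \<inter> D')). h x = x}"
      "inf_dim {x \<in> cspan (- (D \<inter> D')). (finv h \<circ> g) x = x}"
      using fixer_factor[OF \<open>infinite (- (D \<inter> D'))\<close> g] by blast
    have "h \<circ> (finv h \<circ> g) \<in> P (68 + 68)"
      by (intro P_comp one h fixer_comp fixer_inv g)
    moreover have "h \<circ> (finv h \<circ> g) = g" by (simp add: fun_eq_iff orth_inv_apply fixer_orth[OF h(1)])
    ultimately show ?thesis by simp
  qed
  obtain m where "D \<inter> D' \<subseteq> {..<m}" using D(3) finite_nat_iff_bounded by blast
  then have "fixer {..<m} \<subseteq> P 136" using fixer_antimono all by blast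
  then show ?thesis by (rule that)
qed

end

section \<open>Prescribed inner products and rotations of a finite frame\<close>

lemma inf_dim_orthonormal_sequence:
  fixes V :: "'a::real_inner set"
  assumes "inf_dim V"
  shows "\<exists>\<eta>::nat \<Rightarrow> 'a. orthonormal_on UNIV \<eta> \<and> range \<eta> \<subseteq> V"
proof -
  have "\<exists>w. \<forall>i::nat. w i \<in> V \<and> norm (w i) = 1 \<and> (\<forall>j<i. \<forall>t\<in>{w j}. w i \<bullet> t = 0)"
    by (rule inf_dim_sequence[of "\<lambda>_. V" "\<lambda>x. {x}"]) (use assms in auto)
  then obtain w where w: "\<forall>i::nat. w i \<in> V \<and> norm (w i) = 1 \<and> (\<forall>j<i. \<forall>t\<in>{w j}. w i \<bullet> t = 0)" ..
  have "w i \<bullet> w j = (if i = j then 1 else 0)" for i j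
    by (rule unit_orthogonal_sequence) (use w in auto)
  with w show ?thesis by (intro exI[of _ w]) (auto simp: orthonormal_on_def)
qed

text \<open>
  Each entry \<open>T i j\<close> is produced by a private unit vector \<open>\<eta> (3 * prod_encode (i, j))\<close> shared only
  by \<open>f i\<close> and \<open>f' j\<close>, so that no square root of a matrix is needed.
\<close>

lemma orthonormal_with_cross_gram:
  fixes \<eta> :: "nat \<Rightarrow> 'a::real_inner" and T :: "nat \<Rightarrow> nat \<Rightarrow> real"
  assumes \<eta>: "orthonormal_on UNIV \<eta>"
    and row: "\<And>i. i < m \<Longrightarrow> (\<Sum>j<m. \<bar>T i j\<bar>) \<le> 1" and col: "\<And>j. j < m \<Longrightarrow> (\<Sum>i<m. \<bar>T i j\<bar>) \<le> 1"
  obtains f f' where "orthonormal_on {..<m} f" "orthonormal_on {..<m} f'"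
    "\<And>i. f i \<in> span (range \<eta>)" "\<And>i. f' i \<in> span (range \<eta>)"
    "\<And>i j. i < m \<Longrightarrow> j < m \<Longrightarrow> f i \<bullet> f' j = T i j"
proof -
  have \<eta>\<eta>: "\<eta> a \<bullet> \<eta> b = (if a = b then 1 else 0)" for a b using \<eta> by (simp add: orthonormal_on_def)
  \<comment> \<open>The residues mod 3 separate the shared vectors \<open>\<epsilon>\<close> from
    the padding \<open>\<kappa>\<close> private to \<open>f\<close> and \<open>\<kappa>'\<close>
    private to \<open>f'\<close>.\<close>
  define \<epsilon> where "\<epsilon> i j = \<eta> (3 * prod_encode (i, j))" for i j
  define \<kappa> where "\<kappa> i = \<eta> (3 * i + 1)" for i
  define \<kappa>' where "\<kappa>' i = \<eta> (3 * i + 2)" for i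
  have m3: "3 * a \<noteq> 3 * b + 1" "3 * a \<noteq> 3 * b + 2" "3 * a + 1 \<noteq> 3 * b + 2" for a b :: nat by presburger+
  have \<epsilon>\<epsilon>: "\<epsilon> i j \<bullet> \<epsilon> i' j' = (if i = i' then if j = j' then 1 else 0 else 0)" for i j i' j'
    by (simp add: \<epsilon>_def \<eta>\<eta>)
  have \<kappa>\<kappa>: "\<kappa> i \<bullet> \<kappa> j = (if i = j then 1 else 0)" "\<kappa>' i \<bullet> \<kappa>' j = (if i = j then 1 else 0)" for i j
    by (simp_all add: \<kappa>_def \<kappa>'_def \<eta>\<eta>)
  have \<epsilon>\<kappa>: "\<epsilon> i j \<bullet> \<kappa> k = 0" "\<kappa> k \<bullet> \<epsilon> i j = 0" "\<epsilon> i j \<bullet> \<kappa>' k = 0" "\<kappa>' k \<bullet> \<epsilon> i j = 0"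
    "\<kappa> l \<bullet> \<kappa>' k = 0" "\<kappa>' k \<bullet> \<kappa> l = 0" for i j k l
    unfolding \<epsilon>_def \<kappa>_def \<kappa>'_def \<eta>\<eta> using m3 by (simp_all only: if_False not_False_eq_True) (metis m3)+
  \<comment> \<open>Each entry is split into two square roots, the sign going to \<open>S'\<close>
    only. The squared norms of \<open>A i\<close> and \<open>A' j\<close> are then absolute row and
    column sums, which the padding fills up to 1.\<close>
  define S where "S i j = sqrt \<bar>T i j\<bar>" for i j
  define S' where "S' i j = sgn (T i j) * S i j" for i j
  have SS: "S i j * S i j = \<bar>T i j\<bar>" "S' i j * S' i j = \<bar>T i j\<bar>" for i j
    by (simp_all add: S_def S'_def sgn_if)
  have SS': "S i j * S' i j = T i j" for i j
  proof -
    have "S i j * S' i j = sgn (T i j) * (S i j * S i j)" by (simp add: S'_def)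
    then show ?thesis unfolding SS by (simp add: sgn_mult_abs)
  qed
  define A where "A i = (\<Sum>j<m. S i j *\<^sub>R \<epsilon> i j)" for i
  define A' where "A' j = (\<Sum>i<m. S' i j *\<^sub>R \<epsilon> i j)" for j
  define f where "f i = A i + sqrt (1 - (\<Sum>j<m. \<bar>T i j\<bar>)) *\<^sub>R \<kappa> i" for i
  define f' where "f' j = A' j + sqrt (1 - (\<Sum>i<m. \<bar>T i j\<bar>)) *\<^sub>R \<kappa>' j" for j
  have A\<epsilon>: "A i \<bullet> \<epsilon> i' j = (if i = i' then S i j else 0)" if "j < m" for i i' j
    using that by (simp add: A_def inner_sum_left \<epsilon>\<epsilon> if_distrib[of "(*) _"] cong: if_cong)
  have A'\<epsilon>: "A' j \<bullet> \<epsilon> i j' = (if j = j' then S' i j else 0)" if "i < m" for i j j'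
    using that by (simp add: A'_def inner_sum_left \<epsilon>\<epsilon> if_distrib[of "(*) _"] cong: if_cong)
  have AA: "A i \<bullet> A i' = (if i = i' then (\<Sum>j<m. \<bar>T i j\<bar>) else 0)" for i i'
    unfolding A_def[of i'] by (simp add: inner_sum_right A\<epsilon> SS)
  have AA': "A' j \<bullet> A' j' = (if j = j' then (\<Sum>i<m. \<bar>T i j\<bar>) else 0)" for j j'
    unfolding A'_def[of j'] by (simp add: inner_sum_right A'\<epsilon> SS)
  have AxA: "A i \<bullet> A' j = T i j" if "i < m" "j < m" for i j
    using that unfolding A'_def
    by (simp add: inner_sum_right A\<epsilon> SS' if_distrib[of "(*) _"] mult.commute[of "S' _ _"] cong: if_cong)
  have A\<kappa>: "A i \<bullet> \<kappa> k = 0" "\<kappa> k \<bullet> A i = 0" "A i \<bullet> \<kappa>' k = 0" "A' i \<bullet> \<kappa>' k = 0" "\<kappa>' k \<bullet> A' i = 0" "\<kappa> k \<bullet> A' i = 0" for i k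
    by (simp_all add: A_def A'_def inner_sum_left inner_sum_right \<epsilon>\<kappa>)
  have ff: "f i \<bullet> f i' = (if i = i' then 1 else 0)" if "i < m" for i i'
    using row[OF that] by (cases "i = i'") (simp_all add: f_def inner_add_left inner_add_right A\<kappa> AA \<kappa>\<kappa>)
  have ff': "f' j \<bullet> f' j' = (if j = j' then 1 else 0)" if "j < m" for j j'
    using col[OF that] by (cases "j = j'") (simp_all add: f'_def inner_add_left inner_add_right A\<kappa> AA' \<kappa>\<kappa>)
  have fT: "f i \<bullet> f' j = T i j" if "i < m" "j < m" for i j
    by (simp add: f_def f'_def inner_add_left inner_add_right A\<kappa> AxA[OF that] \<epsilon>\<kappa>)
  have sp: "f i \<in> span (range \<eta>)" "f' i \<in> span (range \<eta>)" for i
    unfolding f_def f'_def A_def A'_def \<epsilon>_def \<kappa>_def \<kappa>'_def by (intro span_add span_sum span_scale span_base rangeI)+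
  show ?thesis
    by (rule that[of f f']) (auto simp: orthonormal_on_def ff ff' fT sp)
qed

context hilbert
begin

text \<open>The part of \<open>p (e i)\<close> inside the frame is exactly
  \<open>c *\<^sub>R e i\<close>; \<open>u i\<close> is the normalized rest, and the common factor
  \<open>c\<close> makes these rests orthonormal again.\<close>

lemma rotation_part:
  assumes p: "p \<in> orth" and c: "0 < c" "c < 1"
    and pe: "\<forall>i<m. \<forall>j<m. p (e i) \<bullet> e j = (if i = j then c else 0)"
  defines "u \<equiv> \<lambda>i. (1 / sqrt (1 - c\<^sup>2)) *\<^sub>R (p (e i) - c *\<^sub>R e i)"
  shows "orthonormal_on {..<m} u" "\<And>i. i < m \<Longrightarrow> u i \<in> cspan (- {..<m})"
    "\<And>i. p (e i) = c *\<^sub>R e i + sqrt (1 - c\<^sup>2) *\<^sub>R u i"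
proof -
  have c2: "c\<^sup>2 < 1" using c by (simp add: power_less_one_iff abs_square_less_1)
  have "(p (e i) - c *\<^sub>R e i) \<bullet> (p (e j) - c *\<^sub>R e j) = (if i = j then 1 - c\<^sup>2 else 0)"
    if "i < m" "j < m" for i j
  proof -
    have "p (e i) \<bullet> e j = (if i = j then c else 0)" "e i \<bullet> p (e j) = (if i = j then c else 0)"
      using pe that by (simp_all add: inner_commute[of "e i"])
    then show ?thesis
      by (simp add: inner_diff_left inner_diff_right orth_inner[OF p] power2_eq_square)
  qed
  then show "orthonormal_on {..<m} u" using c2 by (simp add: orthonormal_on_def u_def)
  show "u i \<in> cspan (- {..<m})" if "i < m" for i
    using pe that by (simp add: mem_cspan u_def inner_diff_left)
  show "p (e i) = c *\<^sub>R e i + sqrt (1 - c\<^sup>2) *\<^sub>R u i" for i using c2 by (simp add: u_def)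
qed

end

context orth_filtration
begin

text \<open>Rotations of each \<open>e i\<close> towards \<open>e (m + i)\<close> form an
  uncountable family. The inner products of a quotient on the frame involve only images of the
  frame, so they give \<open>cos (t - s)\<close> on the diagonal whatever the extensions do
  elsewhere.\<close>

lemma rotation_in_P:
  "\<exists>k\<in>P 2. \<exists>c. 0 < c \<and> c < 1 \<and> (\<forall>i<m. \<forall>j<m. k (e i) \<bullet> e j = (if i = j then c else 0))"
proof -
  have fin: "inf_dim ((f ` {..<m})\<^sup>\<bottom>)" for f :: "nat \<Rightarrow> 'a"
    by (rule inf_dim_finite_orthogonal_comp) simp
  have "\<exists>A\<in>orth. \<forall>i\<in>{..<m}. A (e i) = cos \<theta> *\<^sub>R e i + sin \<theta> *\<^sub>R e (m + i)" for \<theta> :: real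
  proof (rule orth_frame_extension[OF orthonormal_e fin _ fin])
    show "orthonormal_on {..<m} (\<lambda>i. cos \<theta> *\<^sub>R e i + sin \<theta> *\<^sub>R e (m + i))"
      by (auto simp: orthonormal_on_def inner_add_left inner_add_right simp flip: power2_eq_square)
  qed
  then obtain g where g: "\<And>\<theta>. g \<theta> \<in> orth"
    "\<And>\<theta> i. i < m \<Longrightarrow> g \<theta> (e i) = cos \<theta> *\<^sub>R e i + sin \<theta> *\<^sub>R e (m + i)" by (metis lessThan_iff)
  \<comment> \<open>Angles from a unit interval keep the distance of \<open>s\<close> and
    \<open>t\<close> below \<open>pi / 2\<close>, so that \<open>0 < c < 1\<close>.\<close>
  have "uncountable {0..1::real}" by (simp add: uncountable_closed_interval)
  from pigeonhole[OF this, of g, OF g(1)]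
  obtain s t where st: "s \<in> {0..1}" "t \<in> {0..1}" "s \<noteq> t" "finv (g s) \<circ> g t \<in> P 2" by blast
  define c where "c = cos \<bar>t - s\<bar>"
  have "c = cos (t - s)" by (simp add: c_def cos_abs_real)
  then have c: "c = cos t * cos s + sin t * sin s" by (simp add: cos_diff)
  have d: "0 < \<bar>t - s\<bar>" "\<bar>t - s\<bar> \<le> 1" using st by auto
  have "0 < c" unfolding c_def using d pi_gt3 by (intro cos_gt_zero_pi) auto
  moreover have "c < cos 0" unfolding c_def using d pi_gt3 by (intro cos_monotone_0_pi) auto
  moreover have "(finv (g s) \<circ> g t) (e i) \<bullet> e j = (if i = j then c else 0)" if "i < m" "j < m" for i j
    using that by (auto simp: orth_inner_shift[OF g(1)] g(2) inner_add_left inner_add_right c)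
  ultimately show ?thesis using st(4) by (intro bexI[OF _ st(4)] exI[of _ c]) simp
qed

text \<open>A double coset argument: \<open>k\<close> and \<open>p\<close> turn the frame by the
  same angle, towards the directions \<open>u k\<close> and \<open>u p\<close>. An element
  \<open>a\<close> of the fixer aligns these directions, and \<open>p\<close> differs from
  \<open>a \<circ> k\<close> by an element of the fixer on the right.\<close>

lemma rotation_matrix_in_P:
  assumes fx: "fixer {..<m} \<subseteq> P n" and k: "k \<in> P 2" and c: "0 < c" "c < 1"
    and ke: "\<forall>i<m. \<forall>j<m. k (e i) \<bullet> e j = (if i = j then c else 0)"
    and p: "p \<in> orth" and pe: "\<forall>i<m. \<forall>j<m. p (e i) \<bullet> e j = (if i = j then c else 0)"
  shows "p \<in> P (n + 2 + n)"
proof -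
  note ko = P_orth[OF k]
  define u where "u q i = (1 / sqrt (1 - c\<^sup>2)) *\<^sub>R (q (e i) - c *\<^sub>R e i)" for q i
  note uk = rotation_part[OF ko c ke, folded u_def] and up = rotation_part[OF p c pe, folded u_def]
  have fin: "inf_dim (cspan (- {..<m}) \<inter> (f ` {..<m})\<^sup>\<bottom>)" for f :: "nat \<Rightarrow> 'a"
    by (rule inf_dim_Int_orthogonal_comp[OF _ inf_dim_cspan]) (simp_all add: finite_compl infinite_Ici)
  have "\<exists>a\<in>fixer {..<m}. \<forall>i\<in>{..<m}. a (u k i) = u p i"
    by (rule fixer_frame_extension[OF uk(1) _ fin up(1) _ fin]) (use uk(2) up(2) in auto)
  then obtain a where a: "a \<in> fixer {..<m}" "\<And>i. i < m \<Longrightarrow> a (u k i) = u p i" by blast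
  note ao = fixer_orth[OF a(1)]
  have ak: "a (k (e i)) = p (e i)" if "i < m" for i
  proof -
    have "a (k (e i)) = c *\<^sub>R a (e i) + sqrt (1 - c\<^sup>2) *\<^sub>R a (u k i)"
      unfolding uk(3)[of i] by (simp add: linear_add[OF orth_linear[OF ao]] linear_cmul[OF orth_linear[OF ao]])
    then show ?thesis using a that up(3)[of i] by (simp add: fixer_def)
  qed
  define b where "b = finv k \<circ> finv a \<circ> p"
  have "b \<in> fixer {..<m}"
    unfolding fixer_def
  proof (intro CollectI conjI ballI)
    show "b \<in> orth" unfolding b_def by (intro orth_comp orth_inv ko ao p)
    fix i assume "i \<in> {..<m}"
    then show "b (e i) = e i" using ak[of i] by (simp add: b_def orth_inv_apply ko ao flip: ak)
  qed
  then have "a \<circ> k \<circ> b \<in> P (n + 2 + n)" using fx a(1) by (intro P_comp k) blast+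
  moreover have "a \<circ> k \<circ> b = p" by (simp add: b_def fun_eq_iff orth_inv_apply ko ao)
  ultimately show ?thesis by simp
qed

text \<open>
  A frame close to \<open>e 0, \<dots>, e (m - 1)\<close> is reached from it in three rotations through the same
  angle: the entries required of the two auxiliary frames are at most \<open>c / (1 + c) < 1 / 2\<close>
  on the diagonal up to an error which is small with \<open>\<epsilon>\<close>.
\<close>

theorem orth_neighbourhood_subset_P:
  "\<exists>m. \<exists>\<epsilon>>0. \<forall>g\<in>orth. (\<forall>i<m. norm (g (e i) - e i) < \<epsilon>) \<longrightarrow> g \<in> P 822"
proof -
  obtain m where m: "fixer {..<m} \<subseteq> P 136" by (rule fixer_finite_subset_P)
  obtain k c where k: "k \<in> P 2" and c: "0 < c" "c < 1"
    and ke: "\<forall>i<m. \<forall>j<m. k (e i) \<bullet> e j = (if i = j then c else 0)"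
    using rotation_in_P[of m] by blast
  note V = rotation_matrix_in_P[OF m k c ke]
  have c2: "c\<^sup>2 < 1" "0 < c\<^sup>2" using c by (simp_all add: power_less_one_iff abs_square_less_1)
  define s where "s = sqrt (1 - c\<^sup>2)"
  have ss: "s * s = 1 - c\<^sup>2" using c2 by (simp add: s_def)
  define \<beta> where "\<beta> = c\<^sup>2 / (1 - c\<^sup>2)"
  have \<beta>: "\<beta> > 0" using c2 by (simp add: \<beta>_def)
  \<comment> \<open>Chosen so that \<open>m\<close> errors of size
    \<open>\<beta> * \<epsilon>\<close> add up to at most 1/2 in a row or column; the diagonal
    contributes at most another 1/2.\<close>
  define \<epsilon> where "\<epsilon> = 1 / (2 * (real m * \<beta> + 1))"
  have pos: "0 < real m * \<beta> + 1" using \<beta> by (simp add: add_nonneg_pos)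
  have \<epsilon>: "\<epsilon> > 0" "real m * (\<beta> * \<epsilon>) \<le> 1 / 2" using pos by (simp_all add: \<epsilon>_def field_simps)
  have "g \<in> P 822" if g: "g \<in> orth" and close: "\<And>i. i < m \<Longrightarrow> norm (g (e i) - e i) < \<epsilon>" for g
  proof -
    \<comment> \<open>Solves \<open>c\<^sup>2 * (e i \<bullet> g (e j)) + (1 - c\<^sup>2) * T i j =
      (if i = j then c else 0)\<close>, which gives \<open>z\<close> and \<open>z'\<close> below the
      mutual inner products of a rotation.\<close>
    define T where "T i j = ((if i = j then c else 0) - c\<^sup>2 * (e i \<bullet> g (e j))) / (1 - c\<^sup>2)" for i j
    have T: "\<bar>T i j\<bar> \<le> (if i = j then 1 / 2 else 0) + \<beta> * \<epsilon>" if "i < m" "j < m" for i j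
    proof -
      have "\<bar>e i \<bullet> (g (e j) - e j)\<bar> \<le> norm (e i) * norm (g (e j) - e j)" by (rule Cauchy_Schwarz_ineq2)
      then have "\<bar>e i \<bullet> (g (e j) - e j)\<bar> \<le> \<epsilon>" using close[OF that(2)] by simp
      then have 1: "\<beta> * \<bar>e i \<bullet> (g (e j) - e j)\<bar> \<le> \<beta> * \<epsilon>" using \<beta> by (intro mult_left_mono) auto
      define X where "X = (c - c\<^sup>2) / (1 - c\<^sup>2)"
      define Y where "Y = \<beta> * (e i \<bullet> (g (e j) - e j))"
      have "T i j = (if i = j then X else 0) - Y"
        by (simp add: X_def Y_def T_def \<beta>_def inner_diff_right diff_divide_distrib algebra_simps)
      moreover have "X \<le> 1 / 2" "0 \<le> X"
      proof -
        have "2 * (c - c\<^sup>2) \<le> 1 - c\<^sup>2" using zero_le_power2[of "1 - c"] by (simp add: power2_eq_square algebra_simps)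
        then show "X \<le> 1 / 2" using c2 by (simp add: X_def field_simps)
        have "c\<^sup>2 \<le> c" using c by (simp add: power2_eq_square mult_left_le_one_le)
        then show "0 \<le> X" using c2 by (simp add: X_def)
      qed
      moreover have "\<bar>Y\<bar> \<le> \<beta> * \<epsilon>" using 1 \<beta> by (simp add: Y_def abs_mult)
      ultimately show ?thesis by (cases "i = j") auto
    qed
    have row: "(\<Sum>j<m. \<bar>T i j\<bar>) \<le> 1" if "i < m" for i
    proof -
      have "(\<Sum>j<m. \<bar>T i j\<bar>) \<le> (\<Sum>j<m. (if i = j then 1 / 2 else 0) + \<beta> * \<epsilon>)"
        using T that by (intro sum_mono) auto
      also have "\<dots> = 1 / 2 + real m * (\<beta> * \<epsilon>)" using that by (simp add: sum.distrib)
      finally show ?thesis using \<epsilon>(2) by linarith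
    qed
    have col: "(\<Sum>i<m. \<bar>T i j\<bar>) \<le> 1" if "j < m" for j
    proof -
      have "(\<Sum>i<m. \<bar>T i j\<bar>) \<le> (\<Sum>i<m. (if i = j then 1 / 2 else 0) + \<beta> * \<epsilon>)"
        using T that by (intro sum_mono) auto
      also have "\<dots> = 1 / 2 + real m * (\<beta> * \<epsilon>)" using that by (simp add: sum.distrib)
      finally show ?thesis using \<epsilon>(2) by linarith
    qed
    define F where "F = e ` {..<m} \<union> (\<lambda>i. g (e i)) ` {..<m}"
    have "inf_dim (F\<^sup>\<bottom>)" by (rule inf_dim_finite_orthogonal_comp) (simp add: F_def)
    then obtain \<eta> :: "nat \<Rightarrow> 'a" where \<eta>: "orthonormal_on UNIV \<eta>" "range \<eta> \<subseteq> F\<^sup>\<bottom>"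
      using inf_dim_orthonormal_sequence by blast
    obtain f f' where f: "orthonormal_on {..<m} f" "orthonormal_on {..<m} f'"
      "\<And>i. f i \<in> span (range \<eta>)" "\<And>i. f' i \<in> span (range \<eta>)"
      "\<And>i j. i < m \<Longrightarrow> j < m \<Longrightarrow> f i \<bullet> f' j = T i j"
      using orthonormal_with_cross_gram[OF \<eta>(1) row col] by metis
    have sF: "span (range \<eta>) \<subseteq> F\<^sup>\<bottom>" by (rule span_minimal[OF \<eta>(2) subspace_orthocomplement])
    have o: "f i \<bullet> e j = 0" "f i \<bullet> g (e j) = 0" "f' i \<bullet> e j = 0" "f' i \<bullet> g (e j) = 0" if "j < m" for i j
      using subsetD[OF sF f(3)] subsetD[OF sF f(4)] that by (auto simp: mem_orthogonal_comp_iff F_def)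
    have o': "e j \<bullet> f i = 0" "g (e j) \<bullet> f i = 0" "e j \<bullet> f' i = 0" "g (e j) \<bullet> f' i = 0" if "j < m" for i j
      using o[OF that] by (simp_all add: inner_commute)
    define z where "z i = c *\<^sub>R e i + s *\<^sub>R f i" for i
    define z' where "z' i = c *\<^sub>R g (e i) + s *\<^sub>R f' i" for i
    have fin: "inf_dim ((h ` {..<m})\<^sup>\<bottom>)" for h :: "nat \<Rightarrow> 'a"
      by (rule inf_dim_finite_orthogonal_comp) simp
    have cs: "c * c + s * s = 1" by (simp add: ss power2_eq_square)
    have zon: "orthonormal_on {..<m} z"
      using orthonormal_onD[OF f(1)] cs
      by (auto simp: orthonormal_on_def z_def inner_add_left inner_add_right o o')
    have z'on: "orthonormal_on {..<m} z'"
      using orthonormal_onD[OF f(2)] cs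
      by (auto simp: orthonormal_on_def z'_def inner_add_left inner_add_right o o' orth_inner[OF g])
    obtain p where p: "p \<in> orth" "\<And>i. i < m \<Longrightarrow> p (e i) = z i"
      using orth_frame_extension[OF orthonormal_e fin zon fin] by blast
    obtain q where q: "q \<in> orth" "\<And>i. i < m \<Longrightarrow> q (e i) = z' i"
      using orth_frame_extension[OF orthonormal_e fin z'on fin] by blast
    have 1: "p \<in> P (136 + 2 + 136)"
    proof (rule V[OF p(1)], intro allI impI)
      fix i j assume "i < m" "j < m"
      then show "p (e i) \<bullet> e j = (if i = j then c else 0)" by (simp add: p(2) z_def inner_add_left o)
    qed
    have 2: "finv p \<circ> q \<in> P (136 + 2 + 136)"
    proof (rule V[OF orth_comp[OF orth_inv[OF p(1)] q(1)]], intro allI impI)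
      fix i j assume ij: "i < m" "j < m"
      have "(finv p \<circ> q) (e i) \<bullet> e j = z' i \<bullet> z j"
        using ij by (simp add: orth_inner_shift[OF p(1)] p(2) q(2))
      also have "\<dots> = c\<^sup>2 * (e j \<bullet> g (e i)) + s * s * T j i"
        using ij f(5)[of j i]
        by (simp add: z_def z'_def inner_add_left inner_add_right o o' power2_eq_square inner_commute)
      also have "\<dots> = (if i = j then c else 0)" using c2 by (simp add: ss T_def)
      finally show "(finv p \<circ> q) (e i) \<bullet> e j = (if i = j then c else 0)" .
    qed
    have 3: "finv q \<circ> g \<in> P (136 + 2 + 136)"
    proof (rule V[OF orth_comp[OF orth_inv[OF q(1)] g]], intro allI impI)
      fix i j assume ij: "i < m" "j < m"
      then show "(finv q \<circ> g) (e i) \<bullet> e j = (if i = j then c else 0)"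
        by (simp add: orth_inner_shift[OF q(1)] q(2) z'_def inner_add_right o' orth_inner[OF g])
    qed
    have "p \<circ> (finv p \<circ> q) \<circ> (finv q \<circ> g) \<in> P ((136 + 2 + 136) + (136 + 2 + 136) + (136 + 2 + 136))"
      by (intro P_comp 1 2 3)
    moreover have "p \<circ> (finv p \<circ> q) \<circ> (finv q \<circ> g) = g"
      by (simp add: fun_eq_iff orth_inv_apply p(1) q(1))
    ultimately show ?thesis by simp
  qed
  with \<epsilon>(1) show ?thesis by blast
qed

end

section \<open>From the stabilizer of a point to the isometry group\<close>

lemma set_mult_mem_iff: "x \<in> H <#>\<^bsub>G\<^esub> K \<longleftrightarrow> (\<exists>h\<in>H. \<exists>k\<in>K. x = h \<otimes>\<^bsub>G\<^esub> k)"
  by (auto simp: set_mult_def)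

context group
begin

lemma set_power_carrier: "W \<subseteq> carrier G \<Longrightarrow> set_power G W n \<subseteq> carrier G"
  by (induction n) (auto simp: set_mult_mem_iff subset_iff)

lemma set_power_mult:
  assumes W: "W \<subseteq> carrier G" and a: "a \<in> set_power G W m"
  shows "b \<in> set_power G W n \<Longrightarrow> a \<otimes> b \<in> set_power G W (m + n)"
proof (induction n arbitrary: b)
  case 0
  then show ?case using a subsetD[OF set_power_carrier[OF W] a] by simp
next
  case (Suc n)
  then obtain c w where cw: "c \<in> set_power G W n" "w \<in> W" "b = c \<otimes> w" by (auto simp: set_mult_mem_iff)
  then have "a \<otimes> b = (a \<otimes> c) \<otimes> w"
    using a W set_power_carrier[OF W] by (metis m_assoc subsetD)
  then show ?case using Suc.IH[OF cw(1)] cw(2) by (auto simp: set_mult_mem_iff)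
qed

lemma set_power_1: "W \<subseteq> carrier G \<Longrightarrow> w \<in> W \<Longrightarrow> w \<in> set_power G W 1"
  by (auto simp: set_mult_mem_iff intro: l_one[symmetric])

lemma set_power_inv:
  assumes "symmetric_subset G W"
  shows "a \<in> set_power G W n \<Longrightarrow> inv a \<in> set_power G W n"
proof (induction n arbitrary: a)
  case 0
  then show ?case by simp
next
  case (Suc n)
  have W: "W \<subseteq> carrier G" "\<And>w. w \<in> W \<Longrightarrow> inv w \<in> W"
    using assms by (auto simp: symmetric_subset_def SET_INV_def)
  from Suc obtain c w where cw: "c \<in> set_power G W n" "w \<in> W" "a = c \<otimes> w" by (auto simp: set_mult_mem_iff)
  then have "inv a = inv w \<otimes> inv c"
    using W set_power_carrier[OF W(1)] by (metis inv_mult_group subsetD)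
  moreover have "inv w \<otimes> inv c \<in> set_power G W (1 + n)"
    by (intro set_power_mult set_power_1 W cw(2) Suc.IH cw(1))
  ultimately show ?case by (simp only: plus_1_eq_Suc)
qed

end

context hilbert
begin

text \<open>The translates are centred in \<open>G\<close> rather than in the image of
  \<open>\<rho>\<close>. Each one that meets the image is recentred at \<open>h c\<close>, and the
  quotient of two of its elements lies in the square of \<open>W\<close>; hence the factor 2 in
  \<open>P\<close> and 1644 = 2 * 822.\<close>

lemma orth_neighbourhood_subset_set_power:
  assumes "group G" and \<rho>: "\<And>A. A \<in> orth \<Longrightarrow> \<rho> A \<in> carrier G"
    and hom: "\<And>A B. A \<in> orth \<Longrightarrow> B \<in> orth \<Longrightarrow> \<rho> (A \<circ> B) = \<rho> A \<otimes>\<^bsub>G\<^esub> \<rho> B"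
    and W: "sigma_syndetic G W" "symmetric_subset G W"
  shows "\<exists>m. \<exists>\<epsilon>>0. \<forall>A\<in>orth. (\<forall>i<m. norm (A (e i) - e i) < \<epsilon>) \<longrightarrow> \<rho> A \<in> set_power G W 1644"
proof -
  interpret group G by (rule assms(1))
  have WG: "W \<subseteq> carrier G" using W(2) by (simp add: symmetric_subset_def)
  have Winv: "inv\<^bsub>G\<^esub> w \<in> W" if "w \<in> W" for w
    using W(2) that by (auto simp: symmetric_subset_def SET_INV_def)
  have "\<rho> id \<otimes>\<^bsub>G\<^esub> \<rho> id = \<rho> id" using hom[OF orth_id orth_id] by simp
  then have \<rho>1: "\<rho> id = \<one>\<^bsub>G\<^esub>" using \<rho>[OF orth_id] by (simp add: l_cancel_one)
  have \<rho>inv: "\<rho> (finv A) = inv\<^bsub>G\<^esub> (\<rho> A)" if A: "A \<in> orth" for A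
  proof -
    have "finv A \<circ> A = id" using A by (simp add: fun_eq_iff orth_inv_apply)
    then have "\<rho> (finv A) \<otimes>\<^bsub>G\<^esub> \<rho> A = \<one>\<^bsub>G\<^esub>" using hom[OF orth_inv[OF A] A] \<rho>1 by simp
    then show ?thesis using \<rho> A orth_inv[OF A] by (metis inv_equality)
  qed
  from W(1) obtain C0 where C0: "countable C0" "C0 \<subseteq> carrier G" "carrier G = (\<Union>c\<in>C0. c <#\<^bsub>G\<^esub> W)"
    unfolding sigma_syndetic_def by (elim conjE exE)
  define C1 where "C1 = {c \<in> C0. \<exists>A\<in>orth. \<rho> A \<in> c <#\<^bsub>G\<^esub> W}"
  have "\<forall>c\<in>C1. \<exists>A\<in>orth. \<rho> A \<in> c <#\<^bsub>G\<^esub> W" by (simp add: C1_def)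
  then obtain h where h: "\<And>c. c \<in> C1 \<Longrightarrow> h c \<in> orth" "\<And>c. c \<in> C1 \<Longrightarrow> \<rho> (h c) \<in> c <#\<^bsub>G\<^esub> W" by metis
  define P where "P n = {A \<in> orth. \<rho> A \<in> set_power G W (2 * n)}" for n
  interpret orth_filtration e P "h ` C1"
  proof
    show "A \<circ> B \<in> P (m + n)" if "A \<in> P m" "B \<in> P n" for A B m n
      using that set_power_mult[OF WG, of "\<rho> A" "2 * m" "\<rho> B" "2 * n"]
      by (simp add: P_def orth_comp hom distrib_left)
    show "finv A \<in> P n" if "A \<in> P n" for A n
      using that set_power_inv[OF W(2)] by (simp add: P_def orth_inv \<rho>inv)
    show "A \<in> orth" if "A \<in> P n" for A n using that by (simp add: P_def)
    show "countable (h ` C1)" using C0(1) by (simp add: C1_def)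
    show "h ` C1 \<subseteq> orth" using h(1) by blast
    show "\<exists>c\<in>h ` C1. finv c \<circ> A \<in> P 1" if A: "A \<in> orth" for A
    proof -
      obtain c where c: "c \<in> C0" "\<rho> A \<in> c <#\<^bsub>G\<^esub> W" using \<rho>[OF A] C0(3) by blast
      then have c1: "c \<in> C1" using A by (auto simp: C1_def)
      obtain w where w: "w \<in> W" "\<rho> A = c \<otimes>\<^bsub>G\<^esub> w" using c(2) by (auto simp: l_coset_def)
      obtain w' where w': "w' \<in> W" "\<rho> (h c) = c \<otimes>\<^bsub>G\<^esub> w'" using h(2)[OF c1] by (auto simp: l_coset_def)
      have G: "c \<in> carrier G" "w \<in> carrier G" "w' \<in> carrier G" using c(1) C0(2) w(1) w'(1) WG by blast+
      have "\<rho> (finv (h c) \<circ> A) = inv\<^bsub>G\<^esub> (c \<otimes>\<^bsub>G\<^esub> w') \<otimes>\<^bsub>G\<^esub> (c \<otimes>\<^bsub>G\<^esub> w)"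
        using A h(1)[OF c1] by (simp add: hom orth_inv \<rho>inv w w')
      also have "\<dots> = inv\<^bsub>G\<^esub> w' \<otimes>\<^bsub>G\<^esub> (inv\<^bsub>G\<^esub> c \<otimes>\<^bsub>G\<^esub> (c \<otimes>\<^bsub>G\<^esub> w))"
        using G by (simp add: inv_mult_group m_assoc)
      also have "\<dots> = inv\<^bsub>G\<^esub> w' \<otimes>\<^bsub>G\<^esub> w" using G by (simp flip: m_assoc)
      also have "\<dots> \<in> set_power G W (1 + 1)"
        by (intro set_power_mult set_power_1 WG Winv w(1) w'(1))
      finally have "finv (h c) \<circ> A \<in> P 1"
        using A h(1)[OF c1] by (simp add: P_def orth_comp orth_inv numeral_2_eq_2)
      then show ?thesis using c1 by blast
    qed
  qed
  obtain m \<epsilon> where "\<epsilon> > 0" "\<forall>g\<in>orth. (\<forall>i<m. norm (g (e i) - e i) < \<epsilon>) \<longrightarrow> g \<in> P 822"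
    using orth_neighbourhood_subset_P by blast
  then show ?thesis by (intro exI[of _ m] exI[of _ \<epsilon>]) (simp add: P_def)
qed

end

section \<open>Reflections and small rotations\<close>

lemma reflection_orth:
  fixes u :: "'a::real_inner"
  assumes "norm u = 1"
  shows "(\<lambda>v. v - (2 * (u \<bullet> v)) *\<^sub>R u) \<in> orth" (is "?R \<in> _")
proof -
  have uu: "u \<bullet> u = 1" using assms by (simp add: norm_eq_1)
  have "?R v \<bullet> ?R w = v \<bullet> w" for v w
    by (simp add: inner_diff_left inner_diff_right uu inner_commute[of v u])
  moreover have "?R (?R v) = v" for v
    by (simp add: inner_diff_right uu)
  then have "surj ?R" by (rule surjI[where f = ?R])
  ultimately show ?thesis by (simp add: orth_def)
qed

text \<open>The product of the reflections along \<open>p\<close> and along \<open>p + q\<close>: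
  the first sends \<open>p\<close> to \<open>- p\<close>, the second \<open>- p\<close> to
  \<open>q\<close>. Its displacement is governed by the distance of the two unit normals; a crude
  bound suffices, since only its smallness matters.\<close>

lemma small_rotation:
  fixes p q :: "'a::real_inner"
  assumes r: "norm p = r" "norm q = r" "r > 0" and pq: "p + q \<noteq> 0"
  shows "\<exists>A\<in>orth. A p = q \<and> (\<forall>v. norm (A v - v) \<le> 4 * sqrt (norm (p - q) / r) * norm v)"
proof -
  define R where "R u = (\<lambda>v. v - (2 * (u \<bullet> v)) *\<^sub>R u)" for u :: 'a
  define p' where "p' = (1 / r) *\<^sub>R p"
  define w where "w = (1 / norm (p + q)) *\<^sub>R (p + q)"
  have n1: "norm p' = 1" "norm w = 1" using r pq by (simp_all add: p'_def w_def)
  then have i1: "p' \<bullet> p' = 1" "w \<bullet> w = 1" by (simp_all add: norm_eq_1)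
  have Ro: "R p' \<in> orth" "R w \<in> orth"
    using reflection_orth[OF n1(1)] reflection_orth[OF n1(2)] by (simp_all only: R_def)
  have rr: "p \<bullet> p = r\<^sup>2" "q \<bullet> q = r\<^sup>2" using r by (simp_all flip: power2_norm_eq_inner)
  have sum: "(norm (p + q))\<^sup>2 = 2 * (p \<bullet> (p + q))"
    unfolding power2_norm_eq_inner by (simp add: inner_add_left inner_add_right rr inner_commute[of q p])
  have "R p' p = - p"
    using r by (simp add: R_def p'_def rr power2_eq_square scaleR_2)
  moreover have "R w (- p) = q"
  proof -
    define K where "K = 2 * ((p + q) \<bullet> p) / (norm (p + q))\<^sup>2"
    have "(norm (p + q))\<^sup>2 \<noteq> 0" using pq by simp
    then have "K = 1" unfolding K_def sum by (simp add: inner_commute)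
    moreover have "R w (- p) = - p + K *\<^sub>R (p + q)"
      by (simp only: K_def R_def w_def inner_scaleR_left inner_minus_right scaleR_scaleR power2_eq_square) simp
    ultimately show ?thesis by simp
  qed
  ultimately have Ap: "(R w \<circ> R p') p = q" by simp
  have "(norm (p' - w))\<^sup>2 = 2 - 2 * (p' \<bullet> w)"
    unfolding power2_norm_eq_inner by (simp add: inner_diff_left inner_diff_right i1 inner_commute[of w p'])
  also have "p' \<bullet> w = norm (p + q) / (2 * r)"
  proof -
    have "p' \<bullet> w = (p \<bullet> (p + q)) / (r * norm (p + q))" by (simp add: p'_def w_def)
    also have "p \<bullet> (p + q) = (norm (p + q))\<^sup>2 / 2" using sum by simp
    finally show ?thesis using pq by (simp add: power2_eq_square)
  qed
  also have "2 - 2 * (norm (p + q) / (2 * r)) = (2 * r - norm (p + q)) / r"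
    using r(3) by (simp add: field_simps)
  also have "\<dots> \<le> norm (p - q) / r"
  proof -
    have "2 * r = norm ((p + q) + (p - q))" using r by (simp flip: scaleR_2)
    also have "\<dots> \<le> norm (p + q) + norm (p - q)" by (rule norm_triangle_ineq)
    finally show ?thesis using r(3) by (simp add: divide_right_mono)
  qed
  finally have pw: "norm (p' - w) \<le> sqrt (norm (p - q) / r)" by (rule real_le_rsqrt)
  have "norm ((R w \<circ> R p') v - v) \<le> 4 * sqrt (norm (p - q) / r) * norm v" for v
  proof -
    define y where "y = R p' v"
    have ny: "norm y = norm v" unfolding y_def by (rule orth_norm[OF Ro(1)])
    \<comment> \<open>\<open>R p'\<close> is an involution, so the displacement of \<open>v\<close>
      is the difference of the two reflections at \<open>y\<close>.\<close>
    have "R p' y = v" by (simp add: y_def R_def inner_diff_right i1)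
    then have "(R w \<circ> R p') v - v = R w y - R p' y" by (simp add: y_def)
    also have "\<dots> = 2 *\<^sub>R (((p' - w) \<bullet> y) *\<^sub>R p' + (w \<bullet> y) *\<^sub>R (p' - w))"
      by (simp add: R_def inner_diff_left algebra_simps flip: scaleR_2)
    also have "norm \<dots> \<le> 2 * (\<bar>(p' - w) \<bullet> y\<bar> + \<bar>w \<bullet> y\<bar> * norm (p' - w))"
      using norm_triangle_ineq[of "((p' - w) \<bullet> y) *\<^sub>R p'" "(w \<bullet> y) *\<^sub>R (p' - w)"] by (simp add: n1)
    also have "\<dots> \<le> 2 * (norm (p' - w) * norm y + norm y * norm (p' - w))"
      using Cauchy_Schwarz_ineq2[of "p' - w" y] Cauchy_Schwarz_ineq2[of w y] n1
      by (intro mult_left_mono add_mono mult_right_mono) auto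
    also have "\<dots> = 4 * norm (p' - w) * norm v" by (simp add: ny)
    also have "\<dots> \<le> 4 * sqrt (norm (p - q) / r) * norm v"
      using pw by (intro mult_right_mono) auto
    finally show ?thesis .
  qed
  with Ap orth_comp[OF Ro(2,1)] show ?thesis by blast
qed

text \<open>
  \<open>\<phi>\<close> is a chart centred at \<open>x0\<close> in which the stabilizer of \<open>x0\<close> acts linearly as \<open>orth\<close>.
  The last assumption says that from \<open>x0\<close> every near point \<open>x\<close> is reached in two short steps, each on a
  sphere around one of \<open>ta x0\<close>, \<open>tb x0\<close>.
\<close>

locale orth_chart = hilbert e + Metric_space M d
  for e :: "nat \<Rightarrow> 'a::{real_inner,complete_space}" and M :: "'b set" and d +
  fixes x0 :: 'b and \<phi> :: "'b \<Rightarrow> 'a" and \<rho> :: "('a \<Rightarrow> 'a) \<Rightarrow> 'b \<Rightarrow> 'b" and ta tb :: "'b \<Rightarrow> 'b"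
  assumes x0: "x0 \<in> M"
    and \<rho>_carrier: "A \<in> orth \<Longrightarrow> \<rho> A \<in> carrier (isom_group M d)"
    and \<rho>_comp: "A \<in> orth \<Longrightarrow> B \<in> orth \<Longrightarrow> \<rho> (A \<circ> B) = compose M (\<rho> A) (\<rho> B)"
    and \<rho>_x0: "A \<in> orth \<Longrightarrow> \<rho> A x0 = x0"
    and \<rho>_stab: "g \<in> carrier (isom_group M d) \<Longrightarrow> g x0 = x0 \<Longrightarrow> \<exists>A\<in>orth. g = \<rho> A"
    and \<phi>_\<rho>: "A \<in> orth \<Longrightarrow> x \<in> M \<Longrightarrow> \<phi> (\<rho> A x) = A (\<phi> x)"
    and \<phi>_inj: "x \<in> M \<Longrightarrow> y \<in> M \<Longrightarrow> \<phi> x = \<phi> y \<Longrightarrow> x = y"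
    and \<phi>_e: "\<exists>x\<in>M. \<phi> x = e i"
    and \<phi>_ge: "x \<in> M \<Longrightarrow> d x x0 \<le> norm (\<phi> x)"
    and \<phi>_norm: "x \<in> M \<Longrightarrow> y \<in> M \<Longrightarrow> d x x0 = d y x0 \<Longrightarrow> norm (\<phi> x) = norm (\<phi> y)"
    and \<phi>_le: "x \<in> M \<Longrightarrow> y \<in> M \<Longrightarrow> d x x0 = d y x0 \<Longrightarrow> d x y \<le> norm (\<phi> x - \<phi> y)"
    and \<phi>_cont: "\<epsilon> > 0 \<Longrightarrow> \<exists>\<delta>>0. \<forall>x\<in>M. \<forall>y\<in>M. d x x0 = d y x0 \<longrightarrow> d x y < \<delta> \<longrightarrow> norm (\<phi> x - \<phi> y) < \<epsilon>"
    and ta: "ta \<in> carrier (isom_group M d)" "ta x0 \<noteq> x0"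
    and tb: "tb \<in> carrier (isom_group M d)" "tb x0 \<noteq> x0"
    and connect: "\<delta> > 0 \<Longrightarrow> \<exists>\<delta>'>0. \<forall>x\<in>M. d x x0 < \<delta>' \<longrightarrow> (\<exists>y\<in>M. d y x0 < \<delta> \<and>
      (d y (ta x0) = d x0 (ta x0) \<and> d y (tb x0) = d x (tb x0) \<or>
       d y (tb x0) = d x0 (tb x0) \<and> d y (ta x0) = d x (ta x0)))"
begin

abbreviation "G \<equiv> isom_group M d"

sublocale G: group G by (rule group_isom_group)

lemma G_apply:
  assumes "f \<in> carrier G" "g \<in> carrier G" "x \<in> M"
  shows "(f \<otimes>\<^bsub>G\<^esub> g) x = f (g x)"
  using assms by (simp add: mult_isom_group compose_eq)

lemma G_dist: "f \<in> carrier G \<Longrightarrow> x \<in> M \<Longrightarrow> y \<in> M \<Longrightarrow> d (f x) (f y) = d x y"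
  by (simp add: carrier_isom_group)

lemma G_inv_left:
  assumes "f \<in> carrier G" "x \<in> M"
  shows "(inv\<^bsub>G\<^esub> f) (f x) = x"
proof -
  have "inj_on f M" using assms by (simp add: carrier_isom_group Bij_def bij_betw_def)
  then show ?thesis using assms isom_mem[OF assms] by (simp add: inv_isom_group)
qed

lemma G_inv_right:
  assumes "f \<in> carrier G" "x \<in> M"
  shows "f ((inv\<^bsub>G\<^esub> f) x) = x"
proof -
  have "f ` M = M" using assms by (simp add: carrier_isom_group Bij_def bij_betw_def)
  then show ?thesis using assms by (simp add: inv_isom_group f_inv_into_f)
qed

lemma \<rho>_mult: "A \<in> orth \<Longrightarrow> B \<in> orth \<Longrightarrow> \<rho> (A \<circ> B) = \<rho> A \<otimes>\<^bsub>G\<^esub> \<rho> B"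
  by (simp add: \<rho>_comp mult_isom_group \<rho>_carrier)

lemma \<rho>_dist:
  assumes "A \<in> orth" "s \<in> M"
  shows "d (\<rho> A s) x0 = d s x0" "d (\<rho> A s) s \<le> norm (A (\<phi> s) - \<phi> s)"
proof -
  have "d (\<rho> A s) (\<rho> A x0) = d s x0" by (rule G_dist[OF \<rho>_carrier[OF assms(1)] assms(2) x0])
  then show *: "d (\<rho> A s) x0 = d s x0" by (simp add: \<rho>_x0 assms(1))
  show "d (\<rho> A s) s \<le> norm (A (\<phi> s) - \<phi> s)"
    using \<phi>_le[OF isom_mem[OF \<rho>_carrier[OF assms(1)] assms(2)] assms(2) *] by (simp add: \<phi>_\<rho> assms)
qed

text \<open>The copy of \<open>orth\<close> inside the stabilizer of \<open>t x0\<close>; unlike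
  \<open>\<rho>\<close> itself it can move \<open>x0\<close>.\<close>

definition conj_\<rho> :: "('b \<Rightarrow> 'b) \<Rightarrow> ('a \<Rightarrow> 'a) \<Rightarrow> 'b \<Rightarrow> 'b" where
  "conj_\<rho> t A = t \<otimes>\<^bsub>G\<^esub> \<rho> A \<otimes>\<^bsub>G\<^esub> inv\<^bsub>G\<^esub> t"

lemma conj_\<rho>_carrier: "t \<in> carrier G \<Longrightarrow> A \<in> orth \<Longrightarrow> conj_\<rho> t A \<in> carrier G"
  by (simp add: conj_\<rho>_def \<rho>_carrier)

lemma conj_\<rho>_mult:
  assumes "t \<in> carrier G" "A \<in> orth" "B \<in> orth"
  shows "conj_\<rho> t (A \<circ> B) = conj_\<rho> t A \<otimes>\<^bsub>G\<^esub> conj_\<rho> t B"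
proof -
  note c = assms(1) \<rho>_carrier[OF assms(2)] \<rho>_carrier[OF assms(3)]
  have "inv\<^bsub>G\<^esub> t \<otimes>\<^bsub>G\<^esub> (t \<otimes>\<^bsub>G\<^esub> (\<rho> B \<otimes>\<^bsub>G\<^esub> inv\<^bsub>G\<^esub> t)) = \<rho> B \<otimes>\<^bsub>G\<^esub> inv\<^bsub>G\<^esub> t"
    using c by (simp flip: G.m_assoc)
  then show ?thesis using c assms by (simp add: conj_\<rho>_def \<rho>_mult G.m_assoc)
qed

lemma conj_\<rho>_apply:
  assumes "t \<in> carrier G" "A \<in> orth" "x \<in> M"
  shows "conj_\<rho> t A x = t (\<rho> A ((inv\<^bsub>G\<^esub> t) x))"
proof -
  have "inv\<^bsub>G\<^esub> t \<in> carrier G" using assms(1) by simp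
  then show ?thesis
    using assms isom_mem[of "inv\<^bsub>G\<^esub> t" x] by (simp add: conj_\<rho>_def G_apply \<rho>_carrier)
qed

text \<open>Pulled back by \<open>t\<close>, the two points lie on one sphere about
  \<open>x0\<close>, where the chart linearizes the stabilizer: a \<open>small_rotation\<close>
  takes one chart vector to the other and barely moves the finite set \<open>S\<close>.\<close>

lemma local_move:
  assumes t: "t \<in> carrier G" "t x0 \<noteq> x0" and S: "finite S" "S \<subseteq> M" and \<epsilon>: "\<epsilon> > 0"
  shows "\<exists>\<delta>>0. \<forall>x\<in>M. \<forall>y\<in>M. d x x0 < \<delta> \<longrightarrow> d y x0 < \<delta> \<longrightarrow> d x (t x0) = d y (t x0) \<longrightarrow>
    (\<exists>A\<in>orth. (\<forall>i. norm (A (e i) - e i) < \<epsilon>) \<and> conj_\<rho> t A x = y \<and> (\<forall>s\<in>S. d (conj_\<rho> t A s) s < \<epsilon>))"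
proof -
  define t' where "t' = inv\<^bsub>G\<^esub> t"
  have t': "t' \<in> carrier G" using t by (simp add: t'_def)
  note tt' = G_inv_right[OF t(1), folded t'_def] and t't = G_inv_left[OF t(1), folded t'_def]
  note m = isom_mem[OF t'] and mt = isom_mem[OF t(1)]
  have "t' x0 \<noteq> x0" using tt'[OF x0] t(2) by metis
  define r where "r = d (t' x0) x0"
  have r: "r > 0" using \<open>t' x0 \<noteq> x0\<close> m[OF x0] x0 by (simp add: r_def)
  \<comment> \<open>Bounds the chart norms of the points of \<open>S\<close> after pulling back; the
    summand 1 covers the vectors \<open>e i\<close> as well.\<close>
  define K where "K = 1 + (\<Sum>s\<in>S. norm (\<phi> (t' s)))"
  have K1: "K \<ge> 1" by (simp add: K_def sum_nonneg)
  have K: "norm (\<phi> (t' s)) \<le> K" if "s \<in> S" for s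
    using member_le_sum[of s S "\<lambda>s. norm (\<phi> (t' s))"] S(1) that by (simp add: K_def)
  \<comment> \<open>With this value the displacement bound \<open>4 * \<zeta> * K\<close> is
    \<open>\<epsilon> / 2\<close>.\<close>
  define \<zeta> where "\<zeta> = \<epsilon> / (8 * K)"
  have \<zeta>: "\<zeta> > 0" using \<epsilon> K1 by (simp add: \<zeta>_def)
  \<comment> \<open>The first bound excludes antipodal chart vectors, the second makes the square
    root in \<open>small_rotation\<close> at most \<open>\<zeta>\<close>; both rely on the chart
    radius \<open>l\<close> exceeding \<open>r / 2\<close>.\<close>
  define \<eta> where "\<eta> = min (r / 2) (\<zeta>\<^sup>2 * (r / 2))"
  have \<eta>: "\<eta> > 0" using r \<zeta> by (simp add: \<eta>_def)
  obtain \<delta>1 where \<delta>1: "\<delta>1 > 0" "\<And>x y. x \<in> M \<Longrightarrow> y \<in> M \<Longrightarrow> d x x0 = d y x0 \<Longrightarrow> d x y < \<delta>1 \<Longrightarrow> norm (\<phi> x - \<phi> y) < \<eta>"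
    using \<phi>_cont[OF \<eta>] by metis
  define \<delta> where "\<delta> = min (r / 2) (\<delta>1 / 2)"
  have \<delta>: "\<delta> > 0" using r \<delta>1 by (simp add: \<delta>_def)
  have "\<exists>A\<in>orth. (\<forall>i. norm (A (e i) - e i) < \<epsilon>) \<and> conj_\<rho> t A x = y \<and> (\<forall>s\<in>S. d (conj_\<rho> t A s) s < \<epsilon>)"
    if xy: "x \<in> M" "y \<in> M" "d x x0 < \<delta>" "d y x0 < \<delta>" "d x (t x0) = d y (t x0)" for x y
  proof -
    have x'x0: "d (t' z) x0 = d z (t x0)" if "z \<in> M" for z
      using G_dist[OF t(1) m[OF that] x0] by (simp add: tt' that)
    have same: "d (t' x) x0 = d (t' y) x0" using xy by (simp add: x'x0)
    have "d (t' x) (t' y) = d x y" by (rule G_dist[OF t' xy(1,2)])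
    also have "\<dots> \<le> d x x0 + d x0 y" by (rule triangle[OF xy(1) x0 xy(2)])
    also have "\<dots> < \<delta>1" using xy(3,4) commute[of x0 y] by (simp add: \<delta>_def)
    finally have close: "norm (\<phi> (t' x) - \<phi> (t' y)) < \<eta>" by (intro \<delta>1(2) m xy same)
    define l where "l = norm (\<phi> (t' x))"
    have ln: "norm (\<phi> (t' y)) = l" unfolding l_def by (rule \<phi>_norm[OF m[OF xy(1)] m[OF xy(2)] same, symmetric])
    have "r = d (t' x0) x0" by (simp add: r_def)
    also have "\<dots> \<le> d (t' x0) (t' x) + d (t' x) x0" by (rule triangle[OF m[OF x0] m[OF xy(1)] x0])
    also have "d (t' x0) (t' x) = d x0 x" by (rule G_dist[OF t' x0 xy(1)])
    also have "d (t' x) x0 \<le> l" unfolding l_def by (rule \<phi>_ge[OF m[OF xy(1)]])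
    finally have l: "l > r / 2" using xy(3) commute[of x0 x] by (simp add: \<delta>_def)
    have "\<phi> (t' x) + \<phi> (t' y) \<noteq> 0"
    proof
      assume "\<phi> (t' x) + \<phi> (t' y) = 0"
      then have "\<phi> (t' x) - \<phi> (t' y) = 2 *\<^sub>R \<phi> (t' x)" by (simp add: scaleR_2 eq_neg_iff_add_eq_0[symmetric])
      then have "norm (\<phi> (t' x) - \<phi> (t' y)) = 2 * l" by (simp add: l_def)
      then show False using close l r by (simp add: \<eta>_def)
    qed
    then obtain A where A: "A \<in> orth" "A (\<phi> (t' x)) = \<phi> (t' y)"
      "\<And>v. norm (A v - v) \<le> 4 * sqrt (norm (\<phi> (t' x) - \<phi> (t' y)) / l) * norm v"
      using small_rotation[OF l_def[symmetric] ln] l r by fastforce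
    have "norm (\<phi> (t' x) - \<phi> (t' y)) / l \<le> \<zeta>\<^sup>2"
    proof -
      have "norm (\<phi> (t' x) - \<phi> (t' y)) \<le> \<zeta>\<^sup>2 * (r / 2)" using close by (simp add: \<eta>_def)
      also have "\<dots> \<le> \<zeta>\<^sup>2 * l" using l by (intro mult_left_mono) auto
      finally show ?thesis using l r by (simp add: divide_le_eq)
    qed
    then have "sqrt (norm (\<phi> (t' x) - \<phi> (t' y)) / l) \<le> \<zeta>"
      using \<zeta> by (intro real_le_lsqrt) (auto simp: l_def)
    then have A': "norm (A v - v) < \<epsilon>" if "norm v \<le> K" for v
    proof -
      have "norm (A v - v) \<le> 4 * \<zeta> * K"
      proof (rule order_trans[OF A(3)])
        have "0 \<le> norm (\<phi> (t' x) - \<phi> (t' y)) / l" using l r by simp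
        then show "4 * sqrt (norm (\<phi> (t' x) - \<phi> (t' y)) / l) * norm v \<le> 4 * \<zeta> * K"
          using \<open>sqrt _ \<le> \<zeta>\<close> that \<zeta> by (intro mult_mono) auto
      qed
      also have "\<dots> < \<epsilon>" using K1 \<epsilon> by (simp add: \<zeta>_def)
      finally show ?thesis .
    qed
    have "\<rho> A (t' x) = t' y"
      by (rule \<phi>_inj[OF isom_mem[OF \<rho>_carrier[OF A(1)] m[OF xy(1)]] m[OF xy(2)]])
        (simp add: \<phi>_\<rho> A(1,2) m xy)
    then have "conj_\<rho> t A x = y" using xy by (simp add: conj_\<rho>_apply t A(1) tt' flip: t'_def)
    moreover have "d (conj_\<rho> t A s) s < \<epsilon>" if s: "s \<in> S" for s
    proof -
      have sM: "s \<in> M" using s S by blast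
      have "d (conj_\<rho> t A s) (t (t' s)) = d (\<rho> A (t' s)) (t' s)"
        using G_dist[OF t(1) isom_mem[OF \<rho>_carrier[OF A(1)] m[OF sM]] m[OF sM]] sM
        by (simp add: conj_\<rho>_apply t A(1) flip: t'_def)
      also have "\<dots> \<le> norm (A (\<phi> (t' s)) - \<phi> (t' s))" by (rule \<rho>_dist(2)[OF A(1) m[OF sM]])
      also have "\<dots> < \<epsilon>" by (rule A'[OF K[OF s]])
      finally show ?thesis by (simp add: tt' sM)
    qed
    moreover have "norm (A (e i) - e i) < \<epsilon>" for i by (rule A') (simp add: K1)
    ultimately show ?thesis using A(1) by blast
  qed
  with \<delta> show ?thesis by blast
qed

text \<open>An element \<open>g\<close> near the identity is matched at \<open>x0\<close> by a
  product \<open>h'\<close> of two short moves about \<open>ta x0\<close> and \<open>tb x0\<close>.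
  The remaining factor \<open>k\<close> fixes \<open>x0\<close> and still moves the test points
  \<open>S\<close> little, so it lies in the neighbourhood found for the stabilizer.\<close>

theorem steinhaus_isom_group: "steinhaus_property G (isom_topology M d)"
  unfolding steinhaus_property_def
proof (intro conjI exI[of _ 4932] allI impI)
  show "topological_group G (isom_topology M d)" by (rule topological_group_isom)
  fix W assume W: "sigma_syndetic G W \<and> symmetric_subset G W"
  then have WG: "W \<subseteq> carrier G" by (simp add: symmetric_subset_def)
  note near = orth_neighbourhood_subset_set_power[OF G.group_axioms _ _ conjunct1[OF W] conjunct2[OF W]]
  have "\<exists>m. \<exists>\<epsilon>>0. \<forall>A\<in>orth. (\<forall>i<m. norm (A (e i) - e i) < \<epsilon>) \<longrightarrow> \<rho> A \<in> set_power G W 1644"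
    by (rule near) (simp_all add: \<rho>_carrier \<rho>_mult)
  then obtain m0 \<epsilon>0 where 0: "\<epsilon>0 > 0" "\<And>A. A \<in> orth \<Longrightarrow> (\<And>i. i < m0 \<Longrightarrow> norm (A (e i) - e i) < \<epsilon>0) \<Longrightarrow> \<rho> A \<in> set_power G W 1644"
    by blast
  have conj_near: "\<exists>\<epsilon>>0. \<forall>A\<in>orth. (\<forall>i. norm (A (e i) - e i) < \<epsilon>) \<longrightarrow> conj_\<rho> t A \<in> set_power G W 1644"
    if t: "t \<in> carrier G" for t
  proof -
    have "\<exists>m. \<exists>\<epsilon>>0. \<forall>A\<in>orth. (\<forall>i<m. norm (A (e i) - e i) < \<epsilon>) \<longrightarrow> conj_\<rho> t A \<in> set_power G W 1644"
      by (rule near) (simp_all add: conj_\<rho>_carrier conj_\<rho>_mult t)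
    then show ?thesis by blast
  qed
  have "\<forall>i. \<exists>x\<in>M. \<phi> x = e i" using \<phi>_e by blast
  then obtain s where s: "\<And>i. s i \<in> M" "\<And>i. \<phi> (s i) = e i" by metis
  \<comment> \<open>Points with chart images \<open>e i\<close> for \<open>i < m0\<close>: they turn
    closeness on basis vectors into a condition on finitely many orbit maps, hence an open
    one.\<close>
  define S where "S = s ` {..<m0}"
  have S: "finite S" "S \<subseteq> M" using s(1) by (auto simp: S_def)
  obtain \<delta>0 where \<delta>0: "\<delta>0 > 0" "\<And>x y. x \<in> M \<Longrightarrow> y \<in> M \<Longrightarrow> d x x0 = d y x0 \<Longrightarrow> d x y < \<delta>0 \<Longrightarrow> norm (\<phi> x - \<phi> y) < \<epsilon>0"
    using \<phi>_cont[OF 0(1)] by metis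
  have stab: "g \<in> set_power G W 1644" if g: "g \<in> carrier G" "g x0 = x0" "\<And>x. x \<in> S \<Longrightarrow> d (g x) x < \<delta>0" for g
  proof -
    obtain A where A: "A \<in> orth" "g = \<rho> A" using \<rho>_stab[OF g(1,2)] by blast
    have "norm (A (e i) - e i) < \<epsilon>0" if "i < m0" for i
    proof -
      have "d (\<rho> A (s i)) (s i) < \<delta>0" using g(3)[of "s i"] that A by (simp add: S_def)
      then have "norm (\<phi> (\<rho> A (s i)) - \<phi> (s i)) < \<epsilon>0"
        by (intro \<delta>0(2) isom_mem[OF \<rho>_carrier] s A(1) \<rho>_dist)
      then show ?thesis by (simp add: \<phi>_\<rho> A(1) s)
    qed
    then show ?thesis unfolding A(2) by (rule 0(2)[OF A(1)])
  qed
  have step: "\<exists>\<delta>>0. \<forall>x\<in>M. \<forall>y\<in>M. d x x0 < \<delta> \<longrightarrow> d y x0 < \<delta> \<longrightarrow> d x (t x0) = d y (t x0) \<longrightarrow>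
      (\<exists>h\<in>set_power G W 1644. h x = y \<and> (\<forall>s\<in>S. d (h s) s < \<delta>0 / 4))"
    if t: "t \<in> carrier G" "t x0 \<noteq> x0" for t
  proof -
    obtain \<epsilon> where \<epsilon>: "\<epsilon> > 0" "\<forall>A\<in>orth. (\<forall>i. norm (A (e i) - e i) < \<epsilon>) \<longrightarrow> conj_\<rho> t A \<in> set_power G W 1644"
      using conj_near[OF t(1)] by blast
    have "min \<epsilon> (\<delta>0 / 4) > 0" using \<epsilon>(1) \<delta>0(1) by simp
    from local_move[OF t S this] obtain \<delta> where \<delta>: "\<delta> > 0"
      and mv: "\<forall>x\<in>M. \<forall>y\<in>M. d x x0 < \<delta> \<longrightarrow> d y x0 < \<delta> \<longrightarrow> d x (t x0) = d y (t x0) \<longrightarrow>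
        (\<exists>A\<in>orth. (\<forall>i. norm (A (e i) - e i) < min \<epsilon> (\<delta>0 / 4)) \<and> conj_\<rho> t A x = y \<and>
          (\<forall>s\<in>S. d (conj_\<rho> t A s) s < min \<epsilon> (\<delta>0 / 4)))" by blast
    show ?thesis
    proof (intro exI[of _ \<delta>] conjI ballI impI \<delta>)
      fix x y assume "x \<in> M" "y \<in> M" "d x x0 < \<delta>" "d y x0 < \<delta>" "d x (t x0) = d y (t x0)"
      then obtain A where A: "A \<in> orth" "\<forall>i. norm (A (e i) - e i) < min \<epsilon> (\<delta>0 / 4)" "conj_\<rho> t A x = y"
        "\<forall>s\<in>S. d (conj_\<rho> t A s) s < min \<epsilon> (\<delta>0 / 4)" using mv by blast
      then have "conj_\<rho> t A \<in> set_power G W 1644" using \<epsilon>(2) by simp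
      then show "\<exists>h\<in>set_power G W 1644. h x = y \<and> (\<forall>s\<in>S. d (h s) s < \<delta>0 / 4)" using A by auto
    qed
  qed
  from step[OF ta] obtain \<delta>a where \<delta>a: "\<delta>a > 0"
    "\<forall>x\<in>M. \<forall>y\<in>M. d x x0 < \<delta>a \<longrightarrow> d y x0 < \<delta>a \<longrightarrow> d x (ta x0) = d y (ta x0) \<longrightarrow>
      (\<exists>h\<in>set_power G W 1644. h x = y \<and> (\<forall>s\<in>S. d (h s) s < \<delta>0 / 4))"
    by (elim exE conjE)
  from step[OF tb] obtain \<delta>b where \<delta>b: "\<delta>b > 0"
    "\<forall>x\<in>M. \<forall>y\<in>M. d x x0 < \<delta>b \<longrightarrow> d y x0 < \<delta>b \<longrightarrow> d x (tb x0) = d y (tb x0) \<longrightarrow>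
      (\<exists>h\<in>set_power G W 1644. h x = y \<and> (\<forall>s\<in>S. d (h s) s < \<delta>0 / 4))"
    by (elim exE conjE)
  have "min \<delta>a \<delta>b > 0" using \<delta>a(1) \<delta>b(1) by simp
  from connect[OF this] obtain \<delta>' where \<delta>': "\<delta>' > 0" "\<And>x. x \<in> M \<Longrightarrow> d x x0 < \<delta>' \<Longrightarrow> \<exists>y\<in>M. d y x0 < min \<delta>a \<delta>b \<and>
      (d y (ta x0) = d x0 (ta x0) \<and> d y (tb x0) = d x (tb x0) \<or>
       d y (tb x0) = d x0 (tb x0) \<and> d y (ta x0) = d x (ta x0))" by blast
  define \<delta> where "\<delta> = min \<delta>' (min \<delta>a \<delta>b)"
  \<comment> \<open>\<open>g\<close> may displace points of \<open>S\<close> by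
    \<open>\<delta>0 / 2\<close> and each of the two moves by \<open>\<delta>0 / 4\<close>, so that
    \<open>k\<close> displaces them by less than \<open>\<delta>0\<close>.\<close>
  define U where "U = {g \<in> carrier G. g x0 \<in> mball x0 \<delta>} \<inter> (\<Inter>x\<in>S. {g \<in> carrier G. g x \<in> mball x (\<delta>0 / 2)})"
  show "\<exists>U. openin (isom_topology M d) U \<and> \<one>\<^bsub>G\<^esub> \<in> U \<and> U \<subseteq> set_power G W 4932"
  proof (intro exI[of _ U] conjI subsetI)
    show "openin (isom_topology M d) U"
    proof (cases "S = {}")
      case True
      then show ?thesis using openin_isom_ball[OF x0] by (simp add: U_def)
    next
      case False
      show ?thesis
        unfolding U_def
        by (intro openin_Int openin_INT2 openin_isom_ball x0 S(1) False subsetD[OF S(2)])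
    qed
    have one: "\<one>\<^bsub>G\<^esub> x = x" if "x \<in> M" for x
      using that by (simp add: isom_group_def BijGroup_def)
    have "\<delta> > 0" using \<delta>'(1) \<delta>a(1) \<delta>b(1) by (simp add: \<delta>_def)
    then show "\<one>\<^bsub>G\<^esub> \<in> U" using x0 S(2) \<delta>0(1) by (auto simp: U_def one subset_iff)
  next
    fix g assume gU: "g \<in> U"
    then have g: "g \<in> carrier G" "d (g x0) x0 < \<delta>" "\<And>x. x \<in> S \<Longrightarrow> d (g x) x < \<delta>0 / 2"
      by (auto simp: U_def commute)
    define x where "x = g x0"
    have x: "x \<in> M" "d x x0 < \<delta>'" "d x x0 < \<delta>a" "d x x0 < \<delta>b"
      using isom_mem[OF g(1) x0] g(2) by (simp_all add: x_def \<delta>_def)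
    have z: "d x0 x0 < \<delta>a" "d x0 x0 < \<delta>b" using \<delta>a(1) \<delta>b(1) x0 by simp_all
    obtain y where y: "y \<in> M" "d y x0 < \<delta>a" "d y x0 < \<delta>b"
      "d y (ta x0) = d x0 (ta x0) \<and> d y (tb x0) = d x (tb x0) \<or>
       d y (tb x0) = d x0 (tb x0) \<and> d y (ta x0) = d x (ta x0)" using \<delta>'(2)[OF x(1,2)] by auto
    have "\<exists>h1\<in>set_power G W 1644. \<exists>h2\<in>set_power G W 1644. h1 x0 = y \<and> h2 y = x \<and>
        (\<forall>s\<in>S. d (h1 s) s < \<delta>0 / 4) \<and> (\<forall>s\<in>S. d (h2 s) s < \<delta>0 / 4)"
      using y(4)
    proof
      assume "d y (ta x0) = d x0 (ta x0) \<and> d y (tb x0) = d x (tb x0)"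
      then show ?thesis using \<delta>a(2)[rule_format, OF x0 y(1) z(1) y(2)] \<delta>b(2)[rule_format, OF y(1) x(1) y(3) x(4)] by auto
    next
      assume "d y (tb x0) = d x0 (tb x0) \<and> d y (ta x0) = d x (ta x0)"
      then show ?thesis using \<delta>b(2)[rule_format, OF x0 y(1) z(2) y(3)] \<delta>a(2)[rule_format, OF y(1) x(1) y(2) x(3)] by auto
    qed
    then obtain h1 h2 where h: "h1 \<in> set_power G W 1644" "h2 \<in> set_power G W 1644" "h1 x0 = y" "h2 y = x"
      "\<And>s. s \<in> S \<Longrightarrow> d (h1 s) s < \<delta>0 / 4" "\<And>s. s \<in> S \<Longrightarrow> d (h2 s) s < \<delta>0 / 4" by blast
    have hc: "h1 \<in> carrier G" "h2 \<in> carrier G" using h(1,2) G.set_power_carrier[OF WG] by blast+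
    define h' where "h' = h2 \<otimes>\<^bsub>G\<^esub> h1"
    have h'c: "h' \<in> carrier G" using hc by (simp add: h'_def)
    have hap: "h' z = h2 (h1 z)" if "z \<in> M" for z using that hc by (simp add: h'_def G_apply)
    define k where "k = inv\<^bsub>G\<^esub> h' \<otimes>\<^bsub>G\<^esub> g"
    have ic: "inv\<^bsub>G\<^esub> h' \<in> carrier G" using h'c by simp
    have kc: "k \<in> carrier G" using h'c g(1) by (simp add: k_def)
    have kap: "k z = (inv\<^bsub>G\<^esub> h') (g z)" if "z \<in> M" for z using that ic g(1) by (simp add: k_def G_apply)
    have "k x0 = x0"
    proof -
      have "h' x0 = x" by (simp add: hap x0 h(3,4))
      then show ?thesis using G_inv_left[OF h'c x0] by (simp add: kap x0 x_def[symmetric])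
    qed
    moreover have "d (k s) s < \<delta>0" if s: "s \<in> S" for s
    proof -
      have sM: "s \<in> M" using s S by blast
      note mem = isom_mem[OF g(1) sM] isom_mem[OF h'c sM] isom_mem[OF hc(1) sM] isom_mem[OF hc(2) sM]
      have "d (k s) s = d ((inv\<^bsub>G\<^esub> h') (g s)) ((inv\<^bsub>G\<^esub> h') (h' s))"
        by (simp add: kap sM G_inv_left[OF h'c sM])
      also have "\<dots> = d (g s) (h' s)" by (rule G_dist[OF ic mem(1,2)])
      also have "\<dots> \<le> d (g s) s + d s (h' s)" by (rule triangle[OF mem(1) sM mem(2)])
      also have "d s (h' s) \<le> d s (h2 s) + d (h2 s) (h' s)" by (rule triangle[OF sM mem(4,2)])
      also have "d (h2 s) (h' s) = d s (h1 s)" using G_dist[OF hc(2) sM mem(3)] by (simp add: hap sM)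
      finally show ?thesis using g(3)[OF s] h(5,6)[OF s] by (simp add: commute[of s])
    qed
    ultimately have "k \<in> set_power G W 1644" by (intro stab kc)
    then have "h' \<otimes>\<^bsub>G\<^esub> k \<in> set_power G W ((1644 + 1644) + 1644)"
      unfolding h'_def by (intro G.set_power_mult WG h(1,2))
    moreover have "h' \<otimes>\<^bsub>G\<^esub> k = g" using h'c g(1) by (simp add: k_def flip: G.m_assoc)
    ultimately show "g \<in> set_power G W 4932" by simp
  qed
qed

end

section \<open>The Hilbert space and the hyperbolic space\<close>

lemma orthonormal_pair:
  fixes u n :: "'a::real_inner"
  assumes "norm u = 1" "norm n = 1" "u \<bullet> n = 0"
  shows "(a *\<^sub>R u + b *\<^sub>R n) \<bullet> u = a" "(norm (a *\<^sub>R u + b *\<^sub>R n))\<^sup>2 = a\<^sup>2 + b\<^sup>2"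
proof -
  have "u \<bullet> u = 1" "n \<bullet> n = 1" "n \<bullet> u = 0" using assms by (simp_all add: norm_eq_1 inner_commute)
  then show "(a *\<^sub>R u + b *\<^sub>R n) \<bullet> u = a" "(norm (a *\<^sub>R u + b *\<^sub>R n))\<^sup>2 = a\<^sup>2 + b\<^sup>2"
    unfolding power2_norm_eq_inner using assms(3)
    by (simp_all add: inner_add_left inner_add_right power2_eq_square)
qed

lemma hilbert_steinhaus:
  fixes e :: "nat \<Rightarrow> 'a::{real_inner,complete_space}"
  assumes "hilbert_basis e"
  shows "steinhaus_property (isom_group (UNIV :: 'a set) dist) (isom_topology (UNIV :: 'a set) dist)"
proof -
  interpret hilbert e by unfold_locales (rule assms)
  have G: "carrier (isom_group (UNIV :: 'a set) dist) = {f. bij f \<and> (\<forall>x y. dist (f x) (f y) = dist x y)}"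
    by (simp add: carrier_isom_group Bij_def)
  \<comment> \<open>\<open>y\<close> has to lie on the unit sphere about \<open>- u\<close> and on
    the sphere about \<open>u\<close> through \<open>x\<close>. These meet near 0 when
    \<open>x\<close> is near 0 and not inside the unit ball about \<open>u\<close>.\<close>
  have key: "\<exists>y. dist y 0 < \<delta> \<and> dist y (- u) = dist 0 (- u) \<and> dist y u = dist x u"
    if u: "norm u = 1" "norm n = 1" "u \<bullet> n = 0" and \<delta>: "\<delta> > 0" and x: "norm x < min 1 (\<delta>\<^sup>2 / 2)" "dist x u \<ge> 1"
    for u n x :: 'a and \<delta>
  proof -
    \<comment> \<open>The squared norm of the point sought: the first sphere forces
      \<open>y \<bullet> u = - \<sigma> / 2\<close>, and the second then determines
      \<open>\<sigma>\<close>. The component along \<open>n\<close> exists for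
      \<open>0 \<le> \<sigma> \<le> 4\<close>.\<close>
    define \<sigma> where "\<sigma> = ((norm x)\<^sup>2 - 2 * (x \<bullet> u)) / 2"
    have uu: "u \<bullet> u = 1" "n \<bullet> n = 1" using u by (simp_all add: norm_eq_1)
    have sq: "(dist z u)\<^sup>2 = (norm z)\<^sup>2 - 2 * (z \<bullet> u) + 1" "(dist z (- u))\<^sup>2 = (norm z)\<^sup>2 + 2 * (z \<bullet> u) + 1" for z
      unfolding dist_norm power2_norm_eq_inner
      by (simp_all add: inner_diff_left inner_diff_right inner_add_left inner_add_right uu inner_commute[of u z])
    have \<sigma>0: "0 \<le> \<sigma>" using power_mono[OF x(2), of 2] by (simp add: sq \<sigma>_def)
    have "\<bar>x \<bullet> u\<bar> \<le> norm x" using Cauchy_Schwarz_ineq2[of x u] u by simp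
    moreover have "(norm x)\<^sup>2 \<le> norm x" using x(1) by (simp add: power2_eq_square mult_left_le_one_le)
    ultimately have \<sigma>1: "\<sigma> \<le> 3 / 2 * norm x" by (simp add: \<sigma>_def)
    moreover have "0 < \<delta>\<^sup>2" using \<delta> by simp
    ultimately have \<sigma>: "\<sigma> < \<delta>\<^sup>2" "\<sigma> \<le> 4" using x(1) unfolding min_less_iff_conj by linarith+
    have nn: "0 \<le> \<sigma> - \<sigma>\<^sup>2 / 4" using mult_left_mono[OF \<sigma>(2) \<sigma>0] by (simp add: power2_eq_square)
    define y where "y = (- \<sigma> / 2) *\<^sub>R u + sqrt (\<sigma> - \<sigma>\<^sup>2 / 4) *\<^sub>R n"
    have yu: "y \<bullet> u = - \<sigma> / 2" unfolding y_def by (rule orthonormal_pair[OF u])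
    have yy: "(norm y)\<^sup>2 = \<sigma>"
      unfolding y_def orthonormal_pair(2)[OF u] real_sqrt_pow2[OF nn] by (simp add: power_divide)
    have "(norm y)\<^sup>2 < \<delta>\<^sup>2" using yy \<sigma>(1) by simp
    then have "norm y < \<delta>" using \<delta> by (simp add: power_less_imp_less_base)
    moreover have "(dist y (- u))\<^sup>2 = (dist 0 (- u))\<^sup>2" by (simp add: sq yu yy u)
    then have "dist y (- u) = dist 0 (- u)" by (simp only: power2_eq_iff_nonneg[OF zero_le_dist zero_le_dist])
    moreover have "(dist y u)\<^sup>2 = (dist x u)\<^sup>2" by (simp add: sq yu yy) (simp add: \<sigma>_def field_simps)
    then have "dist y u = dist x u" by (simp only: power2_eq_iff_nonneg[OF zero_le_dist zero_le_dist])
    ultimately show ?thesis by (intro exI[of _ y]) simp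
  qed
  interpret orth_chart e UNIV dist 0 "\<lambda>x. x" "\<lambda>A. A" "\<lambda>x. x + e 0" "\<lambda>x. x - e 0"
  proof (unfold_locales)
    fix A B g :: "'a \<Rightarrow> 'a" and x y :: 'a and i :: nat and \<epsilon> \<delta> :: real
    show "A \<in> carrier (isom_group UNIV dist)" if "A \<in> orth"
      using that linear_diff[OF orth_linear[OF that]] orth_norm[OF that] orth_bij[OF that]
      by (simp add: G dist_norm flip: linear_diff[OF orth_linear[OF that]])
    show "A \<circ> B = compose UNIV A B" by (simp add: compose_def fun_eq_iff)
    show "A 0 = 0" if "A \<in> orth" by (rule linear_0[OF orth_linear[OF that]])
    show "\<exists>A\<in>orth. g = A" if "g \<in> carrier (isom_group UNIV dist)" "g 0 = 0"
    proof -
      have b: "bij g" and dg: "\<And>x y. dist (g x) (g y) = dist x y" using that(1) by (auto simp: G)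
      have ng: "norm (g x) = norm x" for x using dg[of x 0] that(2) by (simp add: dist_norm)
      have "g x \<bullet> g y = x \<bullet> y" for x y
      proof -
        have "(norm (g x - g y))\<^sup>2 = (norm (x - y))\<^sup>2" using dg[of x y] by (simp add: dist_norm)
        moreover have "(norm (v - w))\<^sup>2 = (norm v)\<^sup>2 - 2 * (v \<bullet> w) + (norm w)\<^sup>2" for v w :: 'a
          unfolding power2_norm_eq_inner by (simp add: inner_diff_left inner_diff_right inner_commute[of w v])
        ultimately show ?thesis by (simp add: ng)
      qed
      then show ?thesis using b by (auto simp: orth_def bij_is_surj)
    qed
    show "\<exists>x\<in>UNIV. x = e i" by simp
    show "dist x 0 \<le> norm x" by simp
    show "norm x = norm y" if "dist x 0 = dist y 0" using that by simp
    show "dist x y \<le> norm (x - y)" by (simp add: dist_norm)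
    show "\<exists>\<delta>>0. \<forall>x\<in>UNIV. \<forall>y\<in>UNIV. dist x 0 = dist y 0 \<longrightarrow> dist x y < \<delta> \<longrightarrow> norm (x - y) < \<epsilon>" if "\<epsilon> > 0"
      using that by (intro exI[of _ \<epsilon>]) (simp add: dist_norm)
    have tr: "(\<lambda>x. x + c) \<in> carrier (isom_group UNIV dist)" for c :: 'a
    proof -
      have "bij (\<lambda>x. x + c)" by (rule o_bij[of "\<lambda>x. x - c"]) (simp_all add: fun_eq_iff)
      then show ?thesis by (simp add: G)
    qed
    show "(\<lambda>x. x + e 0) \<in> carrier (isom_group UNIV dist)" by (rule tr)
    show "(\<lambda>x. x - e 0) \<in> carrier (isom_group UNIV dist)" using tr[of "- e 0"] by simp
    have "e 0 \<noteq> 0" using e_norm[of 0] by force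
    then show "0 + e 0 \<noteq> 0" "0 - e 0 \<noteq> 0" by simp_all
    show "\<exists>\<delta>'>0. \<forall>x\<in>UNIV. dist x 0 < \<delta>' \<longrightarrow> (\<exists>y\<in>UNIV. dist y 0 < \<delta> \<and>
        (dist y (0 + e 0) = dist 0 (0 + e 0) \<and> dist y (0 - e 0) = dist x (0 - e 0) \<or>
         dist y (0 - e 0) = dist 0 (0 - e 0) \<and> dist y (0 + e 0) = dist x (0 + e 0)))" if "\<delta> > 0"
    proof (intro exI[of _ "min 1 (\<delta>\<^sup>2 / 2)"] conjI ballI impI)
      show "0 < min 1 (\<delta>\<^sup>2 / 2)" using that by simp
      fix x :: 'a assume "dist x 0 < min 1 (\<delta>\<^sup>2 / 2)"
      then have x: "norm x < min 1 (\<delta>\<^sup>2 / 2)" by simp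
      have *: "(dist x v)\<^sup>2 < 1" if "dist x v < 1" for v using power_strict_mono[OF that, of 2] by simp
      \<comment> \<open>The parallelogram law puts \<open>x\<close> outside one of the two open unit
        balls, which decides about which centre the first step turns.\<close>
      have "(dist x (e 0))\<^sup>2 + (dist x (- e 0))\<^sup>2 = 2 * (norm x)\<^sup>2 + 2"
        unfolding dist_norm power2_norm_eq_inner
        by (simp add: inner_diff_left inner_diff_right inner_add_left inner_add_right)
      then have "2 \<le> (dist x (e 0))\<^sup>2 + (dist x (- e 0))\<^sup>2" by simp
      then have "dist x (e 0) \<ge> 1 \<or> dist x (- e 0) \<ge> 1"
        using *[of "e 0"] *[of "- e 0"]
        by (cases "dist x (e 0) < 1"; cases "dist x (- e 0) < 1") auto
      then show "\<exists>y\<in>UNIV. dist y 0 < \<delta> \<and>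
        (dist y (0 + e 0) = dist 0 (0 + e 0) \<and> dist y (0 - e 0) = dist x (0 - e 0) \<or>
         dist y (0 - e 0) = dist 0 (0 - e 0) \<and> dist y (0 + e 0) = dist x (0 + e 0))"
      proof
        assume "dist x (e 0) \<ge> 1"
        from key[of "e 0" "e 1", OF _ _ _ that x this] show ?thesis by auto
      next
        assume "dist x (- e 0) \<ge> 1"
        from key[of "- e 0" "e 1", OF _ _ _ that x this] show ?thesis by auto
      qed
    qed
  qed simp_all
  show ?thesis by (rule steinhaus_isom_group)
qed

section \<open>The hyperboloid in a linear chart\<close>

context hilbert
begin

text \<open>The unilateral shift identifies the whole space with the complement of
  \<open>e 0\<close>, so that the stabilizer of \<open>e 0\<close> acts on a chart of the original
  type and the results on \<open>orth\<close> apply directly.\<close>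

definition shift :: "'a \<Rightarrow> 'a" where
  "shift = (SOME S. (\<forall>x y. S x \<bullet> S y = x \<bullet> y) \<and> (\<forall>i. S (e i) = e (Suc i)))"

lemma shift: "shift x \<bullet> shift y = x \<bullet> y" "shift (e i) = e (Suc i)"
proof -
  have "orthonormal_on UNIV (\<lambda>i. e (Suc i))" by (simp add: orthonormal_on_def)
  then have "\<exists>S. (\<forall>x y. S x \<bullet> S y = x \<bullet> y) \<and> (\<forall>i. S (e i) = e (Suc i))"
    by (rule isometric_extension[OF hilbert_basisD[OF basis]]) auto
  from someI_ex[OF this] show "shift x \<bullet> shift y = x \<bullet> y" "shift (e i) = e (Suc i)"
    unfolding shift_def by blast+
qed

lemma shift_linear: "linear shift" by (rule isometric_linear) (rule shift)

lemma shift_e0: "shift x \<bullet> e 0 = 0"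
proof -
  note l = shift_linear
  have "subspace {x. shift x \<bullet> e 0 = 0}"
    by (auto simp: subspace_def linear_add[OF l] linear_cmul[OF l] linear_0[OF l] inner_add_left)
  moreover have "closed {x. shift x \<bullet> e 0 = 0}"
    by (intro closed_Collect_eq continuous_intros linear_continuous_on isometric_bounded_linear shift(1))
  ultimately have "cspan UNIV \<subseteq> {x. shift x \<bullet> e 0 = 0}" by (rule cspan_subset) (simp add: shift)
  then show ?thesis by (auto simp: mem_cspan)
qed

lemma shift_norm: "norm (shift x) = norm x" by (rule isometric_norm) (rule shift)

lemma shift_inj: "shift x = shift y \<Longrightarrow> x = y"
  using shift_norm[of "x - y"] by (simp add: linear_diff[OF shift_linear])

lemma ex_shift:
  assumes "x \<bullet> e 0 = 0"
  shows "\<exists>v. shift v = x"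
proof -
  note l = shift_linear
  have cl: "closed (range shift)" by (rule isometric_closed_range[OF shift(1)])
  have "cspan (- {0}) \<subseteq> range shift"
  proof (rule cspan_subset[OF linear_subspace_image[OF l subspace_UNIV] cl])
    fix i :: nat assume "i \<in> - {0}"
    then have "e i = shift (e (i - 1))" by (simp add: shift)
    then show "e i \<in> range shift" by blast
  qed
  moreover have "x \<in> cspan (- {0})" using assms by (simp add: mem_cspan)
  ultimately show ?thesis by blast
qed

text \<open>The hyperboloid is a graph over the complement of \<open>e 0\<close>, so this spatial
  part determines a point of \<open>hyp_space e\<close>; \<open>hyp_point\<close> is the
  inverse.\<close>

definition hyp_chart :: "'a \<Rightarrow> 'a" where
  "hyp_chart x = (SOME v. shift v = x - (x \<bullet> e 0) *\<^sub>R e 0)"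

definition hyp_point :: "'a \<Rightarrow> 'a" where
  "hyp_point v = sqrt (1 + (norm v)\<^sup>2) *\<^sub>R e 0 + shift v"

lemma shift_hyp_chart: "shift (hyp_chart x) = x - (x \<bullet> e 0) *\<^sub>R e 0"
  unfolding hyp_chart_def by (rule someI_ex, rule ex_shift) (simp add: inner_diff_left)

lemma hyp_form_chart: "hyp_form e x y = (x \<bullet> e 0) * (y \<bullet> e 0) - hyp_chart x \<bullet> hyp_chart y"
  unfolding hyp_form_split[OF basis] by (simp only: shift_hyp_chart[symmetric] shift)

lemma hyp_point_e0: "hyp_point v \<bullet> e 0 = sqrt (1 + (norm v)\<^sup>2)"
  by (simp add: hyp_point_def inner_add_left shift_e0)

lemma hyp_chart_point: "hyp_chart (hyp_point v) = v"
proof -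
  have "shift (hyp_chart (hyp_point v)) = shift v"
    unfolding shift_hyp_chart hyp_point_e0 by (simp add: hyp_point_def)
  then show ?thesis by (rule shift_inj)
qed

lemma hyp_space_e0:
  assumes "x \<in> hyp_space e"
  shows "x \<bullet> e 0 = sqrt (1 + (norm (hyp_chart x))\<^sup>2)"
proof -
  have "(x \<bullet> e 0)\<^sup>2 = 1 + (norm (hyp_chart x))\<^sup>2" "x \<bullet> e 0 > 0"
    using assms unfolding hyp_space_iff[OF basis] hyp_form_chart
    by (simp_all add: power2_eq_square[of "x \<bullet> e 0"] power2_norm_eq_inner)
  then show ?thesis by (metis less_imp_le real_sqrt_unique)
qed

lemma hyp_point_mem: "hyp_point v \<in> hyp_space e"
proof -
  have "0 < 1 + (norm v)\<^sup>2" by (rule add_pos_nonneg) auto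
  then show ?thesis
    by (simp add: hyp_space_iff[OF basis] hyp_form_chart hyp_point_e0 hyp_chart_point
        flip: power2_norm_eq_inner)
qed

lemma hyp_point_chart: "x \<in> hyp_space e \<Longrightarrow> hyp_point (hyp_chart x) = x"
  by (simp add: hyp_point_def shift_hyp_chart hyp_space_e0)

lemma hyp_chart_e0: "hyp_chart (e 0) = 0"
proof -
  have "norm (shift (hyp_chart (e 0))) = 0" by (simp add: shift_hyp_chart)
  then show ?thesis by (simp add: shift_norm)
qed

lemma e0_mem: "e 0 \<in> hyp_space e"
  using hyp_point_mem[of 0] by (simp add: hyp_point_def linear_0[OF shift_linear])

lemma cosh_hyp_dist:
  assumes "x \<in> hyp_space e" "y \<in> hyp_space e"
  shows "cosh (hyp_dist e x y) = hyp_form e x y" "hyp_dist e x y \<ge> 0"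
  using hyp_form_ge_1[OF basis assms] assms by (auto simp: hyp_dist_def)

lemma hyp_dist_eq_iff:
  assumes "x \<in> hyp_space e" "y \<in> hyp_space e" "x' \<in> hyp_space e" "y' \<in> hyp_space e"
  shows "hyp_dist e x y = hyp_dist e x' y' \<longleftrightarrow> hyp_form e x y = hyp_form e x' y'"
proof
  assume "hyp_dist e x y = hyp_dist e x' y'"
  then show "hyp_form e x y = hyp_form e x' y'"
    using cosh_hyp_dist(1)[OF assms(1,2)] cosh_hyp_dist(1)[OF assms(3,4)] by metis
qed (simp add: hyp_dist_def assms)

lemma hyp_form_e0: "hyp_form e x (e 0) = x \<bullet> e 0"
  by (simp add: hyp_form_chart hyp_chart_e0)

lemma norm_hyp_chart:
  assumes "x \<in> hyp_space e"
  shows "norm (hyp_chart x) = sinh (hyp_dist e x (e 0))"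
proof -
  have "(cosh (hyp_dist e x (e 0)))\<^sup>2 = 1 + (norm (hyp_chart x))\<^sup>2"
    unfolding cosh_hyp_dist(1)[OF assms e0_mem] hyp_form_e0 hyp_space_e0[OF assms] by simp
  then have "(norm (hyp_chart x))\<^sup>2 = (sinh (hyp_dist e x (e 0)))\<^sup>2" by (simp add: cosh_square_eq)
  then show ?thesis
    using cosh_hyp_dist(2)[OF assms e0_mem] by (simp add: power2_eq_iff_nonneg)
qed

text \<open>On a sphere about \<open>e 0\<close> the time coordinates agree, so the form is a
  constant minus the inner product of the chart vectors, and the half-argument formula gives an
  exact chord length. Both comparisons \<open>\<phi>_le\<close> and \<open>\<phi>_cont\<close>
  follow from it.\<close>

lemma norm_hyp_chart_diff:
  assumes x: "x \<in> hyp_space e" and y: "y \<in> hyp_space e" and xy: "hyp_dist e x (e 0) = hyp_dist e y (e 0)"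
  shows "norm (hyp_chart x - hyp_chart y) = 2 * sinh (hyp_dist e x y / 2)"
proof -
  define n where "n = norm (hyp_chart x)"
  have n: "norm (hyp_chart y) = n" using norm_hyp_chart[OF x] norm_hyp_chart[OF y] xy by (simp add: n_def)
  have "cosh (hyp_dist e x y) = 1 + n\<^sup>2 - hyp_chart x \<bullet> hyp_chart y"
    unfolding cosh_hyp_dist(1)[OF x y] hyp_form_chart hyp_space_e0[OF x] hyp_space_e0[OF y] n
    by (simp add: n_def)
  moreover have "(norm (hyp_chart x - hyp_chart y))\<^sup>2 = 2 * n\<^sup>2 - 2 * (hyp_chart x \<bullet> hyp_chart y)"
  proof -
    have "hyp_chart x \<bullet> hyp_chart x = n\<^sup>2" "hyp_chart y \<bullet> hyp_chart y = n\<^sup>2"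
      using n by (simp_all add: n_def flip: power2_norm_eq_inner)
    then show ?thesis
      unfolding power2_norm_eq_inner
      by (simp add: inner_diff_left inner_diff_right inner_commute[of "hyp_chart y" "hyp_chart x"])
  qed
  moreover have "cosh (hyp_dist e x y) = 1 + 2 * (sinh (hyp_dist e x y / 2))\<^sup>2"
    using cosh_double_cosh[of "hyp_dist e x y / 2"] by (simp add: cosh_square_eq)
  ultimately have "(norm (hyp_chart x - hyp_chart y))\<^sup>2 = (2 * sinh (hyp_dist e x y / 2))\<^sup>2"
    by (simp add: power_mult_distrib)
  then show ?thesis
    by (rule power2_eq_imp_eq) (use cosh_hyp_dist(2)[OF x y] in simp_all)
qed

lemma sinh_ge_self: "x \<ge> 0 \<Longrightarrow> x \<le> sinh x" for x :: real
proof -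
  assume x: "x \<ge> 0"
  have "sinh 0 - 0 \<le> sinh x - x"
  proof (rule DERIV_nonneg_imp_nondecreasing[OF x])
    fix t :: real
    show "\<exists>y. ((\<lambda>t. sinh t - t) has_real_derivative y) (at t) \<and> 0 \<le> y"
      by (intro exI[of _ "cosh t - 1"] conjI) (auto intro!: derivative_eq_intros simp: cosh_real_ge_1)
  qed
  then show ?thesis by simp
qed

lemma hyp_carrier:
  "f \<in> carrier (isom_group (hyp_space e) (hyp_dist e)) \<longleftrightarrow>
    f \<in> extensional (hyp_space e) \<and> bij_betw f (hyp_space e) (hyp_space e) \<and>
    (\<forall>x\<in>hyp_space e. \<forall>y\<in>hyp_space e. hyp_form e (f x) (f y) = hyp_form e x y)"
proof -
  have "(\<forall>x\<in>hyp_space e. \<forall>y\<in>hyp_space e. hyp_dist e (f x) (f y) = hyp_dist e x y) \<longleftrightarrow>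
    (\<forall>x\<in>hyp_space e. \<forall>y\<in>hyp_space e. hyp_form e (f x) (f y) = hyp_form e x y)"
    if "bij_betw f (hyp_space e) (hyp_space e)"
    using bij_betwE[OF that] by (intro ball_cong refl hyp_dist_eq_iff) auto
  then show ?thesis unfolding carrier_isom_group Bij_def by blast
qed

text \<open>The Lorentz reflection in the direction \<open>c - e 0\<close> exchanges \<open>e 0\<close> and \<open>c\<close>.\<close>

lemma hyp_transitive:
  assumes c: "c \<in> hyp_space e" "c \<noteq> e 0"
  shows "\<exists>t\<in>carrier (isom_group (hyp_space e) (hyp_dist e)). t (e 0) = c"
proof -
  let ?B = "hyp_form e"
  have add: "?B (f + g) h = ?B f h + ?B g h" and diff: "?B (f - g) h = ?B f h - ?B g h"
    and sc: "?B (k *\<^sub>R f) h = k * ?B f h" and sym: "?B f g = ?B g f" for f g h k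
    by (simp_all add: hyp_form_eq[OF basis] inner_add_left inner_diff_left inner_commute algebra_simps)
  have diff': "?B h (f - g) = ?B h f - ?B h g" and sc': "?B h (k *\<^sub>R f) = k * ?B h f" for f g h k
    using diff[of f g h] sc[of k f h] by (simp_all add: sym[of h])
  define n where "n = c - e 0"
  have one: "?B c c = 1" "?B (e 0) (e 0) = 1" using c(1) e0_mem by (simp_all add: hyp_space_iff[OF basis])
  have ge: "?B c (e 0) > 1" using hyp_form_ge_1[OF basis c(1) e0_mem] c(2) by auto
  \<comment> \<open>Negative because the form of two distinct points exceeds 1, so the reflection is
    defined.\<close>
  define \<nu> where "\<nu> = ?B n n"
  have \<nu>: "\<nu> = 2 - 2 * ?B c (e 0)" by (simp add: \<nu>_def n_def diff diff' one sym[of "e 0" c])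
  then have \<nu>0: "\<nu> \<noteq> 0" using ge by simp
  define R where "R x = x - (2 * ?B x n / \<nu>) *\<^sub>R n" for x
  have RR: "?B (R x) (R y) = ?B x y" for x y
    using \<nu>0 by (simp add: R_def diff diff' sc sc' \<nu>_def[symmetric] sym[of n y] field_simps)
  have inv: "R (R x) = x" for x
  proof -
    have "?B (R x) n = - ?B x n" using \<nu>0 by (simp add: R_def diff sc \<nu>_def[symmetric])
    then have "R (R x) = R x + (2 * ?B x n / \<nu>) *\<^sub>R n" unfolding R_def[of "R x"] by simp
    then show ?thesis by (simp add: R_def)
  qed
  have R0: "R (e 0) = c"
  proof -
    have "2 * ?B (e 0) n = - \<nu>" by (simp add: n_def diff' one \<nu> sym[of "e 0" c])
    then have "R (e 0) = e 0 + n" using \<nu>0 by (simp add: R_def)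
    then show ?thesis by (simp add: n_def)
  qed
  have mem: "R x \<in> hyp_space e" if x: "x \<in> hyp_space e" for x
  proof -
    \<comment> \<open>Applying \<open>R\<close> to both arguments turns the time coordinate of
      \<open>R x\<close> into the form of \<open>x\<close> and \<open>c\<close>, which is at least
      1: \<open>R\<close> keeps the sheet.\<close>
    have "R x \<bullet> e 0 = ?B (R x) (R (R (e 0)))" by (simp add: inv hyp_form_e0)
    also have "\<dots> = ?B x c" by (simp only: RR R0)
    also have "\<dots> > 0" using hyp_form_ge_1[OF basis x c(1)] by linarith
    finally show ?thesis using x by (simp add: hyp_space_iff[OF basis] RR)
  qed
  define t where "t = restrict R (hyp_space e)"
  have "t \<in> carrier (isom_group (hyp_space e) (hyp_dist e))"
    unfolding hyp_carrier
  proof (intro conjI ballI)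
    show "bij_betw t (hyp_space e) (hyp_space e)"
      by (rule bij_betw_byWitness[where f' = t]) (auto simp: t_def inv mem)
  qed (simp_all add: t_def RR)
  moreover have "t (e 0) = c" by (simp add: t_def e0_mem R0)
  ultimately show ?thesis by blast
qed

definition hyp_rot :: "('a \<Rightarrow> 'a) \<Rightarrow> 'a \<Rightarrow> 'a" where
  "hyp_rot A = (\<lambda>x\<in>hyp_space e. hyp_point (A (hyp_chart x)))"

lemma hyp_form_rot:
  assumes "A \<in> orth" "x \<in> hyp_space e" "y \<in> hyp_space e"
  shows "hyp_form e (hyp_rot A x) (hyp_rot A y) = hyp_form e x y"
  using assms by (simp add: hyp_rot_def hyp_form_chart hyp_point_e0 hyp_chart_point orth_norm orth_inner hyp_space_e0)

lemma hyp_rot_carrier: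
  assumes A: "A \<in> orth"
  shows "hyp_rot A \<in> carrier (isom_group (hyp_space e) (hyp_dist e))"
  unfolding hyp_carrier
proof (intro conjI ballI hyp_form_rot[OF A])
  show "bij_betw (hyp_rot A) (hyp_space e) (hyp_space e)"
    by (rule bij_betw_byWitness[where f' = "hyp_rot (finv A)"])
      (auto simp: hyp_rot_def hyp_point_mem hyp_chart_point orth_inv_apply A hyp_point_chart)
qed (simp_all add: hyp_rot_def)

text \<open>An isometry fixing \<open>e 0\<close> keeps the time coordinate, so preserving the form
  amounts to preserving the inner product of chart vectors.\<close>

lemma hyp_stabilizer:
  assumes g: "g \<in> carrier (isom_group (hyp_space e) (hyp_dist e))" and g0: "g (e 0) = e 0"
  shows "\<exists>A\<in>orth. g = hyp_rot A"
proof -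
  have gM: "g x \<in> hyp_space e" if "x \<in> hyp_space e" for x
    using g that unfolding hyp_carrier by (blast dest: bij_betwE)
  have gB: "hyp_form e (g x) (g y) = hyp_form e x y" if "x \<in> hyp_space e" "y \<in> hyp_space e" for x y
    using g that unfolding hyp_carrier by blast
  define A where "A v = hyp_chart (g (hyp_point v))" for v
  have ge0: "g (hyp_point v) \<bullet> e 0 = hyp_point v \<bullet> e 0" for v
    using gB[OF hyp_point_mem e0_mem, of v] by (simp add: g0 hyp_form_e0)
  have "A v \<bullet> A w = v \<bullet> w" for v w
    using gB[OF hyp_point_mem hyp_point_mem, of v w]
    by (simp add: A_def hyp_form_chart ge0 hyp_chart_point)
  moreover have "surj A"
  proof (rule surjI)
    fix w
    have "hyp_point w \<in> g ` hyp_space e" using g hyp_point_mem unfolding hyp_carrier bij_betw_def by blast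
    then have "inv_into (hyp_space e) g (hyp_point w) \<in> hyp_space e" "g (inv_into (hyp_space e) g (hyp_point w)) = hyp_point w"
      by (simp_all add: inv_into_into f_inv_into_f)
    then show "A (hyp_chart (inv_into (hyp_space e) g (hyp_point w))) = w"
      by (simp add: A_def hyp_point_chart hyp_chart_point)
  qed
  ultimately have "A \<in> orth" by (simp add: orth_def)
  moreover have "g = hyp_rot A"
  proof (rule extensionalityI)
    show "g \<in> extensional (hyp_space e)" using g unfolding hyp_carrier by blast
    show "hyp_rot A \<in> extensional (hyp_space e)" by (simp add: hyp_rot_def)
    show "g x = hyp_rot A x" if "x \<in> hyp_space e" for x
      using that by (simp add: hyp_rot_def A_def hyp_point_chart gM)
  qed
  ultimately show ?thesis by blast
qed

text \<open>The counterpart of \<open>key\<close> in \<open>hilbert_steinhaus\<close>. Both centres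
  have time coordinate \<open>sqrt 2\<close>, and spheres about them are cut out of the hyperboloid
  by equations linear in the point.\<close>

lemma hyp_connect:
  assumes u: "norm u = 1" "norm n = 1" "u \<bullet> n = 0" and \<delta>: "\<delta> > 0"
    and x: "x \<in> hyp_space e" "exp (hyp_dist e x (e 0)) - 1 < min 2 (cosh \<delta> - 1)"
    and ge: "hyp_form e x (hyp_point u) \<ge> sqrt 2"
  shows "\<exists>y\<in>hyp_space e. hyp_dist e y (e 0) < \<delta> \<and>
    hyp_dist e y (hyp_point (- u)) = hyp_dist e (e 0) (hyp_point (- u)) \<and>
    hyp_dist e y (hyp_point u) = hyp_dist e x (hyp_point u)"
proof -
  define r where "r = hyp_dist e x (e 0)"
  \<comment> \<open>The point sought has time coordinate \<open>1 + \<mu>\<close>. Keeping the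
    distance to \<open>hyp_point (- u)\<close> forces
    \<open>v \<bullet> u = - sqrt 2 * \<mu>\<close>, and the prescribed form with
    \<open>hyp_point u\<close> then gives \<open>\<mu>\<close>.\<close>
  define \<mu> where "\<mu> = (hyp_form e x (hyp_point u) - sqrt 2) / (2 * sqrt 2)"
  have \<mu>0: "\<mu> \<ge> 0" using ge by (simp add: \<mu>_def)
  have form: "hyp_form e z (hyp_point v) = sqrt 2 * (z \<bullet> e 0) - hyp_chart z \<bullet> v" if "norm v = 1" for z v
    using that by (simp add: hyp_form_chart hyp_point_e0 hyp_chart_point)
  have xe: "x \<bullet> e 0 = cosh r" using cosh_hyp_dist(1)[OF x(1) e0_mem] by (simp add: r_def hyp_form_e0)
  \<comment> \<open>Both \<open>cosh r - 1\<close> and \<open>sinh r\<close> are given the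
    coefficient \<open>2 * sqrt 2\<close>, since their sum is \<open>exp r - 1\<close>.\<close>
  have "\<mu> \<le> exp r - 1"
  proof -
    have "\<bar>hyp_chart x \<bullet> u\<bar> \<le> sinh r"
      using Cauchy_Schwarz_ineq2[of "hyp_chart x" u] u by (simp add: norm_hyp_chart[OF x(1)] r_def)
    then have "hyp_form e x (hyp_point u) - sqrt 2 \<le> sqrt 2 * (cosh r - 1) + sinh r"
      by (simp add: form[OF u(1)] xe algebra_simps)
    also have "\<dots> \<le> 2 * sqrt 2 * (cosh r - 1) + 2 * sqrt 2 * sinh r"
    proof (intro add_mono mult_right_mono)
      have "0 \<le> sinh r" using cosh_hyp_dist(2)[OF x(1) e0_mem] by (simp add: r_def)
      moreover have "1 \<le> 2 * sqrt 2" using real_sqrt_ge_1_iff[of 2] by linarith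
      ultimately show "sinh r \<le> 2 * sqrt 2 * sinh r" using mult_right_mono[of 1 "2 * sqrt 2" "sinh r"] by simp
    qed (simp_all add: cosh_real_ge_1)
    also have "\<dots> = 2 * sqrt 2 * (exp r - 1)"
      unfolding cosh_plus_sinh[of r, symmetric] by (simp add: algebra_simps)
    finally show ?thesis by (simp add: \<mu>_def field_simps)
  qed
  then have \<mu>: "\<mu> < 2" "\<mu> < cosh \<delta> - 1" using x(2) by (simp_all add: r_def)
  \<comment> \<open>The square of the component along \<open>n\<close>, left over from
    \<open>(norm v)\<^sup>2 = (1 + \<mu>)\<^sup>2 - 1\<close>; the bound 2 in the hypothesis on
    \<open>x\<close> serves this.\<close>
  have nn: "0 \<le> 2 * \<mu> - \<mu>\<^sup>2" using mult_right_mono[OF less_imp_le[OF \<mu>(1)] \<mu>0] by (simp add: power2_eq_square)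
  define v where "v = (- sqrt 2 * \<mu>) *\<^sub>R u + sqrt (2 * \<mu> - \<mu>\<^sup>2) *\<^sub>R n"
  have vu: "v \<bullet> u = - sqrt 2 * \<mu>" unfolding v_def by (rule orthonormal_pair[OF u])
  have vv: "(norm v)\<^sup>2 = 2 * \<mu> + \<mu>\<^sup>2"
    unfolding v_def orthonormal_pair(2)[OF u] real_sqrt_pow2[OF nn] by (simp add: power_mult_distrib)
  have "1 + (norm v)\<^sup>2 = (1 + \<mu>)\<^sup>2" unfolding vv by (simp add: power2_eq_square algebra_simps)
  then have w: "hyp_point v \<bullet> e 0 = 1 + \<mu>" using \<mu>0 by (simp add: hyp_point_e0)
  have "cosh (hyp_dist e (hyp_point v) (e 0)) < cosh \<delta>"
    using \<mu>(2) by (simp add: cosh_hyp_dist[OF hyp_point_mem e0_mem] hyp_form_e0 w)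
  then have "hyp_dist e (hyp_point v) (e 0) < \<delta>"
    using cosh_hyp_dist(2)[OF hyp_point_mem e0_mem] \<delta> by (simp add: cosh_real_nonneg_less_iff)
  moreover have "hyp_form e (hyp_point v) (hyp_point (- u)) = hyp_form e (e 0) (hyp_point (- u))"
    using u(1) by (simp add: form w hyp_chart_point vu hyp_chart_e0 algebra_simps)
  moreover have "hyp_form e (hyp_point v) (hyp_point u) = hyp_form e x (hyp_point u)"
  proof -
    have "hyp_form e (hyp_point v) (hyp_point u) = sqrt 2 + 2 * sqrt 2 * \<mu>"
      using u(1) by (simp add: form w hyp_chart_point vu algebra_simps)
    then show ?thesis by (simp add: \<mu>_def)
  qed
  ultimately show ?thesis
    using x(1) by (intro bexI[OF _ hyp_point_mem[of v]]) (simp add: hyp_dist_eq_iff hyp_point_mem e0_mem)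
qed

end

lemma hyperbolic_steinhaus:
  fixes e :: "nat \<Rightarrow> 'a::{real_inner,complete_space}"
  assumes "hilbert_basis e"
  shows "steinhaus_property (isom_group (hyp_space e) (hyp_dist e)) (isom_topology (hyp_space e) (hyp_dist e))"
proof -
  interpret hilbert e by unfold_locales (rule assms)
  let ?M = "hyp_space e" and ?d = "hyp_dist e"
  interpret H: Metric_space ?M ?d by (rule Metric_space_hyp[OF assms])
  have "hyp_point v \<noteq> e 0" if "norm v = 1" for v
    using hyp_chart_point[of v] hyp_chart_e0 that by (metis norm_zero zero_neq_one)
  then have p: "hyp_point (e 0) \<noteq> e 0" "hyp_point (- e 0) \<noteq> e 0" by simp_all
  obtain ta where ta: "ta \<in> carrier (isom_group ?M ?d)" "ta (e 0) = hyp_point (e 0)"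
    using hyp_transitive[OF hyp_point_mem p(1)] by blast
  obtain tb where tb: "tb \<in> carrier (isom_group ?M ?d)" "tb (e 0) = hyp_point (- e 0)"
    using hyp_transitive[OF hyp_point_mem p(2)] by blast
  interpret orth_chart e ?M ?d "e 0" hyp_chart hyp_rot ta tb
  proof (unfold_locales)
    fix A B g :: "'a \<Rightarrow> 'a" and x y :: 'a and i :: nat and \<epsilon> \<delta> :: real
    show "e 0 \<in> ?M" by (rule e0_mem)
    show "hyp_rot A \<in> carrier (isom_group ?M ?d)" if "A \<in> orth" by (rule hyp_rot_carrier[OF that])
    show "hyp_rot (A \<circ> B) = compose ?M (hyp_rot A) (hyp_rot B)"
      by (auto simp: hyp_rot_def compose_def hyp_point_mem hyp_chart_point fun_eq_iff)
    show "hyp_rot A (e 0) = e 0" if "A \<in> orth"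
      using hyp_point_chart[OF e0_mem]
      by (simp add: hyp_rot_def e0_mem hyp_chart_e0 linear_0[OF orth_linear[OF that]])
    show "\<exists>A\<in>orth. g = hyp_rot A" if "g \<in> carrier (isom_group ?M ?d)" "g (e 0) = e 0"
      by (rule hyp_stabilizer[OF that])
    show "hyp_chart (hyp_rot A x) = A (hyp_chart x)" if "x \<in> ?M" using that by (simp add: hyp_rot_def hyp_chart_point)
    show "x = y" if "x \<in> ?M" "y \<in> ?M" "hyp_chart x = hyp_chart y"
      using hyp_point_chart[OF that(1)] hyp_point_chart[OF that(2)] that(3) by metis
    show "\<exists>x\<in>?M. hyp_chart x = e i" using hyp_point_mem hyp_chart_point by blast
    show "?d x (e 0) \<le> norm (hyp_chart x)" if "x \<in> ?M"
      using sinh_ge_self[OF cosh_hyp_dist(2)[OF that e0_mem]] by (simp add: norm_hyp_chart[OF that])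
    show "norm (hyp_chart x) = norm (hyp_chart y)" if "x \<in> ?M" "y \<in> ?M" "?d x (e 0) = ?d y (e 0)"
      using that by (simp add: norm_hyp_chart)
    show "?d x y \<le> norm (hyp_chart x - hyp_chart y)" if "x \<in> ?M" "y \<in> ?M" "?d x (e 0) = ?d y (e 0)"
      using sinh_ge_self[of "?d x y / 2"] cosh_hyp_dist(2)[OF that(1,2)] by (simp add: norm_hyp_chart_diff[OF that])
    show "\<exists>\<delta>>0. \<forall>x\<in>?M. \<forall>y\<in>?M. ?d x (e 0) = ?d y (e 0) \<longrightarrow> ?d x y < \<delta> \<longrightarrow> norm (hyp_chart x - hyp_chart y) < \<epsilon>"
      if "\<epsilon> > 0"
    proof (intro exI[of _ "2 * arsinh (\<epsilon> / 2)"] conjI ballI impI)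
      show "0 < 2 * arsinh (\<epsilon> / 2)" using that by simp
      fix x y assume xy: "x \<in> ?M" "y \<in> ?M" "?d x (e 0) = ?d y (e 0)" "?d x y < 2 * arsinh (\<epsilon> / 2)"
      then have "?d x y / 2 < arsinh (\<epsilon> / 2)" by simp
      then have "sinh (?d x y / 2) < sinh (arsinh (\<epsilon> / 2))" by (simp only: sinh_real_less_iff)
      then show "norm (hyp_chart x - hyp_chart y) < \<epsilon>" using norm_hyp_chart_diff[OF xy(1-3)] by simp
    qed
    show "ta \<in> carrier (isom_group ?M ?d)" "tb \<in> carrier (isom_group ?M ?d)" by (rule ta tb)+
    show "ta (e 0) \<noteq> e 0" "tb (e 0) \<noteq> e 0" using ta tb p by simp_all
    show "\<exists>\<delta>'>0. \<forall>x\<in>?M. ?d x (e 0) < \<delta>' \<longrightarrow> (\<exists>y\<in>?M. ?d y (e 0) < \<delta> \<and>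
        (?d y (ta (e 0)) = ?d (e 0) (ta (e 0)) \<and> ?d y (tb (e 0)) = ?d x (tb (e 0)) \<or>
         ?d y (tb (e 0)) = ?d (e 0) (tb (e 0)) \<and> ?d y (ta (e 0)) = ?d x (ta (e 0))))" if \<delta>: "\<delta> > 0"
      unfolding ta(2) tb(2)
    proof (intro exI conjI ballI impI)
      let ?m = "min 2 (cosh \<delta> - 1)"
      have "cosh 0 < cosh \<delta>" using \<delta> by (subst cosh_real_nonneg_less_iff) auto
      then have m: "?m > 0" by simp
      then show "0 < ln (1 + ?m)" by simp
      fix x assume x: "x \<in> ?M" "?d x (e 0) < ln (1 + ?m)"
      have "exp (?d x (e 0)) < exp (ln (1 + ?m))" using x(2) by simp
      then have ex: "exp (?d x (e 0)) - 1 < ?m" using m by (simp only: exp_ln add_pos_pos zero_less_one)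
      \<comment> \<open>The spatial terms cancel, so the sum is at least \<open>2 * sqrt 2\<close>
        and one of the two centres meets the hypothesis of \<open>hyp_connect\<close>.\<close>
      have "hyp_form e x (hyp_point (e 0)) + hyp_form e x (hyp_point (- e 0)) = 2 * sqrt 2 * (x \<bullet> e 0)"
        by (simp add: hyp_form_chart hyp_point_e0 hyp_chart_point)
      moreover have "x \<bullet> e 0 \<ge> 1" by (simp add: hyp_space_e0[OF x(1)])
      then have "2 * sqrt 2 * 1 \<le> 2 * sqrt 2 * (x \<bullet> e 0)" by (intro mult_left_mono) auto
      ultimately consider "hyp_form e x (hyp_point (e 0)) \<ge> sqrt 2" | "hyp_form e x (hyp_point (- e 0)) \<ge> sqrt 2"
        by linarith
      then show "\<exists>y\<in>?M. ?d y (e 0) < \<delta> \<and>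
        (?d y (hyp_point (e 0)) = ?d (e 0) (hyp_point (e 0)) \<and> ?d y (hyp_point (- e 0)) = ?d x (hyp_point (- e 0)) \<or>
         ?d y (hyp_point (- e 0)) = ?d (e 0) (hyp_point (- e 0)) \<and> ?d y (hyp_point (e 0)) = ?d x (hyp_point (e 0)))"
      proof cases
        case 1
        from hyp_connect[of "e 0" "e 1", OF _ _ _ \<delta> x(1) ex this] show ?thesis by auto
      next
        case 2
        from hyp_connect[of "- e 0" "e 1", OF _ _ _ \<delta> x(1) ex this] show ?thesis by auto
      qed
    qed
  qed
  show ?thesis by (rule steinhaus_isom_group)
qed

theorem theorem4p1:
  fixes e :: "nat \<Rightarrow> 'a::{real_inner, complete_space}"
  assumes "hilbert_basis e"
  shows "steinhaus_property (isom_group (hyp_space e) (hyp_dist e))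
                            (isom_topology (hyp_space e) (hyp_dist e))
       \<and> steinhaus_property (isom_group (UNIV :: 'a set) dist)
                            (isom_topology (UNIV :: 'a set) dist)"
  using hyperbolic_steinhaus[OF assms] hilbert_steinhaus[OF assms] ..

end
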